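(* Let $s_*>3/2$ and let $W\in L^2(\mathbb{T};\mathbb{R})$ be the even random potential defined by $$W(x)=\sum_{k\ge1}X_k\langle k\rangle^{-s_*}\cos(kx),$$ where the $X_k\sim\mathcal{N}(0,1)$, $k\ge1$, are independent normalized real Gaussian random variables. For $k\ge1$, let $\omega_k:=\lambda_k$ be the $k$-th smallest eigenvalue of the Sturm--Liouville operator $-\partial_x^2+W$ with homogeneous Dirichlet boundary conditions on $[0,\pi]$. Then there exists a constant $\eta>0$ such that, almost surely, provided that $\|W\|_{H^1}\le\eta$, the frequencies $\omega=(\omega_k)_{k\ge1}$ are strongly-non-resonant.
   Context: $\mathbb{T}=\mathbb{R}/2\pi\mathbb{Z}$, $\langle x\rangle=(1+x^2)^{1/2}$, $\mathbb{Z}^*=\mathbb{Z}\setminus\{0\}$. Dirichlet spectrum: $(\lambda_n)_{n\ge1}$ is the increasing sequence of real numbers for which there is a Hilbertian basis $(f_n)_{n\ge1}$ of $L^2(0,\pi)$ with $f_n\in H^2\cap H^1_0$ and $-\partial_x^2f_n+Wf_n=\lambda_nf_n$ on $(0,\pi)$. Strong non-resonance: given $\mathcal{I}\subset\mathbb{Z}$, a family $\omega\in\mathbb{R}^{\mathcal{I}}$ is strongly-non-resonant if there exist $\alpha,\rho>0$ such that for all $q\ge1$, all $\boldsymbol{m}\in(\mathbb{Z}^* )^q$ with $\boldsymbol{m}_1+\cdots+\boldsymbol{m}_q=0$, and all distinct $\boldsymbol{h}_1,\dots,\boldsymbol{h}_q\in\mathcal{I}$, $$\Big|\sum_{j=1}^q\boldsymbol{m}_j\omega_{\boldsymbol{h}_j}\Big|\ge\rho\big(2\min_{1\le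 j\le q}\langle\boldsymbol{h}_j\rangle\big)^{-\exp(\alpha|\boldsymbol{m}|_1)},\qquad|\boldsymbol{m}|_1=|\boldsymbol{m}_1|+\cdots+|\boldsymbol{m}_q|.$$ Here $\mathcal{I}=\{1,2,3,\dots\}$. *)

theory Defs
  imports "HOL-Probability.Probability"
begin

definition japanese_bracket :: "real \<Rightarrow> real" where
  "japanese_bracket x = sqrt (1 + x\<^sup>2)"


subsection \<open>Square-integrable functions and Sobolev spaces on an open set\<close>

text \<open>
  Elements of the function spaces below are functions, not classes modulo equality almost everywhere.
  Only notions that are invariant under almost everywhere equality on the underlying set are used.
\<close>

definition square_integrable :: "real measure \<Rightarrow> (real \<Rightarrow> real) set" where
  "square_integrable M = {f \<in> borel_measurable M. integrable M (\<lambda>x. (f x)\<^sup>2)}"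

definition test_functions :: "real set \<Rightarrow> (real \<Rightarrow> real) set" where
  "test_functions S =
     {\<phi>. (\<forall>n x. (deriv ^^ n) \<phi> differentiable at x) \<and>
         (\<exists>K. compact K \<and> K \<subseteq> S \<and> (\<forall>x. x \<notin> K \<longrightarrow> \<phi> x = 0))}"

text \<open>\<open>has_weak_deriv S k f g\<close>: the distributional derivative of order \<open>k\<close> of \<open>f\<close> on the open set
  \<open>S\<close> is the square-integrable function \<open>g\<close>.\<close>

definition has_weak_deriv :: "real set \<Rightarrow> nat \<Rightarrow> (real \<Rightarrow> real) \<Rightarrow> (real \<Rightarrow> real) \<Rightarrow> bool" where
  "has_weak_deriv S k f g \<longleftrightarrow>
     f \<in> square_integrable (lebesgue_on S) \<and> g \<in> square_integrable (lebesgue_on S) \<and>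
     (\<forall>\<phi>\<in>test_functions S.
        (LINT x|lebesgue_on S. f x * (deriv ^^ k) \<phi> x) =
        (-1) ^ k * (LINT x|lebesgue_on S. g x * \<phi> x))"

definition sobolev :: "real set \<Rightarrow> nat \<Rightarrow> (real \<Rightarrow> real) set" where
  "sobolev S k = {f. \<forall>j\<le>k. \<exists>g. has_weak_deriv S j f g}"

text \<open>The closure of the test functions in \<open>H\<^sup>1\<close>.\<close>

definition sobolev_1_0 :: "real set \<Rightarrow> (real \<Rightarrow> real) set" where
  "sobolev_1_0 S =
     {f. \<exists>g. has_weak_deriv S 1 f g \<and>
        (\<forall>\<epsilon>>0. \<exists>\<phi>\<in>test_functions S.
           (LINT x|lebesgue_on S. (f x - \<phi> x)\<^sup>2) +
           (LINT x|lebesgue_on S. (g x - deriv \<phi> x)\<^sup>2) < \<epsilon>)}"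


subsection \<open>Dirichlet spectrum\<close>

text \<open>A Hilbertian basis indexed by \<open>n \<ge> 1\<close>: an orthonormal family whose linear span is dense.\<close>

definition hilbert_basis :: "real measure \<Rightarrow> (nat \<Rightarrow> real \<Rightarrow> real) \<Rightarrow> bool" where
  "hilbert_basis M f \<longleftrightarrow>
     (\<forall>n\<ge>1. f n \<in> square_integrable M) \<and>
     (\<forall>m\<ge>1. \<forall>n\<ge>1. (LINT x|M. f m x * f n x) = (if m = n then 1 else 0)) \<and>
     (\<forall>g\<in>square_integrable M. \<forall>\<epsilon>>0. \<exists>N c.
        (LINT x|M. (g x - (\<Sum>n=1..N. c n * f n x))\<^sup>2) < \<epsilon>)"

definition is_dirichlet_spectrum :: "(real \<Rightarrow> real) \<Rightarrow> (nat \<Rightarrow> real) \<Rightarrow> bool" where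
  "is_dirichlet_spectrum W lam \<longleftrightarrow>
     strict_mono_on {1..} lam \<and>
     (\<exists>f. hilbert_basis (lebesgue_on {0<..<pi}) f \<and>
        (\<forall>n\<ge>1. f n \<in> sobolev {0<..<pi} 2 \<inter> sobolev_1_0 {0<..<pi} \<and>
           (\<exists>h. has_weak_deriv {0<..<pi} 2 (f n) h \<and>
              (AE x in lebesgue_on {0<..<pi}. - h x + W x * f n x = lam n * f n x))))"

text \<open>Only meaningful for \<open>k \<ge> 1\<close>.\<close>

definition dirichlet_eigenvalue :: "(real \<Rightarrow> real) \<Rightarrow> nat \<Rightarrow> real" where
  "dirichlet_eigenvalue W k = (THE l. \<exists>lam. is_dirichlet_spectrum W lam \<and> l = lam k)"


subsection \<open>The space \<open>H\<^sup>1\<close> of the torus\<close>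

text \<open>Functions on the torus are \<open>2 * pi\<close>-periodic functions on the real line.\<close>

definition fourier_coeff :: "(real \<Rightarrow> real) \<Rightarrow> int \<Rightarrow> complex" where
  "fourier_coeff u n =
     (LINT x|lebesgue_on {0..2*pi}. complex_of_real (u x) * cis (- real_of_int n * x)) / (2 * pi)"

definition H1_torus :: "(real \<Rightarrow> real) set" where
  "H1_torus =
     {u. (\<forall>x. u (x + 2 * pi) = u x) \<and> u \<in> square_integrable (lebesgue_on {0..2*pi}) \<and>
         (\<lambda>n. (japanese_bracket (real_of_int n))\<^sup>2 * (norm (fourier_coeff u n))\<^sup>2) summable_on UNIV}"

definition H1_torus_norm :: "(real \<Rightarrow> real) \<Rightarrow> real" where
  "H1_torus_norm u =
     sqrt (\<Sum>\<^sub>\<infinity>n\<in>UNIV. (japanese_bracket (real_of_int n))\<^sup>2 * (norm (fourier_coeff u n))\<^sup>2)"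


subsection \<open>The random potential and strong non-resonance\<close>

text \<open>The argument \<open>a\<close> is the sequence of values of the Gaussian variables. For \<open>s > 3/2\<close> the series
  converges absolutely almost surely; where it does not, \<^term>\<open>infsum\<close> returns \<open>0\<close>.\<close>

definition potential :: "real \<Rightarrow> (nat \<Rightarrow> real) \<Rightarrow> real \<Rightarrow> real" where
  "potential s a x =
     (\<Sum>\<^sub>\<infinity>k\<in>{1..}. a k * japanese_bracket (real k) powr (- s) * cos (real k * x))"

definition strongly_non_resonant :: "int set \<Rightarrow> (int \<Rightarrow> real) \<Rightarrow> bool" where
  "strongly_non_resonant I \<omega> \<longleftrightarrow>
     (\<exists>\<alpha>>0. \<exists>\<rho>>0. \<forall>q\<ge>1. \<forall>m :: nat \<Rightarrow> int. \<forall>h :: nat \<Rightarrow> int.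
        (\<forall>j\<in>{1..q}. m j \<noteq> 0) \<longrightarrow> (\<Sum>j=1..q. m j) = 0 \<longrightarrow>
        h ` {1..q} \<subseteq> I \<longrightarrow> inj_on h {1..q} \<longrightarrow>
        \<bar>\<Sum>j=1..q. real_of_int (m j) * \<omega> (h j)\<bar> \<ge>
          \<rho> * (2 * (MIN j\<in>{1..q}. japanese_bracket (real_of_int (h j))))
                powr (- exp (\<alpha> * real_of_int (\<Sum>j=1..q. \<bar>m j\<bar>))))"

end

theory Submission
  imports Defs
begin

text \<open>Write \<open>W(x) = \<Sum>k\<ge>1. w k * cos (k * x)\<close> with \<open>w k = X k * \<langle>k\<rangle> powr (- s)\<close>. In the basis \<open>sin (l * x)\<close> of
\<open>L\<^sup>2(0, \<pi>)\<close>, multiplication by \<open>W\<close> is the symmetric matrix with entries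
\<open>(w \<bar>l - j\<bar> - w (l + j)) / 2\<close>, and a small \<open>H\<^sup>1\<close> norm of \<open>W\<close> makes both the sum of the
\<open>\<bar>w k\<bar>\<close> and the supremum of the \<open>k * \<bar>w k\<bar>\<close> small. The \<open>n\<close>-th eigenpair \<open>(n\<^sup>2, sin (n * x))\<close> of
\<open>-\<partial>\<^sub>x\<^sup>2\<close> then continues, by a contraction that is uniform in \<open>n\<close>, to an eigenpair of
\<open>-\<partial>\<^sub>x\<^sup>2 + W\<close> whose eigenvalue \<open>\<lambda> n\<close> satisfies \<open>\<bar>\<lambda> n - n\<^sup>2\<bar> \<le> 1 / n\<close>. These eigenfunctions are
so close to the sines that they are complete with them, so the \<open>\<lambda> n\<close> are the Dirichlet spectrum
(\<open>dirichlet_spectrum_small_potential\<close>); that spectrum is unique because eigenfunctions for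
different eigenvalues are orthogonal (\<open>dirichlet_spectrum_unique\<close>).

The randomness enters through the even coefficients. To first order
\<open>\<lambda> n = n\<^sup>2 - w (2 * n) / 2\<close>. A change \<open>\<tau>\<close> of the single coefficient \<open>w (2 * i)\<close> moves \<open>\<lambda> i\<close> by
at least \<open>\<bar>\<tau>\<bar> / 4\<close>, and moves the other \<open>\<lambda> n\<close> by at most a small multiple of
\<open>\<bar>\<tau>\<bar> / max n i\<close>. A Schur test with the weight \<open>sqrt n\<close> turns this into a statement on every integer
combination \<open>\<Sum>n. z n * \<lambda> n\<close>: if \<open>i\<close> maximises \<open>\<bar>z n\<bar> * sqrt n\<close>, the combination moves by at least
\<open>\<bar>\<tau>\<bar> / 8\<close> (\<open>combination_shift\<close>). Conditionally on the other coefficients, the Gaussian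
\<open>X (2 * i)\<close> must therefore fall in a short interval for the combination to be close to a given
integer (\<open>thin_slices_probability\<close>), and a union bound over all \<open>z\<close> and all integers \<open>k\<close> yields, almost
surely, a \<open>\<gamma> > 0\<close> with
\<open>\<bar>\<Sum>n. z n * \<lambda> n + k\<bar> \<ge> \<gamma> * (\<Prod>n. (2 * n) powr (- (s + 2) * \<bar>z n\<bar>)) / (1 + k\<^sup>2)\<close>.

It remains to replace the product over all indices by a power of the smallest one
(\<open>strongly_non_resonant_of_small_divisors\<close>). The indices are read in increasing order. If the
next index is enormous compared with the product over the indices read so far, the remaining
\<open>\<lambda> n\<close> may be replaced by the integers \<open>n\<^sup>2\<close> and the bound for the indices read so far concludes.
Otherwise the logarithm of the product has grown by a factor of at most
\<open>1 + (s + 7) * \<bar>z n\<bar>\<close>; the product of all these factors is at most exponential in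
\<open>\<Sum>n. \<bar>z n\<bar>\<close>, which is where the double exponential in the definition of strong non-resonance
comes from.\<close>

section \<open>Smooth cut-offs\<close>

definition smooth :: "(real \<Rightarrow> real) \<Rightarrow> bool" where
  "smooth f \<longleftrightarrow> (\<forall>n x. (deriv ^^ n) f differentiable at x)"

text \<open>Infinite differentiability is proved by exhibiting a class of functions that contains a derivative
of each of its members; this avoids formulas for iterated derivatives.\<close>

lemma smooth_coinduct:
  assumes "Q f" and step: "\<And>g. Q g \<Longrightarrow> \<exists>g'. (\<forall>x. (g has_real_derivative g' x) (at x)) \<and> Q g'"
  shows "smooth f"
proof -
  have Q: "Q ((deriv ^^ n) f)" for n
  proof (induction n)
    case (Suc n)
    then obtain g' where g': "\<forall>x. ((deriv ^^ n) f has_real_derivative g' x) (at x)" "Q g'"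
      using step by blast
    then have "deriv ((deriv ^^ n) f) = g'" using DERIV_imp_deriv by blast
    then show ?case using g'(2) by simp
  qed (simp add: assms(1))
  have "(deriv ^^ n) f differentiable at x" for n x
    using step[OF Q[of n]] by (auto simp: real_differentiable_def)
  then show ?thesis unfolding smooth_def by blast
qed

lemma smooth_has_derivative:
  assumes "smooth f" shows "(f has_real_derivative deriv f x) (at x)"
proof -
  have "(deriv ^^ 0) f differentiable at x" using assms unfolding smooth_def by blast
  then show ?thesis by (simp add: DERIV_deriv_iff_real_differentiable)
qed

lemma smooth_deriv: "smooth f \<Longrightarrow> smooth (deriv f)"
  unfolding smooth_def by (metis funpow_Suc_right o_apply)

lemma smooth_continuous_on: "smooth f \<Longrightarrow> continuous_on S f"
  by (meson DERIV_isCont continuous_at_imp_continuous_on smooth_has_derivative)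

lemma smooth_const: "smooth (\<lambda>_. c)"
proof (rule smooth_coinduct[of "\<lambda>g. \<exists>c. g = (\<lambda>_. c)"])
  fix g :: "real \<Rightarrow> real" assume "\<exists>c. g = (\<lambda>_. c)"
  then show "\<exists>g'. (\<forall>x. (g has_real_derivative g' x) (at x)) \<and> (\<exists>c. g' = (\<lambda>_. c))"
    by (intro exI[of _ "\<lambda>_. 0"]) auto
qed auto

text \<open>A class that is closed under differentiation by the Leibniz and the quotient rule. It shows that sums,
products and reciprocals of smooth functions are smooth.\<close>

inductive smooth_alg :: "(real \<Rightarrow> real) \<Rightarrow> bool" where
  base: "smooth f \<Longrightarrow> smooth_alg f"
| add: "smooth_alg f \<Longrightarrow> smooth_alg g \<Longrightarrow> smooth_alg (\<lambda>x. f x + g x)"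
| mult: "smooth_alg f \<Longrightarrow> smooth_alg g \<Longrightarrow> smooth_alg (\<lambda>x. f x * g x)"
| recip: "smooth f \<Longrightarrow> (\<forall>x. f x \<noteq> 0) \<Longrightarrow> smooth_alg (\<lambda>x. 1 / f x)"

lemma smooth_alg_deriv:
  "smooth_alg f \<Longrightarrow> \<exists>f'. (\<forall>x. (f has_real_derivative f' x) (at x)) \<and> smooth_alg f'"
proof (induction rule: smooth_alg.induct)
  case (base f)
  then show ?case
    by (intro exI[of _ "deriv f"]) (auto intro: smooth_has_derivative smooth_alg.base smooth_deriv)
next
  case (add f g)
  then obtain f' g' where d: "\<forall>x. (f has_real_derivative f' x) (at x)" "smooth_alg f'"
    "\<forall>x. (g has_real_derivative g' x) (at x)" "smooth_alg g'" by blast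
  show ?case
    by (intro exI[of _ "\<lambda>x. f' x + g' x"] conjI allI DERIV_add smooth_alg.add) (use d in auto)
next
  case (mult f g)
  then obtain f' g' where d: "\<forall>x. (f has_real_derivative f' x) (at x)" "smooth_alg f'"
    "\<forall>x. (g has_real_derivative g' x) (at x)" "smooth_alg g'" by blast
  show ?case
    by (intro exI[of _ "\<lambda>x. f' x * g x + g' x * f x"] conjI allI DERIV_mult
        smooth_alg.add smooth_alg.mult) (use d mult in auto)
next
  case (recip f)
  have "smooth_alg (\<lambda>x. (-1) * (deriv f x * ((1 / f x) * (1 / f x))))"
    by (intro smooth_alg.mult smooth_alg.recip smooth_alg.base smooth_const smooth_deriv) (use recip in auto)
  moreover have "((\<lambda>x. 1 / f x) has_real_derivative (-1) * (deriv f x * ((1 / f x) * (1 / f x)))) (at x)" for x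
    using DERIV_inverse'[OF smooth_has_derivative[OF recip(1)], of x] recip(2)
    by (simp add: inverse_eq_divide)
  ultimately show ?case by (intro exI conjI allI)
qed

lemma smooth_alg_smooth: "smooth_alg f \<Longrightarrow> smooth f"
  by (rule smooth_coinduct[of smooth_alg, OF _ smooth_alg_deriv])

lemma smooth_add: "smooth f \<Longrightarrow> smooth g \<Longrightarrow> smooth (\<lambda>x. f x + g x)"
  by (rule smooth_alg_smooth[OF smooth_alg.add[OF smooth_alg.base smooth_alg.base]])

lemma smooth_mult: "smooth f \<Longrightarrow> smooth g \<Longrightarrow> smooth (\<lambda>x. f x * g x)"
  by (rule smooth_alg_smooth[OF smooth_alg.mult[OF smooth_alg.base smooth_alg.base]])

lemma smooth_recip: "smooth f \<Longrightarrow> (\<forall>x. f x \<noteq> 0) \<Longrightarrow> smooth (\<lambda>x. 1 / f x)"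
  by (rule smooth_alg_smooth[OF smooth_alg.recip])

lemma smooth_sum: "(\<And>i. i \<in> A \<Longrightarrow> smooth (f i)) \<Longrightarrow> smooth (\<lambda>x. \<Sum>i\<in>A. f i x)"
  by (induction A rule: infinite_finite_induct) (simp_all add: smooth_const smooth_add)

lemma smooth_affine:
  assumes "smooth f" shows "smooth (\<lambda>x. f (a * x + b))"
proof (rule smooth_coinduct[of "\<lambda>g. \<exists>h c. smooth h \<and> g = (\<lambda>x. c * h (a * x + b))"])
  show "\<exists>h c. smooth h \<and> (\<lambda>x. f (a * x + b)) = (\<lambda>x. c * h (a * x + b))"
    by (intro exI[of _ f] exI[of _ 1]) (simp add: assms)
  fix g assume "\<exists>h c. smooth h \<and> g = (\<lambda>x. c * h (a * x + b))"
  then obtain h c where h: "smooth h" "g = (\<lambda>x. c * h (a * x + b))" by blast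
  have "(g has_real_derivative (c * a) * deriv h (a * x + b)) (at x)" for x
  proof -
    have "((\<lambda>x. h (a * x + b)) has_real_derivative deriv h (a * x + b) * a) (at x)"
      by (rule DERIV_chain'[OF _ smooth_has_derivative[OF h(1)]]) (auto intro!: derivative_eq_intros)
    from DERIV_cmult[OF this, of c] show ?thesis unfolding h(2) by (simp add: mult_ac)
  qed
  then show "\<exists>g'. (\<forall>x. (g has_real_derivative g' x) (at x)) \<and> (\<exists>h c. smooth h \<and> g' = (\<lambda>x. c * h (a * x + b)))"
    using smooth_deriv[OF h(1)]
    by (intro exI[of _ "\<lambda>x. (c * a) * deriv h (a * x + b)"] conjI allI exI[of _ "deriv h"] exI[of _ "c * a"]) auto
qed

lemma smooth_sin: "smooth (\<lambda>x. sin (l * x))"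
proof (rule smooth_coinduct[of "\<lambda>g. \<exists>a b. g = (\<lambda>x. a * sin (l * x) + b * cos (l * x))"])
  show "\<exists>a b. (\<lambda>x. sin (l * x)) = (\<lambda>x. a * sin (l * x) + b * cos (l * x))"
    by (intro exI[of _ 1] exI[of _ 0]) simp
  fix g assume "\<exists>a b. g = (\<lambda>x. a * sin (l * x) + b * cos (l * x))"
  then obtain a b where g: "g = (\<lambda>x. a * sin (l * x) + b * cos (l * x))" by blast
  have "(g has_real_derivative (- b * l) * sin (l * x) + (a * l) * cos (l * x)) (at x)" for x
    unfolding g by (auto intro!: derivative_eq_intros)
  then show "\<exists>g'. (\<forall>x. (g has_real_derivative g' x) (at x)) \<and> (\<exists>a b. g' = (\<lambda>x. a * sin (l * x) + b * cos (l * x)))"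
    by (intro exI[of _ "\<lambda>x. (- b * l) * sin (l * x) + (a * l) * cos (l * x)"] conjI allI
        exI[of _ "- b * l"] exI[of _ "a * l"] refl)
qed

text \<open>A family that contains the extension of \<open>exp (- 1 / t)\<close> by zero, for \<open>p = 1\<close>, and is closed under
differentiation.\<close>

definition flat :: "real poly \<Rightarrow> real \<Rightarrow> real" where
  "flat p t = (if t > 0 then poly p (1 / t) / exp (1 / t) else 0)"

lemma poly_div_exp_tendsto_0: "((\<lambda>y::real. y ^ k * poly p y / exp y) \<longlongrightarrow> 0) at_top"
proof (induction p arbitrary: k)
  case (pCons a p)
  have "((\<lambda>y. a * (y ^ k / exp y) + y ^ Suc k * poly p y / exp y) \<longlongrightarrow> a * 0 + 0) at_top"
    by (intro tendsto_add tendsto_mult tendsto_const tendsto_power_div_exp_0 pCons(2))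
  moreover have "(\<lambda>y. a * (y ^ k / exp y) + y ^ Suc k * poly p y / exp y) = (\<lambda>y. y ^ k * poly (pCons a p) y / exp y)"
    by (simp add: fun_eq_iff add_divide_distrib distrib_left mult_ac)
  ultimately show ?case by simp
qed simp

lemma flat_derivative: "(flat p has_real_derivative flat ([:0, 0, 1:] * (p - pderiv p)) t) (at t)"
proof -
  consider "t > 0" | "t < 0" | "t = 0" by linarith
  then show ?thesis
  proof cases
    case 1
    have "((\<lambda>t. poly p (1 / t) / exp (1 / t)) has_real_derivative flat ([:0, 0, 1:] * (p - pderiv p)) t) (at t)"
    proof -
      define q E where "q = 1 / t" and "E = exp q"
      have inv: "((\<lambda>t. 1 / t) has_real_derivative - (q * q)) (at t)"
        using DERIV_inverse'[OF DERIV_ident, of t UNIV] 1 by (simp add: inverse_eq_divide q_def)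
      have P: "((\<lambda>t. poly p (1 / t)) has_real_derivative poly (pderiv p) q * - (q * q)) (at t)"
        using DERIV_chain'[OF inv poly_DERIV[of p "1 / t"]] by (simp add: q_def)
      have X: "((\<lambda>t. exp (1 / t)) has_real_derivative E * - (q * q)) (at t)"
        using DERIV_chain'[OF inv DERIV_exp[of "1 / t"]] by (simp add: q_def E_def)
      have E: "E \<noteq> 0" by (simp add: E_def)
      have "((\<lambda>t. poly p (1 / t) / exp (1 / t)) has_real_derivative
          (poly (pderiv p) q * - (q * q) * E - poly p q * (E * - (q * q))) / (E * E)) (at t)"
        using DERIV_divide[OF P X] by (simp add: E_def q_def)
      also have "(poly (pderiv p) q * - (q * q) * E - poly p q * (E * - (q * q))) / (E * E)
          = (q * q * (poly p q - poly (pderiv p) q) * E) / (E * E)"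
        by (simp add: algebra_simps)
      also have "\<dots> = (q * q * (poly p q - poly (pderiv p) q)) / E" using E by simp
      also have "\<dots> = flat ([:0, 0, 1:] * (p - pderiv p)) t"
        using 1 by (simp add: flat_def q_def E_def mult_ac)
      finally show ?thesis .
    qed
    then show ?thesis
      by (rule has_field_derivative_transform_within_open[of _ _ _ "{0<..}"]) (use 1 in \<open>auto simp: flat_def\<close>)
  next
    case 2
    have "((\<lambda>t. 0) has_real_derivative flat ([:0, 0, 1:] * (p - pderiv p)) t) (at t)"
      using 2 by (simp add: flat_def)
    then show ?thesis
      by (rule has_field_derivative_transform_within_open[of _ _ _ "{..<0}"]) (use 2 in \<open>auto simp: flat_def\<close>)
  next
    case 3
    have "((\<lambda>y. poly (pCons 0 p) y / exp y) \<longlongrightarrow> 0) at_top"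
      using poly_div_exp_tendsto_0[of 1 p] by simp
    from filterlim_compose[OF this filterlim_inverse_at_top_right]
    have "((\<lambda>h. poly (pCons 0 p) (inverse h) / exp (inverse h)) \<longlongrightarrow> 0) (at_right 0)" .
    moreover have "eventually (\<lambda>h. poly (pCons 0 p) (inverse h) / exp (inverse h) = flat p h / h) (at_right (0::real))"
      using eventually_at_right_less[of 0] by eventually_elim (simp add: flat_def field_simps)
    ultimately have r: "((\<lambda>h. flat p h / h) \<longlongrightarrow> 0) (at_right 0)"
      by (rule Lim_transform_eventually)
    have l: "((\<lambda>h. flat p h / h) \<longlongrightarrow> 0) (at_left 0)"
      by (rule tendsto_eventually) (auto simp: eventually_at_filter flat_def)
    have "((\<lambda>h. flat p h / h) \<longlongrightarrow> 0) (at 0)" using l r by (simp add: filterlim_at_split)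
    then show ?thesis using 3 by (simp add: DERIV_def flat_def)
  qed
qed

lemma smooth_flat: "smooth (flat p)"
proof (rule smooth_coinduct[of "\<lambda>g. \<exists>p. g = flat p"])
  fix g assume "\<exists>p. g = flat p"
  then obtain p where "g = flat p" by blast
  then show "\<exists>g'. (\<forall>x. (g has_real_derivative g' x) (at x)) \<and> (\<exists>p. g' = flat p)"
    using flat_derivative[of p]
    by (intro exI[of _ "flat ([:0, 0, 1:] * (p - pderiv p))"] conjI allI exI[of _ "[:0, 0, 1:] * (p - pderiv p)"] refl) simp
qed auto

lemma flat_one: "flat 1 t \<ge> 0" "flat 1 t > 0 \<longleftrightarrow> t > 0" "t \<le> 0 \<Longrightarrow> flat 1 t = 0"
  by (auto simp: flat_def)

definition smooth_step :: "real \<Rightarrow> real" where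
  "smooth_step x = flat 1 x * (1 / (flat 1 x + flat 1 (1 - x)))"

lemma flat_sum_pos: "flat 1 x + flat 1 (1 - x) > 0"
proof (cases "x > 0")
  case True
  then show ?thesis using flat_one(1)[of "1 - x"] flat_one(2)[of x] by linarith
next
  case False
  then show ?thesis using flat_one(1)[of x] flat_one(2)[of "1 - x"] by linarith
qed

lemma smooth_smooth_step: "smooth smooth_step"
proof -
  have "smooth (\<lambda>x. flat 1 ((-1) * x + 1))" by (rule smooth_affine[OF smooth_flat])
  then have "smooth (\<lambda>x. flat 1 (1 - x))" by (simp add: add.commute)
  then have "smooth (\<lambda>x. flat 1 x + flat 1 (1 - x))" by (rule smooth_add[OF smooth_flat])
  moreover have "\<forall>x. flat 1 x + flat 1 (1 - x) \<noteq> 0" using flat_sum_pos by (simp add: less_imp_neq[symmetric])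
  ultimately show ?thesis
    unfolding smooth_step_def[abs_def] by (rule smooth_mult[OF smooth_flat smooth_recip])
qed

lemma smooth_step_values:
  "x \<le> 0 \<Longrightarrow> smooth_step x = 0" "1 \<le> x \<Longrightarrow> smooth_step x = 1"
  "0 \<le> smooth_step x" "smooth_step x \<le> 1"
proof -
  show "x \<le> 0 \<Longrightarrow> smooth_step x = 0" by (simp add: smooth_step_def flat_one(3))
  show "1 \<le> x \<Longrightarrow> smooth_step x = 1"
    using flat_one(2)[of x] flat_one(3)[of "1 - x"] by (simp add: smooth_step_def)
  show "0 \<le> smooth_step x" unfolding smooth_step_def using flat_one(1)[of x] flat_sum_pos[of x] by simp
  show "smooth_step x \<le> 1"
    unfolding smooth_step_def using flat_one(1)[of "1 - x"] flat_sum_pos[of x] by (simp add: divide_le_eq)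
qed

lemma deriv_smooth_step_outside:
  assumes "x < 0 \<or> 1 < x" shows "deriv smooth_step x = 0"
proof (rule DERIV_imp_deriv)
  show "(smooth_step has_real_derivative 0) (at x)"
  proof (cases "x < 0")
    case True
    show ?thesis
      by (rule has_field_derivative_transform_within_open[of "\<lambda>_. 0" _ _ "{..<0}"])
         (use True in \<open>auto simp: smooth_step_values\<close>)
  next
    case False
    show ?thesis
      by (rule has_field_derivative_transform_within_open[of "\<lambda>_. 1" _ _ "{1<..}"])
         (use False assms in \<open>auto simp: smooth_step_values\<close>)
  qed
qed

lemma deriv_smooth_step_bounded: obtains K where "K > 0" "\<And>x. \<bar>deriv smooth_step x\<bar> \<le> K"
proof -
  have "compact (deriv smooth_step ` {0..1})"
    by (intro compact_continuous_image smooth_continuous_on smooth_deriv smooth_smooth_step) simp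
  then obtain K where K: "\<forall>y\<in>deriv smooth_step ` {0..1}. norm y \<le> K" "K > 0"
    using compact_imp_bounded[of "deriv smooth_step ` {0..1}"] unfolding bounded_pos by blast
  have "\<bar>deriv smooth_step x\<bar> \<le> K" for x
    using K deriv_smooth_step_outside[of x] by (cases "x \<in> {0..1}") auto
  then show ?thesis using that K(2) by blast
qed

text \<open>Equal to \<open>1\<close> at distance more than \<open>2 / a\<close> from the end points of \<open>(0, \<pi>)\<close> and to \<open>0\<close> at distance less
than \<open>1 / a\<close> from them; \<open>cutoff'\<close> is its derivative.\<close>

definition cutoff :: "real \<Rightarrow> real \<Rightarrow> real" where
  "cutoff a x = smooth_step (a * x - 1) * smooth_step (a * (pi - x) - 1)"

definition cutoff' :: "real \<Rightarrow> real \<Rightarrow> real" where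
  "cutoff' a x = a * deriv smooth_step (a * x - 1) * smooth_step (a * (pi - x) - 1)
     - a * deriv smooth_step (a * (pi - x) - 1) * smooth_step (a * x - 1)"

lemma smooth_cutoff: "smooth (cutoff a)"
proof -
  have "smooth (\<lambda>x. smooth_step (a * x + (- 1)) * smooth_step ((- a) * x + (a * pi - 1)))"
    by (rule smooth_mult[OF smooth_affine[OF smooth_smooth_step] smooth_affine[OF smooth_smooth_step]])
  moreover have "(\<lambda>x. smooth_step (a * x + (- 1)) * smooth_step ((- a) * x + (a * pi - 1))) = cutoff a"
    by (auto simp: cutoff_def algebra_simps)
  ultimately show ?thesis by simp
qed

lemma cutoff_derivative: "(cutoff a has_real_derivative cutoff' a x) (at x)"
proof -
  have 1: "((\<lambda>x. smooth_step (a * x - 1)) has_real_derivative deriv smooth_step (a * x - 1) * a) (at x)"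
    by (rule DERIV_chain'[OF _ smooth_has_derivative[OF smooth_smooth_step]]) (auto intro!: derivative_eq_intros)
  have 2: "((\<lambda>x. smooth_step (a * (pi - x) - 1)) has_real_derivative deriv smooth_step (a * (pi - x) - 1) * (- a)) (at x)"
    by (rule DERIV_chain'[OF _ smooth_has_derivative[OF smooth_smooth_step]]) (auto intro!: derivative_eq_intros)
  show ?thesis
    using DERIV_mult[OF 1 2] unfolding cutoff_def[abs_def] cutoff'_def by (simp add: mult_ac)
qed

lemma cutoff_zero:
  assumes "a > 0" "x \<notin> {1/a..pi - 1/a}" shows "cutoff a x = 0"
proof -
  have "a * x - 1 \<le> 0 \<or> a * (pi - x) - 1 \<le> 0" using assms by (auto simp: field_simps)
  then show ?thesis by (auto simp: cutoff_def smooth_step_values)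
qed

lemma cutoff_one:
  assumes "a > 0" "2 / a < x" "x < pi - 2 / a" shows "cutoff a x = 1" "cutoff' a x = 0"
proof -
  have "2 < a * x" using assms by (simp add: field_simps)
  moreover have "a * (2 / a) < a * (pi - x)" using assms by (intro mult_strict_left_mono) auto
  ultimately have "1 < a * x - 1" "1 < a * (pi - x) - 1" using assms(1) by auto
  then show "cutoff a x = 1" "cutoff' a x = 0"
    by (auto simp: cutoff_def cutoff'_def smooth_step_values deriv_smooth_step_outside)
qed

lemma cutoff_bounds: "0 \<le> cutoff a x" "cutoff a x \<le> 1"
  unfolding cutoff_def using smooth_step_values(3,4) by (auto intro: mult_nonneg_nonneg mult_le_one)

text \<open>The derivative of the cut-off has size \<open>a\<close>, but it lives within distance \<open>2 / a\<close> of the end points, where a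
function that vanishes linearly there has size \<open>1 / a\<close>. Hence cutting off such a function
costs nothing in the \<open>H\<^sup>1\<close> norm as \<open>a\<close> tends to infinity.\<close>

lemma cutoff'_times_le:
  assumes K: "\<And>x. \<bar>deriv smooth_step x\<bar> \<le> K" "K > 0" and a: "a > 0" and C: "0 \<le> C"
    and P: "\<bar>P\<bar> \<le> C * x" "\<bar>P\<bar> \<le> C * (pi - x)"
  shows "\<bar>cutoff' a x * P\<bar> \<le> 4 * K * C"
proof -
  have piece: "\<bar>a * deriv smooth_step (a * y - 1) * smooth_step z * P\<bar> \<le> 2 * K * C"
    if y: "\<bar>P\<bar> \<le> C * y" for y z
  proof (cases "1 < a * y - 1")
    case True
    then show ?thesis using K(2) C by (simp add: deriv_smooth_step_outside)
  next
    case False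
    have "a * \<bar>P\<bar> \<le> a * (C * y)" using y a by (intro mult_left_mono) auto
    also have "\<dots> = C * (a * y)" by simp
    also have "\<dots> \<le> C * 2" using False C by (intro mult_left_mono) auto
    finally have "a * \<bar>P\<bar> \<le> C * 2" .
    have "\<bar>a * deriv smooth_step (a * y - 1) * smooth_step z * P\<bar> =
        \<bar>deriv smooth_step (a * y - 1)\<bar> * smooth_step z * (a * \<bar>P\<bar>)"
      using a smooth_step_values(3)[of z] by (simp add: abs_mult mult_ac)
    also have "\<dots> \<le> K * 1 * (C * 2)"
      by (rule mult_mono[OF mult_mono \<open>a * \<bar>P\<bar> \<le> C * 2\<close>]) (use a smooth_step_values(3,4)[of z] K in auto)
    finally show ?thesis by simp
  qed
  have "\<bar>cutoff' a x * P\<bar> \<le> \<bar>a * deriv smooth_step (a * x - 1) * smooth_step (a * (pi - x) - 1) * P\<bar>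
      + \<bar>a * deriv smooth_step (a * (pi - x) - 1) * smooth_step (a * x - 1) * P\<bar>"
    unfolding cutoff'_def left_diff_distrib by (rule abs_triangle_ineq4)
  also have "\<dots> \<le> 2 * K * C + 2 * K * C" by (intro add_mono piece P)
  also have "\<dots> = 4 * K * C" by simp
  finally show ?thesis .
qed

lemma cutoff_times_test_function:
  assumes "a > 0" "smooth f"
  shows "(\<lambda>x. cutoff a x * f x) \<in> test_functions {0<..<pi}"
  unfolding test_functions_def
proof (intro CollectI conjI)
  show "\<forall>n x. (deriv ^^ n) (\<lambda>x. cutoff a x * f x) differentiable at x"
    using smooth_mult[OF smooth_cutoff assms(2)] unfolding smooth_def by blast
  show "\<exists>K. compact K \<and> K \<subseteq> {0<..<pi} \<and> (\<forall>x. x \<notin> K \<longrightarrow> cutoff a x * f x = 0)"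
  proof (intro exI[of _ "{1/a..pi - 1/a}"] conjI allI impI)
    have "1 / a > 0" using assms(1) by simp
    show "{1/a..pi - 1/a} \<subseteq> {0<..<pi}"
    proof
      fix x assume "x \<in> {1/a..pi - 1/a}"
      then have "1 / a \<le> x" "x \<le> pi - 1 / a" by auto
      with \<open>1 / a > 0\<close> have "0 < x" "x < pi" by linarith+
      then show "x \<in> {0<..<pi}" by simp
    qed
  qed (use cutoff_zero[OF assms(1)] in auto)
qed

lemma test_function_smooth: "\<phi> \<in> test_functions S \<Longrightarrow> smooth \<phi>"
  by (auto simp: test_functions_def smooth_def)

lemma deriv_test_function:
  assumes "\<phi> \<in> test_functions S" shows "deriv \<phi> \<in> test_functions S"
proof -
  have s: "smooth (deriv \<phi>)" using assms test_function_smooth smooth_deriv by blast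
  obtain K where K: "compact K" "K \<subseteq> S" "\<forall>x. x \<notin> K \<longrightarrow> \<phi> x = 0"
    using assms unfolding test_functions_def by blast
  have "deriv \<phi> x = 0" if "x \<notin> K" for x
  proof (rule DERIV_imp_deriv)
    show "(\<phi> has_real_derivative 0) (at x)"
      by (rule has_field_derivative_transform_within_open[of "\<lambda>_. 0" _ _ "- K"])
         (use that K compact_imp_closed in auto)
  qed
  then show ?thesis using s K unfolding test_functions_def smooth_def by blast
qed

section \<open>Weak Dirichlet eigenpairs\<close>

abbreviation "leb_0_pi \<equiv> lebesgue_on {0<..<pi}"

lemma finite_measure_0_pi: "finite_measure leb_0_pi"
  by (intro finite_measureI) (simp add: emeasure_restrict_space)

lemma continuous_measurable_0_pi:
  fixes f :: "real \<Rightarrow> real"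
  assumes "continuous_on {0<..<pi} f" shows "f \<in> borel_measurable leb_0_pi"
  by (intro continuous_imp_measurable_on_sets_lebesgue assms) simp

lemma bounded_integrable_0_pi:
  fixes f :: "real \<Rightarrow> real"
  assumes "f \<in> borel_measurable leb_0_pi" "\<And>x. x \<in> {0<..<pi} \<Longrightarrow> \<bar>f x\<bar> \<le> B"
  shows "integrable leb_0_pi f"
  by (rule finite_measure.integrable_const_bound[OF finite_measure_0_pi _ assms(1), of B])
     (use assms(2) in \<open>auto intro!: AE_I2\<close>)

lemma continuous_bounded_on_interval:
  fixes f :: "real \<Rightarrow> real"
  assumes "continuous_on {0..pi} f"
  obtains B where "\<And>x. x \<in> {0<..<pi} \<Longrightarrow> \<bar>f x\<bar> \<le> B"
proof -
  have "compact (f ` {0..pi})" by (intro compact_continuous_image assms) simp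
  then have "bounded (f ` {0..pi})" by (rule compact_imp_bounded)
  then obtain B where "\<forall>y\<in>f ` {0..pi}. norm y \<le> B" unfolding bounded_pos by blast
  then have "\<bar>f x\<bar> \<le> B" if "x \<in> {0<..<pi}" for x using that by auto
  then show ?thesis using that by blast
qed

lemma continuous_integrable_0_pi:
  fixes f :: "real \<Rightarrow> real"
  assumes "continuous_on {0..pi} f" shows "integrable leb_0_pi f"
proof -
  obtain B where "\<And>x. x \<in> {0<..<pi} \<Longrightarrow> \<bar>f x\<bar> \<le> B"
    using continuous_bounded_on_interval[OF assms] by blast
  then show ?thesis
    by (intro bounded_integrable_0_pi continuous_measurable_0_pi continuous_on_subset[OF assms]) auto
qed

lemma continuous_square_integrable:
  assumes "continuous_on {0..pi} f" shows "f \<in> square_integrable leb_0_pi"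
  unfolding square_integrable_def
  by (auto intro!: continuous_measurable_0_pi continuous_integrable_0_pi continuous_intros
      continuous_on_subset[OF assms] assms)

lemma continuous_integral_0_pi:
  fixes f :: "real \<Rightarrow> real"
  assumes "continuous_on {0..pi} f" shows "(LINT x|leb_0_pi. f x) = integral {0..pi} f"
  using lebesgue_integral_eq_integral[OF continuous_integrable_0_pi[OF assms]]
    integral_open_interval_real[of 0 pi f] by simp

lemma integral_derivative_0_pi:
  fixes F f :: "real \<Rightarrow> real"
  assumes "\<And>x. (F has_real_derivative f x) (at x)" "continuous_on {0..pi} f"
  shows "(LINT x|leb_0_pi. f x) = F pi - F 0"
proof -
  have "(f has_integral (F pi - F 0)) {0..pi}"
    by (rule fundamental_theorem_of_calculus)
       (auto intro: has_field_derivative_at_within[OF assms(1)] simp flip: has_real_derivative_iff_has_vector_derivative)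
  then show ?thesis using continuous_integral_0_pi[OF assms(2)] by (simp add: integral_unique)
qed

lemma measure_0_pi: "measure leb_0_pi (space leb_0_pi) = pi"
  by (simp add: measure_restrict_space)

lemma test_function_ends:
  assumes "\<phi> \<in> test_functions {0<..<pi}" shows "\<phi> 0 = 0" "\<phi> pi = 0"
  using assms unfolding test_functions_def by auto

lemma integration_by_parts_test_function:
  assumes f: "\<And>x. (f has_real_derivative f' x) (at x)" "continuous_on UNIV f'"
    and \<phi>: "\<phi> \<in> test_functions {0<..<pi}"
  shows "(LINT x|leb_0_pi. f x * deriv \<phi> x) = - (LINT x|leb_0_pi. f' x * \<phi> x)"
proof -
  have s: "smooth \<phi>" using \<phi> by (rule test_function_smooth)
  have cf: "continuous_on {0..pi} f" using f(1) by (meson DERIV_isCont continuous_at_imp_continuous_on)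
  have cf': "continuous_on {0..pi} f'" using f(2) continuous_on_subset by blast
  note c = continuous_on_mult[OF cf smooth_continuous_on[OF smooth_deriv[OF s]]]
    continuous_on_mult[OF cf' smooth_continuous_on[OF s]]
  have "((\<lambda>x. f x * \<phi> x) has_real_derivative (f x * deriv \<phi> x + f' x * \<phi> x)) (at x)" for x
    using DERIV_mult[OF f(1)[of x] smooth_has_derivative[OF s, of x]] by (simp add: mult.commute add.commute)
  then have "(LINT x|leb_0_pi. f x * deriv \<phi> x + f' x * \<phi> x) = f pi * \<phi> pi - f 0 * \<phi> 0"
    by (rule integral_derivative_0_pi) (intro continuous_on_add c)
  then have "(LINT x|leb_0_pi. f x * deriv \<phi> x) + (LINT x|leb_0_pi. f' x * \<phi> x) = 0"
    using test_function_ends[OF \<phi>] continuous_integrable_0_pi[OF c(1)] continuous_integrable_0_pi[OF c(2)] by simp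
  then show ?thesis by simp
qed

lemma classical_imp_weak_deriv:
  assumes f: "\<And>x. (f has_real_derivative f' x) (at x)" "\<And>x. (f' has_real_derivative f'' x) (at x)"
    and c: "continuous_on UNIV f''"
  shows "has_weak_deriv {0<..<pi} 0 f f" "has_weak_deriv {0<..<pi} 1 f f'" "has_weak_deriv {0<..<pi} 2 f f''"
proof -
  have cf: "continuous_on A f" "continuous_on A f'" "continuous_on A f''" for A
    using f(1) f(2) c by (meson DERIV_isCont continuous_at_imp_continuous_on continuous_on_subset subset_UNIV)+
  note sq = continuous_square_integrable[OF cf(1)] continuous_square_integrable[OF cf(2)]
    continuous_square_integrable[OF cf(3)]
  show "has_weak_deriv {0<..<pi} 0 f f" unfolding has_weak_deriv_def using sq by simp
  show "has_weak_deriv {0<..<pi} 1 f f'" unfolding has_weak_deriv_def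
    using sq integration_by_parts_test_function[OF f(1) cf(2)] by simp
  show "has_weak_deriv {0<..<pi} 2 f f''" unfolding has_weak_deriv_def
  proof (intro conjI ballI sq)
    fix \<phi> assume \<phi>: "\<phi> \<in> test_functions {0<..<pi}"
    show "(LINT x|leb_0_pi. f x * (deriv ^^ 2) \<phi> x) = (- 1) ^ 2 * (LINT x|leb_0_pi. f'' x * \<phi> x)"
      using integration_by_parts_test_function[OF f(1) cf(2) deriv_test_function[OF \<phi>]]
        integration_by_parts_test_function[OF f(2) cf(3) \<phi>] by (simp add: numeral_2_eq_2)
  qed
qed

lemma square_integrable_mult:
  assumes "f \<in> square_integrable M" "g \<in> square_integrable M"
  shows "integrable M (\<lambda>x. f x * g x)"
proof (rule Bochner_Integration.integrable_bound)
  show "integrable M (\<lambda>x. (f x)\<^sup>2 + (g x)\<^sup>2)" using assms by (auto simp: square_integrable_def)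
  show "(\<lambda>x. f x * g x) \<in> borel_measurable M" using assms by (auto simp: square_integrable_def)
  show "AE x in M. norm (f x * g x) \<le> norm ((f x)\<^sup>2 + (g x)\<^sup>2)"
  proof (rule AE_I2)
    fix x
    have "2 * \<bar>f x\<bar> * \<bar>g x\<bar> \<le> \<bar>f x\<bar>\<^sup>2 + \<bar>g x\<bar>\<^sup>2" by (rule sum_squares_bound)
    moreover have "0 \<le> \<bar>f x\<bar> * \<bar>g x\<bar>" by simp
    ultimately have "\<bar>f x\<bar> * \<bar>g x\<bar> \<le> (f x)\<^sup>2 + (g x)\<^sup>2" unfolding power2_abs by linarith
    then show "norm (f x * g x) \<le> norm ((f x)\<^sup>2 + (g x)\<^sup>2)" by (simp add: abs_mult)
  qed
qed

lemma square_integrable_add: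
  assumes "f \<in> square_integrable M" "g \<in> square_integrable M"
  shows "(\<lambda>x. f x + g x) \<in> square_integrable M"
proof -
  have "integrable M (\<lambda>x. (f x)\<^sup>2 + (g x)\<^sup>2 + 2 * (f x * g x))"
    using assms square_integrable_mult[OF assms] by (auto simp: square_integrable_def)
  then have "integrable M (\<lambda>x. (f x + g x)\<^sup>2)" by (simp add: power2_sum mult.assoc)
  then show ?thesis using assms by (auto simp: square_integrable_def)
qed

lemma square_integrable_cmult:
  assumes "f \<in> square_integrable M" shows "(\<lambda>x. c * f x) \<in> square_integrable M"
  using assms by (auto simp: square_integrable_def power_mult_distrib)

lemma square_integrable_diff:
  assumes "f \<in> square_integrable M" "g \<in> square_integrable M"
  shows "(\<lambda>x. f x - g x) \<in> square_integrable M"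
  using square_integrable_add[OF assms(1) square_integrable_cmult[OF assms(2), of "-1"]] by simp

lemma square_integrable_sum:
  assumes "\<And>i. i \<in> A \<Longrightarrow> f i \<in> square_integrable M"
  shows "(\<lambda>x. \<Sum>i\<in>A. f i x) \<in> square_integrable M"
  using assms
  by (induction A rule: infinite_finite_induct) (simp_all add: square_integrable_add, simp_all add: square_integrable_def)

text \<open>Young's inequality with a free parameter \<open>t\<close>. When \<open>g\<close> runs through differences whose squared norm is
below \<open>t\<^sup>2\<close>, the right-hand side is of order \<open>t\<close>, which serves as well as the Cauchy--Schwarz inequality.\<close>

lemma abs_integral_mult_le:
  assumes f: "f \<in> square_integrable M" and g: "g \<in> square_integrable M" and t: "t > 0"
  shows "\<bar>LINT x|M. f x * g x\<bar> \<le> (t * (LINT x|M. (f x)\<^sup>2) + (LINT x|M. (g x)\<^sup>2) / t)"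
proof -
  have i: "integrable M (\<lambda>x. (f x)\<^sup>2)" "integrable M (\<lambda>x. (g x)\<^sup>2)" using f g by (auto simp: square_integrable_def)
  have "\<bar>LINT x|M. f x * g x\<bar> \<le> (LINT x|M. \<bar>f x * g x\<bar>)" by (rule integral_abs_bound)
  also have "\<dots> \<le> (LINT x|M. t * (f x)\<^sup>2 + (g x)\<^sup>2 / t)"
  proof (rule integral_mono)
    show "integrable M (\<lambda>x. \<bar>f x * g x\<bar>)" using square_integrable_mult[OF f g] by simp
    show "integrable M (\<lambda>x. t * (f x)\<^sup>2 + (g x)\<^sup>2 / t)" using i by simp
    fix x
    have "2 * (t * \<bar>f x\<bar>) * \<bar>g x\<bar> \<le> (t * \<bar>f x\<bar>)\<^sup>2 + \<bar>g x\<bar>\<^sup>2" by (rule sum_squares_bound)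
    moreover have "0 \<le> t * \<bar>f x\<bar> * \<bar>g x\<bar>" using t by simp
    ultimately have "t * \<bar>f x * g x\<bar> \<le> t\<^sup>2 * (f x)\<^sup>2 + (g x)\<^sup>2" by (simp add: abs_mult power_mult_distrib)
    then have "\<bar>f x * g x\<bar> \<le> (t\<^sup>2 * (f x)\<^sup>2 + (g x)\<^sup>2) / t" using t by (simp add: le_divide_eq mult.commute)
    also have "\<dots> = t * (f x)\<^sup>2 + (g x)\<^sup>2 / t" using t by (simp add: add_divide_distrib power2_eq_square)
    finally show "\<bar>f x * g x\<bar> \<le> t * (f x)\<^sup>2 + (g x)\<^sup>2 / t" .
  qed
  also have "\<dots> = t * (LINT x|M. (f x)\<^sup>2) + (LINT x|M. (g x)\<^sup>2) / t" using i by simp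
  finally show ?thesis .
qed

text \<open>The condition under the existential quantifier of \<^const>\<open>sobolev_1_0\<close>, with its witness made explicit:
both sides of Green's identity below must refer to the same weak derivative.\<close>

definition H10_derivative :: "(real \<Rightarrow> real) \<Rightarrow> (real \<Rightarrow> real) \<Rightarrow> bool" where
  "H10_derivative f g \<longleftrightarrow> has_weak_deriv {0<..<pi} 1 f g \<and>
        (\<forall>\<epsilon>>0. \<exists>\<phi>\<in>test_functions {0<..<pi}.
           (LINT x|leb_0_pi. (f x - \<phi> x)\<^sup>2) + (LINT x|leb_0_pi. (g x - deriv \<phi> x)\<^sup>2) < \<epsilon>)"

text \<open>For a test function in place of \<open>g\<close> this is the definition of the two weak derivatives of \<open>f\<close>, since the
derivative of a test function is a test function. Both sides are continuous in \<open>g\<close> for the \<open>H\<^sup>1\<close> norm.\<close>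

lemma weak_green:
  assumes f: "has_weak_deriv {0<..<pi} 1 f f'" "has_weak_deriv {0<..<pi} 2 f h" and g: "H10_derivative g g'"
  shows "(LINT x|leb_0_pi. h x * g x) = - (LINT x|leb_0_pi. f' x * g' x)"
proof -
  let ?X = "(LINT x|leb_0_pi. h x * g x) + (LINT x|leb_0_pi. f' x * g' x)"
  \<comment> \<open>The added \<open>1\<close> makes the constant positive, so that it may serve as the denominator of \<open>t\<close> below.\<close>
  let ?K = "(LINT x|leb_0_pi. (h x)\<^sup>2) + (LINT x|leb_0_pi. (f' x)\<^sup>2) + 1"
  have sq: "h \<in> square_integrable leb_0_pi" "f' \<in> square_integrable leb_0_pi" "g \<in> square_integrable leb_0_pi" "g' \<in> square_integrable leb_0_pi"
    using f g unfolding has_weak_deriv_def H10_derivative_def by auto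
  have le: "\<bar>?X\<bar> \<le> t * ?K" if t: "t > 0" for t
  proof -
    have "t\<^sup>2 > 0" using t by simp
    then obtain \<phi> where \<phi>: "\<phi> \<in> test_functions {0<..<pi}"
      "(LINT x|leb_0_pi. (g x - \<phi> x)\<^sup>2) + (LINT x|leb_0_pi. (g' x - deriv \<phi> x)\<^sup>2) < t\<^sup>2"
      using g unfolding H10_derivative_def by blast
    have sp: "\<phi> \<in> square_integrable leb_0_pi" "deriv \<phi> \<in> square_integrable leb_0_pi"
      using \<phi>(1) by (auto intro!: continuous_square_integrable smooth_continuous_on test_function_smooth deriv_test_function)
    have sd: "(\<lambda>x. g x - \<phi> x) \<in> square_integrable leb_0_pi" "(\<lambda>x. g' x - deriv \<phi> x) \<in> square_integrable leb_0_pi"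
      using sq sp by (auto intro: square_integrable_diff)
    have "(LINT x|leb_0_pi. f x * deriv (deriv \<phi>) x) = (LINT x|leb_0_pi. h x * \<phi> x)"
      using f(2) \<phi>(1) unfolding has_weak_deriv_def by (simp add: numeral_2_eq_2)
    moreover have "(LINT x|leb_0_pi. f x * deriv (deriv \<phi>) x) = - (LINT x|leb_0_pi. f' x * deriv \<phi> x)"
      using f(1) deriv_test_function[OF \<phi>(1)] unfolding has_weak_deriv_def by simp
    ultimately have e: "(LINT x|leb_0_pi. h x * \<phi> x) + (LINT x|leb_0_pi. f' x * deriv \<phi> x) = 0" by simp
    have "(LINT x|leb_0_pi. h x * (g x - \<phi> x)) = (LINT x|leb_0_pi. h x * g x) - (LINT x|leb_0_pi. h x * \<phi> x)"
      unfolding right_diff_distrib using sq sp by (intro Bochner_Integration.integral_diff square_integrable_mult)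
    moreover have "(LINT x|leb_0_pi. f' x * (g' x - deriv \<phi> x)) = (LINT x|leb_0_pi. f' x * g' x) - (LINT x|leb_0_pi. f' x * deriv \<phi> x)"
      unfolding right_diff_distrib using sq sp by (intro Bochner_Integration.integral_diff square_integrable_mult)
    ultimately have "?X = (LINT x|leb_0_pi. h x * (g x - \<phi> x)) + (LINT x|leb_0_pi. f' x * (g' x - deriv \<phi> x))"
      using e by linarith
    then have "\<bar>?X\<bar> \<le> (t * (LINT x|leb_0_pi. (h x)\<^sup>2) + (LINT x|leb_0_pi. (g x - \<phi> x)\<^sup>2) / t)
       + (t * (LINT x|leb_0_pi. (f' x)\<^sup>2) + (LINT x|leb_0_pi. (g' x - deriv \<phi> x)\<^sup>2) / t)"
      using abs_integral_mult_le[OF sq(1) sd(1) t] abs_integral_mult_le[OF sq(2) sd(2) t] by linarith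
    also have "\<dots> = t * ((LINT x|leb_0_pi. (h x)\<^sup>2) + (LINT x|leb_0_pi. (f' x)\<^sup>2))
       + ((LINT x|leb_0_pi. (g x - \<phi> x)\<^sup>2) + (LINT x|leb_0_pi. (g' x - deriv \<phi> x)\<^sup>2)) / t"
      by (simp add: distrib_left add_divide_distrib)
    also have "\<dots> \<le> t * ((LINT x|leb_0_pi. (h x)\<^sup>2) + (LINT x|leb_0_pi. (f' x)\<^sup>2)) + t\<^sup>2 / t"
      using \<phi>(2) t by (intro add_left_mono divide_right_mono) auto
    also have "\<dots> = t * ?K" using t by (simp add: distrib_left power2_eq_square)
    finally show ?thesis .
  qed
  have "?X = 0"
  proof (rule ccontr)
    assume n: "?X \<noteq> 0"
    have K: "?K > 0" by (intro add_nonneg_pos add_nonneg_nonneg) auto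
    have "\<bar>?X\<bar> \<le> \<bar>?X\<bar> / (2 * ?K) * ?K" using n K by (intro le) auto
    also have "\<dots> = \<bar>?X\<bar> / 2"
    proof -
      have "A / (2 * B) * B = A / 2" if "B > 0" for A B :: real using that by simp
      then show ?thesis using K by blast
    qed
    finally show False using n by simp
  qed
  then show ?thesis by simp
qed

definition dirichlet_eigenpair :: "(real \<Rightarrow> real) \<Rightarrow> real \<Rightarrow> (real \<Rightarrow> real) \<Rightarrow> bool" where
  "dirichlet_eigenpair W l f \<longleftrightarrow> f \<in> sobolev {0<..<pi} 2 \<inter> sobolev_1_0 {0<..<pi} \<and>
     (\<exists>h. has_weak_deriv {0<..<pi} 2 f h \<and> (AE x in leb_0_pi. - h x + W x * f x = l * f x))"

text \<open>By Green's identity, the second weak derivative is symmetric on \<open>H\<^sup>2 \<inter> H\<^sup>1\<^sub>0\<close>. The product of the potential and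
an eigenfunction is square-integrable because the eigenvalue equation expresses it by square-integrable functions.\<close>

lemma eigenpair_orthogonal:
  assumes f: "dirichlet_eigenpair W l f" and g: "dirichlet_eigenpair W m g" and ne: "l \<noteq> m"
  shows "(LINT x|leb_0_pi. f x * g x) = 0"
proof -
  obtain h k f' g' where h: "has_weak_deriv {0<..<pi} 2 f h" "AE x in leb_0_pi. - h x + W x * f x = l * f x"
    and k: "has_weak_deriv {0<..<pi} 2 g k" "AE x in leb_0_pi. - k x + W x * g x = m * g x"
    and f': "H10_derivative f f'" and g': "H10_derivative g g'"
    using f g unfolding dirichlet_eigenpair_def sobolev_1_0_def H10_derivative_def by auto
  have sq: "f \<in> square_integrable leb_0_pi" "g \<in> square_integrable leb_0_pi" "h \<in> square_integrable leb_0_pi" "k \<in> square_integrable leb_0_pi"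
    using h k unfolding has_weak_deriv_def by auto
  have w: "has_weak_deriv {0<..<pi} 1 f f'" "has_weak_deriv {0<..<pi} 1 g g'"
    using f' g' unfolding H10_derivative_def by auto
  have "(LINT x|leb_0_pi. h x * g x) = - (LINT x|leb_0_pi. f' x * g' x)" by (rule weak_green[OF w(1) h(1) g'])
  moreover have "(LINT x|leb_0_pi. k x * f x) = - (LINT x|leb_0_pi. g' x * f' x)" by (rule weak_green[OF w(2) k(1) f'])
  ultimately have s: "(LINT x|leb_0_pi. h x * g x) = (LINT x|leb_0_pi. k x * f x)" by (simp add: mult.commute)
  note i = square_integrable_mult[OF sq(3,2)] square_integrable_mult[OF sq(4,1)] square_integrable_mult[OF sq(1,2)]
  have m: "f \<in> borel_measurable leb_0_pi" "g \<in> borel_measurable leb_0_pi" "h \<in> borel_measurable leb_0_pi" "k \<in> borel_measurable leb_0_pi"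
    using sq by (auto simp: square_integrable_def)
  have "(LINT x|leb_0_pi. h x * g x + l * (f x * g x)) = (LINT x|leb_0_pi. k x * f x + m * (f x * g x))"
  proof (rule integral_cong_AE)
    show "AE x in leb_0_pi. h x * g x + l * (f x * g x) = k x * f x + m * (f x * g x)"
      using h(2) k(2)
    proof eventually_elim
      case (elim x)
      have "(- h x + W x * f x) * g x = l * f x * g x" "(- k x + W x * g x) * f x = m * g x * f x"
        using elim by auto
      then show ?case by (simp add: algebra_simps)
    qed
  qed (use m in measurable)
  then have "l * (LINT x|leb_0_pi. f x * g x) = m * (LINT x|leb_0_pi. f x * g x)" using s i by simp
  then show ?thesis using ne by simp
qed

text \<open>Pythagoras: subtracting something orthogonal to \<open>f\<close> cannot bring it closer to zero.\<close>

lemma integral_square_diff_lin_comb: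
  assumes b: "\<And>n. n \<ge> 1 \<Longrightarrow> b n \<in> square_integrable M" and f: "f \<in> square_integrable M"
    and o: "\<And>n. n \<ge> 1 \<Longrightarrow> (LINT x|M. f x * b n x) = 0"
  shows "(LINT x|M. (f x)\<^sup>2) \<le> (LINT x|M. (f x - (\<Sum>n=1..N. c n * b n x))\<^sup>2)"
proof -
  let ?s = "\<lambda>x. \<Sum>n=1..N. c n * b n x"
  have s: "?s \<in> square_integrable M" using b by (intro square_integrable_sum square_integrable_cmult) auto
  have z: "(LINT x|M. f x * ?s x) = 0"
  proof -
    have "(LINT x|M. f x * ?s x) = (LINT x|M. (\<Sum>n=1..N. c n * (f x * b n x)))"
      by (simp add: sum_distrib_left mult_ac)
    also have "\<dots> = (\<Sum>n=1..N. c n * (LINT x|M. f x * b n x))"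
      using square_integrable_mult[OF f b] by (subst Bochner_Integration.integral_sum) auto
    also have "\<dots> = 0" using o by simp
    finally show ?thesis .
  qed
  have i: "integrable M (\<lambda>x. (f x)\<^sup>2)" "integrable M (\<lambda>x. (?s x)\<^sup>2)" "integrable M (\<lambda>x. f x * ?s x)"
    using f s square_integrable_mult[OF f s] by (auto simp: square_integrable_def)
  have "(LINT x|M. (f x - ?s x)\<^sup>2) = (LINT x|M. ((f x)\<^sup>2 + (?s x)\<^sup>2) - 2 * (f x * ?s x))"
    by (simp add: power2_diff mult.assoc)
  also have "\<dots> = (LINT x|M. (f x)\<^sup>2) + (LINT x|M. (?s x)\<^sup>2)"
    using i z by simp
  finally show ?thesis by simp
qed

lemma strict_mono_on_same_image_eq:
  fixes a b :: "nat \<Rightarrow> real"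
  assumes a: "strict_mono_on {1..} a" and b: "strict_mono_on {1..} b" and ab: "a ` {1..} = b ` {1..}"
  shows "n \<ge> 1 \<Longrightarrow> a n = b n"
proof (induction n rule: less_induct)
  case (less n)
  have lemma1: "\<not> x n < y n" if x: "strict_mono_on {1..} x" and y: "strict_mono_on {1..} y"
    and xy: "x ` {1..} = y ` {1..}" and IH: "\<And>m. m < n \<Longrightarrow> 1 \<le> m \<Longrightarrow> x m = y m" for x y :: "nat \<Rightarrow> real"
  proof
    assume l: "x n < y n"
    have "x n \<in> y ` {1..}" using less.prems xy by blast
    then obtain m where m: "m \<ge> 1" "x n = y m" by auto
    then have "y m < y n" using l by simp
    then have "m < n" using y m(1) less.prems
      by (metis atLeast_iff linorder_neqE_nat order_less_imp_not_less strict_mono_onD)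
    then have "x m = y m" using IH m by simp
    then have "x n = x m" using m by simp
    moreover have "x m < x n" using x m(1) less.prems \<open>m < n\<close> by (auto simp: strict_mono_on_def)
    ultimately show False by simp
  qed
  show ?case using lemma1[OF a b ab] lemma1[OF b a ab[symmetric]] less.IH by force
qed

text \<open>An eigenvalue of one spectrum that is missing from the other has an eigenfunction orthogonal to a complete family,
which is impossible for a function of norm one. So both sequences enumerate the same set increasingly.\<close>

lemma dirichlet_spectrum_unique:
  assumes "is_dirichlet_spectrum W lam" "is_dirichlet_spectrum W mu" "n \<ge> 1"
  shows "lam n = mu n"
proof -
  have sub: "lam ` {1..} \<subseteq> mu ` {1..}"
    if l: "is_dirichlet_spectrum W lam" and m: "is_dirichlet_spectrum W mu" for lam mu
  proof
    fix y assume "y \<in> lam ` {1..}"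
    then obtain n where n: "n \<ge> 1" "y = lam n" by auto
    obtain f where f: "hilbert_basis leb_0_pi f" "\<forall>n\<ge>1. dirichlet_eigenpair W (lam n) (f n)"
      using l unfolding is_dirichlet_spectrum_def dirichlet_eigenpair_def by blast
    obtain g where g: "hilbert_basis leb_0_pi g" "\<forall>n\<ge>1. dirichlet_eigenpair W (mu n) (g n)"
      using m unfolding is_dirichlet_spectrum_def dirichlet_eigenpair_def by blast
    show "y \<in> mu ` {1..}"
    proof (rule ccontr)
      assume "y \<notin> mu ` {1..}"
      then have o: "(LINT x|leb_0_pi. f n x * g k x) = 0" if "k \<ge> 1" for k
        using f g n that by (intro eigenpair_orthogonal[of W "lam n" _ "mu k"]) auto
      have fs: "f n \<in> square_integrable leb_0_pi" using f n unfolding hilbert_basis_def by blast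
      have gs: "g k \<in> square_integrable leb_0_pi" if "k \<ge> 1" for k using g that unfolding hilbert_basis_def by blast
      have "(LINT x|leb_0_pi. f n x * f n x) = 1" using f(1) n unfolding hilbert_basis_def by simp
      moreover obtain N c where "(LINT x|leb_0_pi. (f n x - (\<Sum>k=1..N. c k * g k x))\<^sup>2) < 1"
        using g(1) fs unfolding hilbert_basis_def by (meson zero_less_one)
      ultimately show False
        using integral_square_diff_lin_comb[where b = g and f = "f n" and M = leb_0_pi and c = c and N = N, OF gs fs o] by (simp add: power2_eq_square)
    qed
  qed
  have "lam ` {1..} = mu ` {1..}" using sub assms(1,2) by blast
  then show ?thesis
    using strict_mono_on_same_image_eq[of lam mu n] assms unfolding is_dirichlet_spectrum_def by blast
qed

lemma dirichlet_eigenvalue_eq: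
  assumes "is_dirichlet_spectrum W lam" "n \<ge> 1"
  shows "dirichlet_eigenvalue W n = lam n"
  unfolding dirichlet_eigenvalue_def
proof (rule the_equality)
  show "\<exists>lam'. is_dirichlet_spectrum W lam' \<and> lam n = lam' n" using assms(1) by blast
  show "l = lam n" if "\<exists>lam'. is_dirichlet_spectrum W lam' \<and> l = lam' n" for l
    using that dirichlet_spectrum_unique[OF _ assms(1) assms(2)] by blast
qed

section \<open>Completeness of the sines\<close>

text \<open>Finite linear combinations, with indices from \<open>1\<close> on as in \<^const>\<open>hilbert_basis\<close>.\<close>

inductive lin_comb :: "(nat \<Rightarrow> real \<Rightarrow> real) \<Rightarrow> (real \<Rightarrow> real) \<Rightarrow> bool" for b where
  zero: "lin_comb b (\<lambda>_. 0)"
| step: "lin_comb b f \<Longrightarrow> 1 \<le> n \<Longrightarrow> lin_comb b (\<lambda>x. f x + a * b n x)"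

lemma lin_comb_add:
  assumes "lin_comb b g" shows "lin_comb b f \<Longrightarrow> lin_comb b (\<lambda>x. f x + g x)"
  using assms
proof (induction rule: lin_comb.induct)
  case (step g n a)
  then show ?case using lin_comb.step[of b "\<lambda>x. f x + g x" n a] by (simp add: add.assoc)
qed simp

lemma lin_comb_cmult: "lin_comb b f \<Longrightarrow> lin_comb b (\<lambda>x. c * f x)"
proof (induction rule: lin_comb.induct)
  case (step f n a)
  then show ?case using lin_comb.step[of b "\<lambda>x. c * f x" n "c * a"] by (simp add: distrib_left mult.assoc)
qed (simp add: lin_comb.zero)

lemma lin_comb_base: "1 \<le> n \<Longrightarrow> lin_comb b (b n)"
  using lin_comb.step[OF lin_comb.zero, of n b 1] by simp

lemma lin_comb_sum: "(\<And>i. i \<in> A \<Longrightarrow> lin_comb b (f i)) \<Longrightarrow> lin_comb b (\<lambda>x. \<Sum>i\<in>A. f i x)"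
  by (induction A rule: infinite_finite_induct) (simp_all add: lin_comb.zero lin_comb_add)

lemma lin_comb_explicit: "lin_comb b f \<Longrightarrow> \<exists>N c. \<forall>x. f x = (\<Sum>n=1..N. c n * b n x)"
proof (induction rule: lin_comb.induct)
  case zero
  then show ?case by (intro exI[of _ 0]) simp
next
  case (step f m a)
  then obtain N c where f: "\<forall>x. f x = (\<Sum>n=1..N. c n * b n x)" by blast
  let ?c = "\<lambda>n. (if n \<le> N then c n else 0) + (if n = m then a else 0)"
  have "f x + a * b m x = (\<Sum>n=1..max N m. ?c n * b n x)" for x
  proof -
    have "(\<Sum>n=1..max N m. (if n \<le> N then c n else 0) * b n x) = (\<Sum>n=1..N. c n * b n x)"
      by (rule sum.mono_neutral_cong_right) auto
    moreover have "(\<Sum>n=1..max N m. (if n = m then a else 0) * b n x) = (\<Sum>n\<in>{m}. a * b n x)"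
      using step(2) by (intro sum.mono_neutral_cong_right) auto
    ultimately show ?thesis using f by (simp add: distrib_right sum.distrib)
  qed
  then show ?case by (intro exI[of _ "max N m"] exI[of _ ?c] allI)
qed

abbreviation "sine n \<equiv> (\<lambda>x. sin (real n * x))"

lemma lin_comb_sine_cos: "lin_comb sine f \<Longrightarrow> lin_comb sine (\<lambda>x. cos x * f x)"
proof (induction rule: lin_comb.induct)
  case zero
  then show ?case by (simp add: lin_comb.zero)
next
  case (step f n a)
  have low: "lin_comb sine (\<lambda>x. sin (real (n - 1) * x))"
  proof (cases "n = 1")
    case True
    then show ?thesis by (simp add: lin_comb.zero)
  next
    case False
    then show ?thesis using step(2) False by (intro lin_comb_base) auto
  qed
  have "lin_comb sine (\<lambda>x. cos x * f x + ((a / 2) * sin (real (n - 1) * x) + (a / 2) * sin (real (Suc n) * x)))"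
    by (rule lin_comb_add[OF lin_comb_add[OF lin_comb_cmult[OF lin_comb_base[of "Suc n" sine]] lin_comb_cmult[OF low]] step.IH]) simp
  moreover have "cos x * f x + ((a / 2) * sin (real (n - 1) * x) + (a / 2) * sin (real (Suc n) * x))
      = cos x * (f x + a * sin (real n * x))" for x
  proof -
    have "real (n - 1) * x = real n * x - x" "real (Suc n) * x = real n * x + x"
      using step(2) by (simp_all add: of_nat_diff algebra_simps)
    then show ?thesis by (simp only: sin_add sin_diff) (simp add: algebra_simps)
  qed
  ultimately show ?case by simp
qed

lemma lin_comb_sine_polynomial:
  assumes "real_polynomial_function p" shows "lin_comb sine (\<lambda>x. sin x * p (cos x))"
proof -
  obtain a n where p: "p = (\<lambda>x. \<Sum>i\<le>n. a i * x ^ i)"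
    using assms unfolding real_polynomial_function_iff_sum by blast
  have "lin_comb sine (\<lambda>x. cos x ^ i * sin x)" for i
  proof (induction i)
    case 0
    show ?case using lin_comb_base[of 1 sine] by simp
  next
    case (Suc i)
    from lin_comb_sine_cos[OF Suc] show ?case by (simp add: mult.assoc)
  qed
  then have "lin_comb sine (\<lambda>x. \<Sum>i\<le>n. a i * (cos x ^ i * sin x))"
    by (intro lin_comb_sum lin_comb_cmult)
  then show ?thesis unfolding p by (simp add: sum_distrib_left mult_ac)
qed

text \<open>The function \<open>q\<close> is a continuous function of \<open>cos x\<close>, hence a uniform limit of polynomials in \<open>cos x\<close>, and
\<open>sin x\<close> times such a polynomial is a combination of sines.\<close>

lemma uniform_sine_approximation:
  assumes q: "continuous_on {0..pi} q" and e: "e > 0"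
  obtains f where "lin_comb sine f" "\<And>x. x \<in> {0..pi} \<Longrightarrow> \<bar>sin x * q x - f x\<bar> \<le> e"
proof -
  have "continuous_on {-1..1} (q \<circ> arccos)"
    by (intro continuous_on_compose continuous_on_arccos' continuous_on_subset[OF q])
       (auto simp: arccos_lbound arccos_ubound)
  then have "continuous_on {-1..1} (\<lambda>y. q (arccos y))" by (simp add: o_def)
  then obtain p where p: "real_polynomial_function p" "\<And>y. y \<in> {-1..1} \<Longrightarrow> \<bar>q (arccos y) - p y\<bar> < e"
    using Stone_Weierstrass_real_polynomial_function[OF _ _ e, of "{-1..1}" "\<lambda>y. q (arccos y)"] by auto
  show ?thesis
  proof (rule that[OF lin_comb_sine_polynomial[OF p(1)]])
    fix x :: real assume x: "x \<in> {0..pi}"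
    then have "\<bar>q x - p (cos x)\<bar> \<le> e" using p(2)[of "cos x"] by (simp add: arccos_cos)
    then have "\<bar>sin x\<bar> * \<bar>q x - p (cos x)\<bar> \<le> 1 * e" by (intro mult_mono) auto
    then show "\<bar>sin x * q x - sin x * p (cos x)\<bar> \<le> e" by (simp add: abs_mult[symmetric] right_diff_distrib)
  qed
qed

lemma integral_square_sum_le:
  assumes f: "f \<in> square_integrable M" and g: "g \<in> square_integrable M"
  shows "(LINT x|M. (f x + g x)\<^sup>2) \<le> 2 * (LINT x|M. (f x)\<^sup>2) + 2 * (LINT x|M. (g x)\<^sup>2)"
proof -
  have i: "integrable M (\<lambda>x. (f x)\<^sup>2)" "integrable M (\<lambda>x. (g x)\<^sup>2)" "integrable M (\<lambda>x. (f x + g x)\<^sup>2)"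
    using f g square_integrable_add[OF f g] by (auto simp: square_integrable_def)
  have "(LINT x|M. (f x + g x)\<^sup>2) \<le> (LINT x|M. 2 * (f x)\<^sup>2 + 2 * (g x)\<^sup>2)"
  proof (rule integral_mono[OF i(3)])
    show "integrable M (\<lambda>x. 2 * (f x)\<^sup>2 + 2 * (g x)\<^sup>2)" using i by simp
    show "(f x + g x)\<^sup>2 \<le> 2 * (f x)\<^sup>2 + 2 * (g x)\<^sup>2" for x
      using zero_le_power2[of "f x - g x"] unfolding power2_sum power2_diff by linarith
  qed
  also have "\<dots> = 2 * (LINT x|M. (f x)\<^sup>2) + 2 * (LINT x|M. (g x)\<^sup>2)" using i by simp
  finally show ?thesis .
qed

lemma integral_square_bounded:
  fixes f :: "real \<Rightarrow> real"
  assumes "f \<in> borel_measurable leb_0_pi" "\<And>x. x \<in> {0<..<pi} \<Longrightarrow> \<bar>f x\<bar> \<le> e" "0 \<le> e"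
  shows "(LINT x|leb_0_pi. (f x)\<^sup>2) \<le> pi * e\<^sup>2"
proof -
  have b: "(f x)\<^sup>2 \<le> e\<^sup>2" if "x \<in> {0<..<pi}" for x
    using power_mono[OF assms(2)[OF that], of 2] by simp
  have "(LINT x|leb_0_pi. (f x)\<^sup>2) \<le> (LINT x|leb_0_pi. e\<^sup>2)"
  proof (rule integral_mono)
    show "integrable leb_0_pi (\<lambda>x. (f x)\<^sup>2)"
      by (rule bounded_integrable_0_pi[where B = "e\<^sup>2"]) (use assms b in auto)
    show "integrable leb_0_pi (\<lambda>x. e\<^sup>2)" by (intro continuous_integrable_0_pi continuous_intros)
  qed (use b in auto)
  also have "\<dots> = pi * e\<^sup>2" by (simp add: measure_0_pi[simplified])
  finally show ?thesis .
qed

lemma dominated_square_limit: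
  fixes g :: "real \<Rightarrow> real"
  assumes v: "\<And>j. v j \<in> borel_measurable leb_0_pi" and g: "g \<in> borel_measurable leb_0_pi"
    and w: "integrable leb_0_pi w" "\<And>j. AE x in leb_0_pi. (g x - v j x)\<^sup>2 \<le> w x"
    and lim: "AE x in leb_0_pi. (\<lambda>j. v j x) \<longlonglongrightarrow> g x"
  shows "(\<lambda>j::nat. LINT x|leb_0_pi. (g x - v j x)\<^sup>2) \<longlonglongrightarrow> 0"
proof -
  have "(\<lambda>j. LINT x|leb_0_pi. (g x - v j x)\<^sup>2) \<longlonglongrightarrow> (LINT x|leb_0_pi. 0)"
  proof (rule integral_dominated_convergence[where w = w])
    show "AE x in leb_0_pi. (\<lambda>j. (g x - v j x)\<^sup>2) \<longlonglongrightarrow> 0"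
      using lim
    proof eventually_elim
      case (elim x)
      then have "(\<lambda>j. (g x - v j x)\<^sup>2) \<longlonglongrightarrow> (g x - g x)\<^sup>2" by (intro tendsto_intros)
      then show ?case by simp
    qed
    show "AE x in leb_0_pi. norm ((g x - v j x)\<^sup>2) \<le> w x" for j using w(2)[of j] by simp
    show "(\<lambda>x. (g x - v j x)\<^sup>2) \<in> borel_measurable leb_0_pi" for j using v[of j] g by measurable
  qed (use w in auto)
  then show ?thesis by simp
qed

definition clip :: "real \<Rightarrow> real \<Rightarrow> real" where "clip m y = max (- m) (min m y)"

lemma clip_bounds: "0 \<le> m \<Longrightarrow> \<bar>clip m y\<bar> \<le> m" "0 \<le> m \<Longrightarrow> \<bar>y - clip m y\<bar> \<le> \<bar>y\<bar>" "\<bar>y\<bar> \<le> m \<Longrightarrow> clip m y = y"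
  by (auto simp: clip_def)

text \<open>A measurable function is almost everywhere a limit of continuous ones. In order to factor out \<open>sin x\<close>, which vanishes
at the end points, these are divided by \<open>max (sin x) (1 / n)\<close>; the resulting factor \<open>sin x / max (sin x) (1 / n)\<close> lies between
\<open>0\<close> and \<open>1\<close> and is eventually \<open>1\<close> at each interior point.\<close>

lemma bounded_sine_approximation:
  assumes g: "g \<in> borel_measurable leb_0_pi" and m: "0 \<le> m" "\<And>x. x \<in> {0<..<pi} \<Longrightarrow> \<bar>g x\<bar> \<le> m" and e: "e > 0"
  obtains f where "lin_comb sine f" "(LINT x|leb_0_pi. (g x - f x)\<^sup>2) < e"
proof -
  let ?G = "\<lambda>x. if x \<in> {0<..<pi} then g x else 0"
  have "?G \<in> borel_measurable lebesgue"
    by (rule borel_measurable_if_I[OF g]) simp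
  then have "?G measurable_on UNIV" by (rule lebesgue_measurable_imp_measurable_on_real) simp
  then obtain N F where N: "negligible N" "\<And>n::nat. continuous_on UNIV (F n)"
    "\<And>x. x \<notin> N \<Longrightarrow> (\<lambda>n. F n x) \<longlonglongrightarrow> ?G x"
    unfolding measurable_on_def by auto
  \<comment> \<open>Clipping at the bound of \<open>g\<close> provides a constant dominating function.\<close>
  define q where "q = (\<lambda>n x. clip m (F n x) * (1 / max (sin x) (1 / real (Suc n))))"
  have pos: "0 < max (sin x) (1 / real (Suc n))" for n x by (simp add: less_max_iff_disj)
  have cq: "continuous_on A (q n)" for n A
    unfolding q_def clip_def
    by (intro continuous_intros continuous_on_subset[OF N(2)]) (use pos less_irrefl in \<open>auto simp: max_def\<close>)
  define v where "v = (\<lambda>n x. sin x * q n x)"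
  have cv: "continuous_on A (v n)" for n A unfolding v_def by (intro continuous_intros cq)
  have vb: "\<bar>v n x\<bar> \<le> m" if "x \<in> {0<..<pi}" for n x
  proof -
    have s: "0 \<le> sin x" using that by (intro sin_ge_zero) auto
    have "\<bar>v n x\<bar> = \<bar>clip m (F n x)\<bar> * (sin x / max (sin x) (1 / real (Suc n)))"
      using s pos[of x n] by (simp add: v_def q_def abs_mult)
    also have "\<dots> \<le> m * 1"
      using clip_bounds(1)[OF m(1)] s pos[of x n] m(1) by (intro mult_mono) (auto simp: divide_le_eq)
    finally show ?thesis by simp
  qed
  have vl: "(\<lambda>n. v n x) \<longlonglongrightarrow> g x" if x: "x \<in> {0<..<pi}" "x \<notin> N" for x
  proof -
    have s: "0 < sin x" using x by (intro sin_gt_zero) auto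
    have "eventually (\<lambda>n. inverse (real (Suc n)) < sin x) sequentially"
      by (rule order_tendstoD(2)[OF LIMSEQ_inverse_real_of_nat s])
    then have "eventually (\<lambda>n. clip m (F n x) = v n x) sequentially"
    proof eventually_elim
      case (elim n)
      then have "max (sin x) (1 / real (Suc n)) = sin x" by (simp add: max_def inverse_eq_divide)
      then show ?case using s by (simp add: v_def q_def)
    qed
    moreover have "(\<lambda>n. clip m (F n x)) \<longlonglongrightarrow> clip m (g x)"
      unfolding clip_def using N(3)[OF x(2)] x(1) by (intro tendsto_intros) simp
    ultimately show ?thesis using Lim_transform_eventually clip_bounds(3)[OF m(2)[OF x(1)]] by force
  qed
  have "(\<lambda>j. LINT x|leb_0_pi. (g x - v j x)\<^sup>2) \<longlonglongrightarrow> 0"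
  proof (rule dominated_square_limit[where w = "\<lambda>_. (2 * m)\<^sup>2"])
    show "AE x in leb_0_pi. (g x - v j x)\<^sup>2 \<le> (2 * m)\<^sup>2" for j
    proof (rule AE_I2)
      fix x assume "x \<in> space leb_0_pi"
      then have "\<bar>g x - v j x\<bar> \<le> 2 * m" using m(2)[of x] vb[of x j] by auto
      then have "\<bar>g x - v j x\<bar>\<^sup>2 \<le> (2 * m)\<^sup>2" by (intro power_mono) auto
      then show "(g x - v j x)\<^sup>2 \<le> (2 * m)\<^sup>2" by simp
    qed
    have "AE x in lebesgue. x \<notin> N" using N(1) by (simp add: negligible_iff_null_sets AE_not_in)
    then have "AE x in lebesgue. x \<in> {0<..<pi} \<longrightarrow> x \<notin> N" by eventually_elim simp
    then have "AE x in leb_0_pi. x \<notin> N" by (simp add: AE_restrict_space_iff)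
    then show "AE x in leb_0_pi. (\<lambda>j. v j x) \<longlonglongrightarrow> g x"
      using AE_space[of leb_0_pi] by eventually_elim (use vl in simp)
    show "integrable leb_0_pi (\<lambda>_. (2 * m)\<^sup>2)" by (intro continuous_integrable_0_pi continuous_intros)
  qed (use g in \<open>auto intro!: continuous_measurable_0_pi cv\<close>)
  then have "eventually (\<lambda>j. (LINT x|leb_0_pi. (g x - v j x)\<^sup>2) < e / 4) sequentially"
    by (rule order_tendstoD(2)) (use e in simp)
  then obtain j where j: "(LINT x|leb_0_pi. (g x - v j x)\<^sup>2) < e / 4" by (auto simp: eventually_sequentially)
  define d where "d = sqrt (e / (8 * pi))"
  have d: "d > 0" "d\<^sup>2 = e / (8 * pi)" using e by (auto simp: d_def)
  obtain f where f: "lin_comb sine f" "\<And>x. x \<in> {0..pi} \<Longrightarrow> \<bar>sin x * q j x - f x\<bar> \<le> d"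
    using uniform_sine_approximation[OF cq d(1)] by blast
  obtain M c where c: "\<forall>x. f x = (\<Sum>n=1..M. c n * sin (real n * x))" using lin_comb_explicit[OF f(1)] by blast
  have cf: "continuous_on A f" for A
    using c by (subst continuous_on_cong[OF refl, of _ _ "\<lambda>x. \<Sum>n=1..M. c n * sin (real n * x)"]) (auto intro!: continuous_intros)
  have vf: "(LINT x|leb_0_pi. (v j x - f x)\<^sup>2) \<le> pi * d\<^sup>2"
  proof (rule integral_square_bounded)
    show "(\<lambda>x. v j x - f x) \<in> borel_measurable leb_0_pi"
      by (intro continuous_measurable_0_pi continuous_intros cv cf)
  qed (use f(2) d in \<open>auto simp: v_def\<close>)
  have gs: "g \<in> square_integrable leb_0_pi"
    unfolding square_integrable_def using g m
    by (auto intro!: bounded_integrable_0_pi[where B = "m\<^sup>2"] simp: abs_le_square_iff[symmetric])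
  have vs: "v j \<in> square_integrable leb_0_pi" "f \<in> square_integrable leb_0_pi" by (rule continuous_square_integrable cv cf)+
  have "(LINT x|leb_0_pi. (g x - f x)\<^sup>2) = (LINT x|leb_0_pi. ((g x - v j x) + (v j x - f x))\<^sup>2)" by simp
  also have "\<dots> \<le> 2 * (LINT x|leb_0_pi. (g x - v j x)\<^sup>2) + 2 * (LINT x|leb_0_pi. (v j x - f x)\<^sup>2)"
    by (intro integral_square_sum_le square_integrable_diff gs vs)
  also have "\<dots> < 2 * (e / 4) + 2 * (pi * d\<^sup>2)" using j vf by linarith
  also have "\<dots> \<le> e" unfolding d(2) using e by simp
  finally show ?thesis using that f(1) by blast
qed

lemma sine_approximation:
  assumes g: "g \<in> square_integrable leb_0_pi" and e: "e > 0"
  obtains f where "lin_comb sine f" "(LINT x|leb_0_pi. (g x - f x)\<^sup>2) < e"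
proof -
  have gm: "g \<in> borel_measurable leb_0_pi" and gi: "integrable leb_0_pi (\<lambda>x. (g x)\<^sup>2)" using g by (auto simp: square_integrable_def)
  define v where "v = (\<lambda>n::nat. \<lambda>x. clip (real n) (g x))"
  have vm: "v n \<in> borel_measurable leb_0_pi" for n unfolding v_def clip_def using gm by measurable
  have "(\<lambda>j. LINT x|leb_0_pi. (g x - v j x)\<^sup>2) \<longlonglongrightarrow> 0"
  proof (rule dominated_square_limit[OF vm gm gi])
    show "AE x in leb_0_pi. (g x - v j x)\<^sup>2 \<le> (g x)\<^sup>2" for j
      unfolding v_def using clip_bounds(2)[of "real j"] by (auto simp: abs_le_square_iff)
    show "AE x in leb_0_pi. (\<lambda>j. v j x) \<longlonglongrightarrow> g x"
    proof (rule AE_I2)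
      fix x
      obtain N :: nat where N: "\<bar>g x\<bar> \<le> real N" using real_arch_simple by blast
      have "eventually (\<lambda>j. v j x = g x) sequentially"
        using eventually_ge_at_top[of N] by eventually_elim (use N in \<open>auto simp: v_def intro!: clip_bounds(3)\<close>)
      then show "(\<lambda>j. v j x) \<longlonglongrightarrow> g x" by (rule tendsto_eventually)
    qed
  qed
  then have "eventually (\<lambda>j. (LINT x|leb_0_pi. (g x - v j x)\<^sup>2) < e / 4) sequentially"
    by (rule order_tendstoD(2)) (use e in simp)
  then obtain j where j: "(LINT x|leb_0_pi. (g x - v j x)\<^sup>2) < e / 4" by (auto simp: eventually_sequentially)
  have vb: "\<bar>v j x\<bar> \<le> real j" for x unfolding v_def by (rule clip_bounds(1)) simp
  obtain f where f: "lin_comb sine f" "(LINT x|leb_0_pi. (v j x - f x)\<^sup>2) < e / 4"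
    using bounded_sine_approximation[OF vm, of "real j" j "e / 4"] vb e by auto
  obtain M c where c: "\<forall>x. f x = (\<Sum>n=1..M. c n * sin (real n * x))" using lin_comb_explicit[OF f(1)] by blast
  have "continuous_on {0..pi} f"
    using c by (subst continuous_on_cong[OF refl, of _ _ "\<lambda>x. \<Sum>n=1..M. c n * sin (real n * x)"]) (auto intro!: continuous_intros)
  then have fs: "f \<in> square_integrable leb_0_pi" by (rule continuous_square_integrable)
  have vs: "v j \<in> square_integrable leb_0_pi"
    unfolding square_integrable_def using vm vb
    by (auto intro!: bounded_integrable_0_pi[where B = "(real j)\<^sup>2"] simp: abs_le_square_iff[symmetric])
  have "(LINT x|leb_0_pi. (g x - f x)\<^sup>2) = (LINT x|leb_0_pi. ((g x - v j x) + (v j x - f x))\<^sup>2)" by simp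
  also have "\<dots> \<le> 2 * (LINT x|leb_0_pi. (g x - v j x)\<^sup>2) + 2 * (LINT x|leb_0_pi. (v j x - f x)\<^sup>2)"
    by (intro integral_square_sum_le square_integrable_diff g vs fs)
  also have "\<dots> < e" using j f(2) by linarith
  finally show ?thesis using that f(1) by blast
qed

section \<open>The eigenvalue problem in the sine basis\<close>

text \<open>The matrix, in the basis \<open>sin (l * x)\<close>, of multiplication by \<open>\<Sum>k. w k * cos (k * x)\<close> when \<open>w 0 = 0\<close>; the first argument of \<open>w\<close> is
\<open>\<bar>l - j\<bar>\<close>, written with truncated subtraction. Row and column \<open>0\<close> vanish, so the function \<open>sin (0 * x) = 0\<close> does no harm as a
member of the basis.\<close>

definition mult_matrix :: "(nat \<Rightarrow> real) \<Rightarrow> nat \<Rightarrow> nat \<Rightarrow> real" where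
  "mult_matrix w l j = (w ((l - j) + (j - l)) - w (l + j)) / 2"

text \<open>The potential has mean zero. Its coefficients are summable, so that the matrix is bounded on summable sequences, and they
decay like \<open>1 / k\<close>, so that the eigenvalues approach \<open>n\<^sup>2\<close> at that rate.\<close>

definition small_coeffs :: "real \<Rightarrow> (nat \<Rightarrow> real) \<Rightarrow> bool" where
  "small_coeffs \<delta> w \<longleftrightarrow>
     w 0 = 0 \<and> (\<forall>k. real k * \<bar>w k\<bar> \<le> \<delta>) \<and> (\<forall>N. (\<Sum>k<N. \<bar>w k\<bar>) \<le> \<delta>)"

definition spectral_gap :: "nat \<Rightarrow> nat \<Rightarrow> real" where
  "spectral_gap n l = (real l)\<^sup>2 - (real n)\<^sup>2"

definition inverse_gap :: "nat \<Rightarrow> nat \<Rightarrow> real" where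
  "inverse_gap n l = (if l = n then 0 else 1 / \<bar>spectral_gap n l\<bar>)"

text \<open>The eigenvector is sought as \<open>e\<^sub>n + u\<close> with \<open>u\<close> orthogonal to \<open>e\<^sub>n\<close>. The unknown is the sequence
\<open>v l = (l\<^sup>2 - n\<^sup>2) * u l\<close>, which need only be bounded: the division by the gaps makes \<open>u\<close> summable.\<close>

definition correction :: "nat \<Rightarrow> (nat \<Rightarrow> real) \<Rightarrow> nat \<Rightarrow> real" where
  "correction n v l = (if l = n then 0 else v l / spectral_gap n l)"

text \<open>The matrix applied to \<open>e\<^sub>n + u\<close>.\<close>

definition action :: "(nat \<Rightarrow> real) \<Rightarrow> nat \<Rightarrow> (nat \<Rightarrow> real) \<Rightarrow> nat \<Rightarrow> real" where
  "action w n v l = mult_matrix w l n + (\<Sum>j. mult_matrix w l j * correction n v j)"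

text \<open>The eigenvalue equation for \<open>e\<^sub>n + u\<close>, solved for \<open>(l\<^sup>2 - n\<^sup>2) * u l\<close>. Since \<open>u n = 0\<close>, the \<open>n\<close>-th component of a fixed
point is \<open>n\<^sup>2 - \<lambda>\<close>, which explains the definition of \<open>eigenvalue\<close> below.\<close>

definition picard_step :: "(nat \<Rightarrow> real) \<Rightarrow> nat \<Rightarrow> (nat \<Rightarrow> real) \<Rightarrow> nat \<Rightarrow> real" where
  "picard_step w n v l = action w n v n * correction n v l - action w n v l"

primrec picard :: "(nat \<Rightarrow> real) \<Rightarrow> nat \<Rightarrow> nat \<Rightarrow> nat \<Rightarrow> real" where
  "picard w n 0 = (\<lambda>_. 0)"
| "picard w n (Suc p) = picard_step w n (picard w n p)"

definition residual :: "(nat \<Rightarrow> real) \<Rightarrow> nat \<Rightarrow> nat \<Rightarrow> real" where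
  "residual w n l = lim (\<lambda>p. picard w n p l)"

definition eigenvalue :: "(nat \<Rightarrow> real) \<Rightarrow> nat \<Rightarrow> real" where
  "eigenvalue w n = (real n)\<^sup>2 - residual w n n"

definition eigencoeff :: "(nat \<Rightarrow> real) \<Rightarrow> nat \<Rightarrow> nat \<Rightarrow> real" where
  "eigencoeff w n l = (if l = n then 1 else 0) + correction n (residual w n) l"

lemma mult_matrix_sym: "mult_matrix w l j = mult_matrix w j l"
  by (simp add: mult_matrix_def add.commute)

lemma small_coeffs_nonneg: "small_coeffs \<delta> w \<Longrightarrow> 0 \<le> \<delta>"
  unfolding small_coeffs_def by (elim conjE allE[of _ 0]) simp

lemma small_coeffs_summable:
  assumes "small_coeffs \<delta> w"
  shows "summable (\<lambda>k. \<bar>w k\<bar>)" "(\<Sum>k. \<bar>w k\<bar>) \<le> \<delta>"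
proof -
  show s: "summable (\<lambda>k. \<bar>w k\<bar>)"
    using assms by (intro summableI_nonneg_bounded[of _ \<delta>]) (auto simp: small_coeffs_def)
  show "(\<Sum>k. \<bar>w k\<bar>) \<le> \<delta>"
    using assms by (intro suminf_le_const[OF s]) (auto simp: small_coeffs_def)
qed

lemma small_coeffs_sum:
  assumes "small_coeffs \<delta> w" "finite F"
  shows "(\<Sum>k\<in>F. \<bar>w k\<bar>) \<le> \<delta>"
  using sum_le_suminf[OF small_coeffs_summable(1)[OF assms(1)] assms(2)]
    small_coeffs_summable(2)[OF assms(1)] by simp

lemma small_coeffs_le:
  assumes "small_coeffs \<delta> w"
  shows "\<bar>w k\<bar> \<le> \<delta>"
  using small_coeffs_sum[OF assms, of "{k}"] by simp

lemma mult_matrix_le: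
  assumes "small_coeffs \<delta> w"
  shows "\<bar>mult_matrix w l j\<bar> \<le> \<delta>"
  using small_coeffs_le[OF assms, of "(l - j) + (j - l)"] small_coeffs_le[OF assms, of "l + j"]
  unfolding mult_matrix_def by (simp add: abs_le_iff)

text \<open>Along a column, each \<open>\<bar>w k\<bar>\<close> occurs at most twice as \<open>\<bar>l - j\<bar> = k\<close> and once as \<open>l + j = k\<close>.\<close>

lemma mult_matrix_column:
  assumes "small_coeffs \<delta> w"
  shows "(\<Sum>l<L. \<bar>mult_matrix w l j\<bar>) \<le> 2 * \<delta>"
proof -
  have 1: "(\<Sum>l<L. \<bar>w (l + j)\<bar>) \<le> \<delta>"
    using small_coeffs_sum[OF assms, of "(\<lambda>l. l + j) ` {..<L}"]
    by (simp add: sum.reindex inj_on_def)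
  have reindexed: "(\<Sum>l\<in>S. \<bar>w ((l - j) + (j - l))\<bar>) \<le> \<delta>"
    if "finite S" "inj_on (\<lambda>l. (l - j) + (j - l)) S" for S
    using small_coeffs_sum[OF assms, of "(\<lambda>l. (l - j) + (j - l)) ` S"] that by (simp add: sum.reindex)
  have 2: "(\<Sum>l\<in>{..<L} \<inter> {..<j}. \<bar>w ((l - j) + (j - l))\<bar>) \<le> \<delta>"
    by (rule reindexed) (auto simp: inj_on_def)
  have 3: "(\<Sum>l\<in>{..<L} - {..<j}. \<bar>w ((l - j) + (j - l))\<bar>) \<le> \<delta>"
    by (rule reindexed) (auto simp: inj_on_def)
  have "(\<Sum>l<L. \<bar>w ((l - j) + (j - l))\<bar>) \<le> 2 * \<delta>"
    using 2 3 by (subst sum.Int_Diff[of _ _ "{..<j}"]) auto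
  moreover have "(\<Sum>l<L. \<bar>mult_matrix w l j\<bar>) \<le>
      (\<Sum>l<L. \<bar>w ((l - j) + (j - l))\<bar> / 2 + \<bar>w (l + j)\<bar> / 2)"
    by (intro sum_mono) (simp add: mult_matrix_def)
  moreover have "0 \<le> \<delta>" using assms by (rule small_coeffs_nonneg)
  ultimately show ?thesis using 1
    by (simp add: sum.distrib flip: sum_divide_distrib)
qed

lemma spectral_gap_lower:
  assumes "l \<noteq> n" shows "\<bar>spectral_gap n l\<bar> \<ge> real l + real n" "\<bar>spectral_gap n l\<bar> \<ge> (real l - real n)\<^sup>2" "spectral_gap n l \<noteq> 0"
proof -
  have e: "\<bar>spectral_gap n l\<bar> = \<bar>real l - real n\<bar> * (real l + real n)"
    unfolding spectral_gap_def by (simp add: power2_eq_square square_diff_square_factored abs_mult)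
  have "\<bar>real l - real n\<bar> \<ge> 1" using assms by linarith
  then show "\<bar>spectral_gap n l\<bar> \<ge> real l + real n"
    unfolding e using mult_right_mono[of 1 "\<bar>real l - real n\<bar>" "real l + real n"] by simp
  have "\<bar>real l - real n\<bar> * \<bar>real l - real n\<bar> \<le> \<bar>real l - real n\<bar> * (real l + real n)"
    by (intro mult_left_mono) auto
  then show 2: "\<bar>spectral_gap n l\<bar> \<ge> (real l - real n)\<^sup>2"
    unfolding e by (simp add: power2_eq_square flip: abs_mult)
  have "(real l - real n)\<^sup>2 > 0" using assms by simp
  with 2 show "spectral_gap n l \<noteq> 0" by auto
qed

lemma sum_inverse_squares_le: "(\<Sum>k=1..K. 1 / (real k)\<^sup>2) \<le> 2"
proof -
  have "(\<Sum>k=1..K. 1 / (real k)\<^sup>2) \<le> 2 - (if K = 0 then 0 else 1 / real K)"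
  proof (induction K)
    case (Suc K)
    show ?case
    proof (cases "K = 0")
      case False
      then have "1 / (1 + real K)\<^sup>2 \<le> 1 / (real K * (1 + real K))"
        unfolding power2_eq_square by (intro divide_left_mono mult_right_mono) auto
      also have "\<dots> = 1 / real K - 1 / (1 + real K)"
        using False by (simp add: field_simps)
      finally have "1 / (1 + real K)\<^sup>2 \<le> 1 / real K - 1 / (1 + real K)" .
      then show ?thesis using Suc False by (simp add: add.commute)
    qed simp
  qed simp
  also have "\<dots> \<le> 2" by simp
  finally show ?thesis .
qed

lemma inverse_gap_sum: "(\<Sum>l<L. inverse_gap n l) \<le> 4"
proof -
  have b: "inverse_gap n l \<le> 1 / (real l - real n)\<^sup>2" for l
    using spectral_gap_lower[of l n] by (auto simp: inverse_gap_def intro!: divide_left_mono mult_pos_pos)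
  have 1: "(\<Sum>l\<in>{..<L} \<inter> {..<n}. inverse_gap n l) \<le> 2"
  proof -
    have "(\<Sum>l\<in>{..<L} \<inter> {..<n}. inverse_gap n l) \<le> (\<Sum>l\<in>{..<n}. 1 / (real l - real n)\<^sup>2)"
      by (intro order.trans[OF sum_mono[OF b] sum_mono2]) auto
    also have "\<dots> = (\<Sum>k=1..n. 1 / (real k)\<^sup>2)"
      by (rule sum.reindex_bij_witness[of _ "\<lambda>k. n - k" "\<lambda>l. n - l"])
         (auto simp: of_nat_diff power2_commute)
    finally show ?thesis using sum_inverse_squares_le[of n] by linarith
  qed
  have 2: "(\<Sum>l\<in>{..<L} - {..<n}. inverse_gap n l) \<le> 2"
  proof -
    have "(\<Sum>l\<in>{..<L} - {..<n}. inverse_gap n l) \<le> (\<Sum>l\<in>{n..<n + L}. inverse_gap n l)"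
      by (intro sum_mono2) (auto simp: inverse_gap_def)
    also have "\<dots> = (\<Sum>l\<in>{n<..<n + L}. inverse_gap n l)"
      by (rule sum.mono_neutral_right) (auto simp: inverse_gap_def)
    also have "\<dots> \<le> (\<Sum>l\<in>{n<..<n + L}. 1 / (real l - real n)\<^sup>2)"
      by (rule sum_mono[OF b])
    also have "\<dots> = (\<Sum>k=1..L-1. 1 / (real k)\<^sup>2)"
      by (rule sum.reindex_bij_witness[of _ "\<lambda>k. n + k" "\<lambda>l. l - n"])
         (auto simp: of_nat_diff power2_commute)
    finally show ?thesis using sum_inverse_squares_le[of "L-1"] by linarith
  qed
  show ?thesis using 1 2 by (subst sum.Int_Diff[of _ _ "{..<n}"]) auto
qed

lemma inverse_gap_nonneg: "0 \<le> inverse_gap n l" by (simp add: inverse_gap_def)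

lemma inverse_gap_le_1: "inverse_gap n l \<le> 1"
proof (cases "l = n")
  case False
  then have "1 \<le> \<bar>spectral_gap n l\<bar>" using spectral_gap_lower(1)[of l n] by linarith
  then show ?thesis using False by (auto simp: inverse_gap_def divide_simps)
qed (simp add: inverse_gap_def)

lemma inverse_gap_suminf: "summable (inverse_gap n)" "suminf (inverse_gap n) \<le> 4"
  using summableI_nonneg_bounded[of "inverse_gap n", OF inverse_gap_nonneg inverse_gap_sum]
    suminf_le_const inverse_gap_sum by auto

lemma correction_le:
  assumes "\<forall>l. \<bar>v l\<bar> \<le> V" shows "\<bar>correction n v l\<bar> \<le> V * inverse_gap n l"
  using assms by (auto simp: correction_def inverse_gap_def abs_divide intro!: divide_right_mono)

lemma correction_le_sup:
  assumes "\<forall>l. \<bar>v l\<bar> \<le> V" shows "\<bar>correction n v l\<bar> \<le> V"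
proof -
  have "0 \<le> V" using assms[THEN spec, of l] by linarith
  then have "V * inverse_gap n l \<le> V * 1" by (intro mult_left_mono inverse_gap_le_1)
  then show ?thesis using correction_le[OF assms, of n l] by linarith
qed

lemma correction_diff: "correction n v l - correction n v' l = correction n (\<lambda>l. v l - v' l) l"
  by (simp add: correction_def diff_divide_distrib)

lemma row_sum_bound:
  assumes w: "small_coeffs \<delta> w" and v: "\<forall>l. \<bar>v l\<bar> \<le> V"
  shows "summable (\<lambda>j. \<bar>mult_matrix w l j * correction n v j\<bar>)"
    and "\<bar>\<Sum>j. mult_matrix w l j * correction n v j\<bar> \<le> 4 * \<delta> * V"
proof -
  have V: "0 \<le> V" using v[THEN spec, of 0] by linarith
  have \<delta>: "0 \<le> \<delta>" using w by (rule small_coeffs_nonneg)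
  have b: "\<bar>mult_matrix w l j * correction n v j\<bar> \<le> \<delta> * V * inverse_gap n j" for j
    unfolding abs_mult mult.assoc using V \<delta>
    by (intro mult_mono mult_matrix_le[OF w] correction_le[OF v]) (auto simp: inverse_gap_nonneg)
  show s: "summable (\<lambda>j. \<bar>mult_matrix w l j * correction n v j\<bar>)"
    by (rule summable_comparison_test'[OF summable_mult[OF inverse_gap_suminf(1), of "\<delta> * V"], of 0])
       (use b in simp)
  have "\<bar>\<Sum>j. mult_matrix w l j * correction n v j\<bar> \<le> (\<Sum>j. \<bar>mult_matrix w l j * correction n v j\<bar>)"
    by (rule summable_rabs[OF s])
  also have "\<dots> \<le> (\<Sum>j. \<delta> * V * inverse_gap n j)"
    by (intro suminf_le b s summable_mult inverse_gap_suminf)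
  also have "\<dots> = \<delta> * V * suminf (inverse_gap n)" by (intro suminf_mult inverse_gap_suminf)
  also have "\<dots> \<le> \<delta> * V * 4" using V \<delta> by (intro mult_left_mono inverse_gap_suminf) auto
  finally show "\<bar>\<Sum>j. mult_matrix w l j * correction n v j\<bar> \<le> 4 * \<delta> * V" by (simp add: mult_ac)
qed

lemma action_bound:
  assumes w: "small_coeffs \<delta> w" and v: "\<forall>l. \<bar>v l\<bar> \<le> 1"
  shows "\<bar>action w n v l\<bar> \<le> 5 * \<delta>"
  using row_sum_bound(2)[OF w v, of l n] mult_matrix_le[OF w, of l n]
  unfolding action_def by linarith

lemma action_diff:
  assumes w: "small_coeffs \<delta> w" and v: "\<forall>l. \<bar>v l\<bar> \<le> 1" and v': "\<forall>l. \<bar>v' l\<bar> \<le> 1"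
    and D: "\<forall>l. \<bar>v l - v' l\<bar> \<le> D"
  shows "\<bar>action w n v l - action w n v' l\<bar> \<le> 4 * \<delta> * D"
proof -
  have "action w n v l - action w n v' l = (\<Sum>j. mult_matrix w l j * correction n (\<lambda>l. v l - v' l) j)"
    unfolding action_def correction_diff[symmetric] right_diff_distrib
    using suminf_diff[OF summable_rabs_cancel[OF row_sum_bound(1)[OF w v]]
        summable_rabs_cancel[OF row_sum_bound(1)[OF w v']], of l n l n] by simp
  then show ?thesis using row_sum_bound(2)[OF w D, of l n] by simp
qed

lemma picard_step_bound:
  assumes w: "small_coeffs \<delta> w" and v: "\<forall>l. \<bar>v l\<bar> \<le> 1"
  shows "\<bar>picard_step w n v l\<bar> \<le> 10 * \<delta>"
proof -
  have "\<bar>action w n v n * correction n v l\<bar> \<le> 5 * \<delta> * 1"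
    unfolding abs_mult using small_coeffs_nonneg[OF w]
    by (intro mult_mono action_bound[OF w v] correction_le_sup[OF v]) auto
  then show ?thesis using action_bound[OF w v, where n = n and l = l] unfolding picard_step_def by linarith
qed

text \<open>The map is quadratic in \<open>v\<close> and every term carries a factor \<open>\<delta>\<close>: a contraction for the supremum norm, with a
rate that does not depend on \<open>n\<close>.\<close>

lemma picard_step_diff:
  assumes w: "small_coeffs \<delta> w" and v: "\<forall>l. \<bar>v l\<bar> \<le> 1" and v': "\<forall>l. \<bar>v' l\<bar> \<le> 1"
    and D: "\<forall>l. \<bar>v l - v' l\<bar> \<le> D"
  shows "\<bar>picard_step w n v l - picard_step w n v' l\<bar> \<le> 13 * \<delta> * D"
proof -
  have \<delta>: "0 \<le> \<delta>" using w by (rule small_coeffs_nonneg)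
  have D0: "0 \<le> D" using D[THEN spec, of 0] by linarith
  have e: "picard_step w n v l - picard_step w n v' l =
      action w n v n * (correction n v l - correction n v' l) + (action w n v n - action w n v' n) * correction n v' l
      - (action w n v l - action w n v' l)"
    unfolding picard_step_def by (simp add: algebra_simps)
  have 1: "\<bar>action w n v n * (correction n v l - correction n v' l)\<bar> \<le> 5 * \<delta> * D"
    unfolding abs_mult correction_diff[of n v l v'] using \<delta>
    by (intro mult_mono action_bound[OF w v] correction_le_sup[OF D]) auto
  have 2: "\<bar>(action w n v n - action w n v' n) * correction n v' l\<bar> \<le> 4 * \<delta> * D * 1"
    unfolding abs_mult using \<delta> D0
    by (intro mult_mono action_diff[OF w v v' D] correction_le_sup[OF v']) auto
  show ?thesis using 1 2 action_diff[OF w v v' D, where n = n and l = l] unfolding e by linarith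
qed

context
  fixes \<delta> :: real and w :: "nat \<Rightarrow> real"
  assumes w: "small_coeffs \<delta> w" and \<delta>: "\<delta> \<le> 1 / 26"
begin

lemma picard_le_1: "\<forall>l. \<bar>picard w n p l\<bar> \<le> 1"
proof (induction p)
  case (Suc p)
  show ?case
  proof
    fix l show "\<bar>picard w n (Suc p) l\<bar> \<le> 1"
      using picard_step_bound[OF w Suc, of n l] \<delta> by simp
  qed
qed simp

lemma picard_diff: "\<forall>l. \<bar>picard w n (Suc p) l - picard w n p l\<bar> \<le> (1 / 2) ^ p"
proof (induction p)
  case 0
  show ?case using picard_le_1[of n "Suc 0"] by (simp del: picard.simps(2))
next
  case (Suc p)
  show ?case
  proof
    fix l
    have "\<bar>picard w n (Suc (Suc p)) l - picard w n (Suc p) l\<bar> \<le> 13 * \<delta> * (1 / 2) ^ p"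
      using picard_step_diff[OF w picard_le_1 picard_le_1 Suc] unfolding picard.simps(2) .
    also have "\<dots> \<le> (1 / 2) * (1 / 2) ^ p" using \<delta> by (intro mult_right_mono) auto
    finally show "\<bar>picard w n (Suc (Suc p)) l - picard w n (Suc p) l\<bar> \<le> (1 / 2) ^ Suc p" by simp
  qed
qed

lemma picard_tendsto: "(\<lambda>p. picard w n p l) \<longlonglongrightarrow> residual w n l"
proof -
  have "summable (\<lambda>p. picard w n (Suc p) l - picard w n p l)"
    by (rule summable_comparison_test'[of "\<lambda>p. (1/2)^p" 0])
       (use picard_diff in \<open>auto intro: summable_geometric simp del: picard.simps\<close>)
  then have "(\<lambda>N. \<Sum>p<N. picard w n (Suc p) l - picard w n p l) \<longlonglongrightarrow> suminf (\<lambda>p. picard w n (Suc p) l - picard w n p l)"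
    by (rule summable_LIMSEQ)
  moreover have "(\<Sum>p<N. picard w n (Suc p) l - picard w n p l) = picard w n N l" for N
    by (subst sum_lessThan_telescope) simp
  ultimately have "convergent (\<lambda>N. picard w n N l)" by (auto simp: convergent_def)
  then show ?thesis unfolding residual_def using convergent_LIMSEQ_iff by blast
qed

lemma residual_le_1: "\<forall>l. \<bar>residual w n l\<bar> \<le> 1"
proof
  fix l
  show "\<bar>residual w n l\<bar> \<le> 1"
    by (rule LIMSEQ_le_const2[OF tendsto_rabs[OF picard_tendsto]]) (use picard_le_1 in auto)
qed

lemma picard_residual: "\<forall>l. \<bar>picard w n p l - residual w n l\<bar> \<le> 2 * (1 / 2) ^ p"
proof
  fix l
  have "\<bar>picard w n p l - picard w n (p + k) l\<bar> \<le> 2 * (1 / 2) ^ p - 2 * (1 / 2) ^ (p + k)" for k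
  proof (induction k)
    case (Suc k)
    have "(1/2::real) ^ (p + Suc k) = (1/2) ^ (p + k) / 2" by simp
    moreover have "\<bar>picard w n (p + Suc k) l - picard w n (p + k) l\<bar> \<le> (1 / 2) ^ (p + k)"
      using picard_diff[of n "p + k"] unfolding add_Suc_right by blast
    ultimately show ?case using Suc by linarith
  qed simp
  then have "\<bar>picard w n p l - picard w n (p + k) l\<bar> \<le> 2 * (1 / 2) ^ p" for k
    by (rule order.trans) simp
  moreover have "(\<lambda>k. \<bar>picard w n p l - picard w n (p + k) l\<bar>) \<longlonglongrightarrow> \<bar>picard w n p l - residual w n l\<bar>"
    using LIMSEQ_ignore_initial_segment[OF picard_tendsto, of n p l]
    by (intro tendsto_intros) (simp add: add.commute)
  ultimately show "\<bar>picard w n p l - residual w n l\<bar> \<le> 2 * (1 / 2) ^ p" by (intro LIMSEQ_le_const2) auto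
qed

lemma residual_fixed: "picard_step w n (residual w n) l = residual w n l"
proof -
  have b: "\<bar>picard_step w n (picard w n p) l - picard_step w n (residual w n) l\<bar> \<le> 13 * \<delta> * (2 * (1 / 2) ^ p)" for p
    by (rule picard_step_diff[OF w picard_le_1 residual_le_1 picard_residual])
  have "(\<lambda>p. (1 / 2 :: real) ^ p) \<longlonglongrightarrow> 0" by (rule LIMSEQ_power_zero) simp
  then have "(\<lambda>p. 13 * \<delta> * (2 * (1 / 2) ^ p)) \<longlonglongrightarrow> 0"
    by (intro tendsto_mult_right_zero)
  then have "(\<lambda>p. picard_step w n (picard w n p) l - picard_step w n (residual w n) l) \<longlonglongrightarrow> 0"
    by (rule Lim_null_comparison[rotated]) (use b in \<open>intro always_eventually, simp\<close>)
  then have "(\<lambda>p. picard w n (Suc p) l) \<longlonglongrightarrow> picard_step w n (residual w n) l"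
    by (simp add: LIM_zero_iff)
  from this LIMSEQ_Suc[OF picard_tendsto] show ?thesis by (rule LIMSEQ_unique)
qed

lemma residual_le: "\<forall>l. \<bar>residual w n l\<bar> \<le> 10 * \<delta>"
  using picard_step_bound[OF w residual_le_1, of n n] by (simp add: residual_fixed)

lemma residual_eq_action: "residual w n n = - action w n (residual w n) n"
  using residual_fixed[of n n] by (simp add: picard_step_def correction_def)

lemma correction_summable: "summable (\<lambda>l. \<bar>correction n (residual w n) l\<bar>)"
  "(\<Sum>l. \<bar>correction n (residual w n) l\<bar>) \<le> 40 * \<delta>"
proof -
  have b: "\<bar>correction n (residual w n) l\<bar> \<le> 10 * \<delta> * inverse_gap n l" for l
    by (rule correction_le[OF residual_le])
  show s: "summable (\<lambda>l. \<bar>correction n (residual w n) l\<bar>)"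
    by (rule summable_comparison_test'[OF summable_mult[OF inverse_gap_suminf(1), of "10 * \<delta>"], of 0])
       (use b in simp)
  have "(\<Sum>l. \<bar>correction n (residual w n) l\<bar>) \<le> (\<Sum>l. 10 * \<delta> * inverse_gap n l)"
    by (intro suminf_le b s summable_mult inverse_gap_suminf)
  also have "\<dots> = 10 * \<delta> * suminf (inverse_gap n)" by (intro suminf_mult inverse_gap_suminf)
  also have "\<dots> \<le> 10 * \<delta> * 4" using small_coeffs_nonneg[OF w]
    by (intro mult_left_mono inverse_gap_suminf) auto
  finally show "(\<Sum>l. \<bar>correction n (residual w n) l\<bar>) \<le> 40 * \<delta>" by simp
qed

lemma mult_matrix_l1:
  assumes c: "summable (\<lambda>l. \<bar>c l\<bar>)"
  shows "(\<Sum>l<L. \<bar>\<Sum>j. mult_matrix w l j * c j\<bar>) \<le> 2 * \<delta> * (\<Sum>l. \<bar>c l\<bar>)"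
    and "summable (\<lambda>j. \<bar>mult_matrix w l j * c j\<bar>)"
proof -
  have s: "summable (\<lambda>j. \<bar>mult_matrix w l j * c j\<bar>)" for l
  proof (rule summable_comparison_test'[OF summable_mult[OF c, of \<delta>], of 0])
    show "norm \<bar>mult_matrix w l j * c j\<bar> \<le> \<delta> * \<bar>c j\<bar>" for j
      unfolding real_norm_def abs_abs abs_mult by (intro mult_right_mono mult_matrix_le[OF w]) simp
  qed
  then show "summable (\<lambda>j. \<bar>mult_matrix w l j * c j\<bar>)" .
  have "(\<Sum>l<L. \<bar>\<Sum>j. mult_matrix w l j * c j\<bar>) \<le> (\<Sum>l<L. \<Sum>j. \<bar>mult_matrix w l j * c j\<bar>)"
    by (intro sum_mono summable_rabs s)
  also have "\<dots> = (\<Sum>j. \<Sum>l<L. \<bar>mult_matrix w l j * c j\<bar>)"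
    by (subst suminf_sum) (auto intro: s)
  also have "\<dots> \<le> (\<Sum>j. 2 * \<delta> * \<bar>c j\<bar>)"
  proof (intro suminf_le summable_sum s summable_mult c)
    show "(\<Sum>l<L. \<bar>mult_matrix w l j * c j\<bar>) \<le> 2 * \<delta> * \<bar>c j\<bar>" for j
      unfolding abs_mult sum_distrib_right[symmetric]
      by (intro mult_right_mono mult_matrix_column w) auto
  qed
  also have "\<dots> = 2 * \<delta> * (\<Sum>l. \<bar>c l\<bar>)" by (intro suminf_mult c)
  finally show "(\<Sum>l<L. \<bar>\<Sum>j. mult_matrix w l j * c j\<bar>) \<le> 2 * \<delta> * (\<Sum>l. \<bar>c l\<bar>)" .
qed

text \<open>The fixed point was found among bounded sequences. As \<open>u\<close> is summable and the matrix is bounded on summable sequences,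
the fixed-point equation shows that \<open>v\<close> is summable too.\<close>

lemma residual_l1: "(\<Sum>l<L. \<bar>residual w n l\<bar>) \<le> 13 * \<delta>"
proof -
  let ?u = "correction n (residual w n)"
  have \<delta>0: "0 \<le> \<delta>" using w by (rule small_coeffs_nonneg)
  have "(\<Sum>l<L. \<bar>residual w n l\<bar>) \<le>
     (\<Sum>l<L. 5 * \<delta> * \<bar>?u l\<bar> + (\<bar>mult_matrix w l n\<bar> + \<bar>\<Sum>j. mult_matrix w l j * ?u j\<bar>))"
  proof (intro sum_mono)
    fix l
    have "\<bar>residual w n l\<bar> \<le> \<bar>action w n (residual w n) n * ?u l\<bar> + \<bar>action w n (residual w n) l\<bar>"
      using residual_fixed[of n l] unfolding picard_step_def by linarith
    moreover have "\<bar>action w n (residual w n) n * ?u l\<bar> \<le> 5 * \<delta> * \<bar>?u l\<bar>"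
      unfolding abs_mult by (intro mult_right_mono action_bound[OF w residual_le_1]) auto
    moreover have "\<bar>action w n (residual w n) l\<bar> \<le> \<bar>mult_matrix w l n\<bar> + \<bar>\<Sum>j. mult_matrix w l j * ?u j\<bar>"
      unfolding action_def by linarith
    ultimately show "\<bar>residual w n l\<bar> \<le> 5 * \<delta> * \<bar>?u l\<bar> + (\<bar>mult_matrix w l n\<bar> + \<bar>\<Sum>j. mult_matrix w l j * ?u j\<bar>)"
      by linarith
  qed
  also have "\<dots> = 5 * \<delta> * (\<Sum>l<L. \<bar>?u l\<bar>) + ((\<Sum>l<L. \<bar>mult_matrix w l n\<bar>) + (\<Sum>l<L. \<bar>\<Sum>j. mult_matrix w l j * ?u j\<bar>))"
    by (simp add: sum.distrib sum_distrib_left)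
  also have "\<dots> \<le> 5 * \<delta> * (40 * \<delta>) + (2 * \<delta> + 2 * \<delta> * (40 * \<delta>))"
  proof (intro add_mono mult_left_mono mult_matrix_column w)
    show "(\<Sum>l<L. \<bar>?u l\<bar>) \<le> 40 * \<delta>"
      using sum_le_suminf[OF correction_summable(1), of "{..<L}" n] correction_summable(2)[of n] by auto
    show "(\<Sum>l<L. \<bar>\<Sum>j. mult_matrix w l j * ?u j\<bar>) \<le> 2 * \<delta> * (40 * \<delta>)"
      using mult_matrix_l1(1)[OF correction_summable(1), of n L] \<delta>0
        mult_left_mono[OF correction_summable(2), of "2 * \<delta>" n] by linarith
  qed (use \<delta>0 in auto)
  also have "\<dots> = \<delta> * (2 + 280 * \<delta>)" by (simp add: algebra_simps)
  also have "\<dots> \<le> \<delta> * 13" using \<delta> \<delta>0 by (intro mult_left_mono) auto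
  finally show ?thesis by (simp add: mult.commute)
qed

text \<open>The gap \<open>\<bar>l\<^sup>2 - n\<^sup>2\<bar>\<close> is at least \<open>l + n\<close>. This bound gives at once the size \<open>1 / n\<close> of the correction and one derivative on it;
all later estimates rest on it.\<close>

lemma weighted_correction_bound: "(\<Sum>l<L. (real l + real n) * \<bar>correction n (residual w n) l\<bar>) \<le> 13 * \<delta>"
proof -
  have "(real l + real n) * \<bar>correction n (residual w n) l\<bar> \<le> \<bar>residual w n l\<bar>" for l
  proof (cases "l = n")
    case False
    have "(real l + real n) * \<bar>correction n (residual w n) l\<bar> \<le> \<bar>spectral_gap n l\<bar> * \<bar>correction n (residual w n) l\<bar>"
      by (intro mult_right_mono spectral_gap_lower False) auto
    also have "\<dots> = \<bar>residual w n l\<bar>"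
      using spectral_gap_lower(3)[OF False] False by (simp add: correction_def abs_divide)
    finally show ?thesis .
  qed (simp add: correction_def)
  then have "(\<Sum>l<L. (real l + real n) * \<bar>correction n (residual w n) l\<bar>) \<le> (\<Sum>l<L. \<bar>residual w n l\<bar>)"
    by (intro sum_mono)
  then show ?thesis using residual_l1[of n L] by linarith
qed

lemma weighted_correction_summable:
  "summable (\<lambda>l. (real l + real n) * \<bar>correction n (residual w n) l\<bar>)"
  "(\<Sum>l. (real l + real n) * \<bar>correction n (residual w n) l\<bar>) \<le> 13 * \<delta>"
proof -
  show s: "summable (\<lambda>l. (real l + real n) * \<bar>correction n (residual w n) l\<bar>)"
    by (rule summableI_nonneg_bounded[OF _ weighted_correction_bound]) simp
  show "(\<Sum>l. (real l + real n) * \<bar>correction n (residual w n) l\<bar>) \<le> 13 * \<delta>"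
    by (rule suminf_le_const[OF s weighted_correction_bound])
qed

lemma correction_sum_le:
  assumes "n \<ge> 1"
  shows "(\<Sum>l. \<bar>correction n (residual w n) l\<bar>) \<le> 13 * \<delta> / real n"
proof -
  have "real n * (\<Sum>l. \<bar>correction n (residual w n) l\<bar>) = (\<Sum>l. real n * \<bar>correction n (residual w n) l\<bar>)"
    by (rule suminf_mult[symmetric, OF correction_summable(1)])
  also have "\<dots> \<le> (\<Sum>l. (real l + real n) * \<bar>correction n (residual w n) l\<bar>)"
    by (intro suminf_le weighted_correction_summable summable_mult correction_summable mult_right_mono) auto
  also have "\<dots> \<le> 13 * \<delta>" by (rule weighted_correction_summable)
  finally show ?thesis using assms by (simp add: field_simps)
qed

lemma eigencoeff_summable: "summable (\<lambda>l. \<bar>eigencoeff w n l\<bar>)"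
proof -
  have "summable (\<lambda>l. (if l = n then 1 else 0) + \<bar>correction n (residual w n) l\<bar>)"
    by (intro summable_add correction_summable summable_single)
  then show ?thesis
    by (rule summable_comparison_test'[of _ 0]) (auto simp: eigencoeff_def)
qed

lemma mult_matrix_eigencoeff: "(\<Sum>j. mult_matrix w l j * eigencoeff w n j) = action w n (residual w n) l"
proof -
  have "(\<lambda>j. if j = n then mult_matrix w l j else 0) sums mult_matrix w l n"
    using sums_If_finite[of "\<lambda>j. j = n" "mult_matrix w l"] by simp
  moreover have "(\<lambda>j. mult_matrix w l j * correction n (residual w n) j) sums
      (\<Sum>j. mult_matrix w l j * correction n (residual w n) j)"
    by (rule summable_sums[OF summable_rabs_cancel[OF row_sum_bound(1)[OF w residual_le_1]]])
  ultimately have "(\<lambda>j. (if j = n then mult_matrix w l j else 0) + mult_matrix w l j * correction n (residual w n) j)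
      sums action w n (residual w n) l" unfolding action_def by (rule sums_add)
  moreover have "(\<lambda>j. (if j = n then mult_matrix w l j else 0) + mult_matrix w l j * correction n (residual w n) j)
      = (\<lambda>j. mult_matrix w l j * eigencoeff w n j)"
    by (auto simp: eigencoeff_def algebra_simps)
  ultimately show ?thesis by (simp add: sums_iff)
qed

lemma eigencoeff_equation:
  "(real l)\<^sup>2 * eigencoeff w n l + (\<Sum>j. mult_matrix w l j * eigencoeff w n j) =
    eigenvalue w n * eigencoeff w n l"
proof (cases "l = n")
  case True
  then show ?thesis unfolding mult_matrix_eigencoeff
    using residual_eq_action[of n] by (simp add: eigencoeff_def correction_def eigenvalue_def)
next
  case False
  let ?u = "correction n (residual w n) l"
  have "residual w n l = - residual w n n * ?u - action w n (residual w n) l"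
    using residual_fixed[of n l] residual_eq_action[of n] by (simp add: picard_step_def)
  moreover have "residual w n l = ((real l)\<^sup>2 - (real n)\<^sup>2) * ?u"
    using False spectral_gap_lower(3)[OF False] by (simp add: correction_def spectral_gap_def)
  ultimately have "((real l)\<^sup>2 - (real n)\<^sup>2) * ?u = - residual w n n * ?u - action w n (residual w n) l"
    by simp
  then show ?thesis unfolding mult_matrix_eigencoeff using False
    by (simp add: eigencoeff_def eigenvalue_def algebra_simps)
qed

text \<open>The first-order term is \<open>- w (2 * n) / 2\<close>, of size \<open>1 / n\<close> by the decay of the coefficients, and the rest is quadratic in the
potential with a factor \<open>1 / n\<close> from the size of the correction.\<close>

lemma eigenvalue_asymptotics:
  assumes "n \<ge> 1"
  shows "\<bar>eigenvalue w n - (real n)\<^sup>2\<bar> \<le> \<delta> / real n"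
proof -
  let ?u = "correction n (residual w n)"
  have \<delta>0: "0 \<le> \<delta>" using w by (rule small_coeffs_nonneg)
  have "\<bar>\<Sum>j. mult_matrix w n j * ?u j\<bar> \<le> (\<Sum>j. \<bar>mult_matrix w n j * ?u j\<bar>)"
    by (rule summable_rabs[OF row_sum_bound(1)[OF w residual_le_1]])
  also have "\<dots> \<le> (\<Sum>j. \<delta> * \<bar>?u j\<bar>)"
    unfolding abs_mult
    by (intro suminf_le mult_right_mono mult_matrix_le[OF w] summable_mult correction_summable
        row_sum_bound(1)[OF w residual_le_1, unfolded abs_mult]) auto
  also have "\<dots> = \<delta> * (\<Sum>j. \<bar>?u j\<bar>)" by (intro suminf_mult correction_summable)
  also have "\<dots> \<le> \<delta> * (13 * \<delta> / real n)" by (intro mult_left_mono correction_sum_le assms \<delta>0)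
  also have "\<dots> \<le> (1 / 2) * (\<delta> / real n)"
    using mult_right_mono[of "13 * \<delta>" "1 / 2" "\<delta> / real n"] \<delta> \<delta>0 by (simp add: mult_ac)
  finally have 1: "\<bar>\<Sum>j. mult_matrix w n j * ?u j\<bar> \<le> (1 / 2) * (\<delta> / real n)" .
  have "real (2 * n) * \<bar>w (2 * n)\<bar> \<le> \<delta>" "w 0 = 0" using w unfolding small_coeffs_def by blast+
  moreover have "real n * \<bar>w (2 * n)\<bar> \<le> real (2 * n) * \<bar>w (2 * n)\<bar>" by (intro mult_right_mono) auto
  ultimately have "real n * \<bar>w (2 * n)\<bar> \<le> \<delta>" "w 0 = 0" by linarith+
  then have 2: "\<bar>mult_matrix w n n\<bar> \<le> (1 / 2) * (\<delta> / real n)"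
    using assms by (simp add: mult_matrix_def field_simps flip: mult_2)
  show ?thesis using 1 2 residual_eq_action[of n] unfolding eigenvalue_def action_def by simp
qed

end

lemma measurable_picard:
  assumes "\<And>k. (\<lambda>x. w x k) \<in> borel_measurable M"
  shows "(\<lambda>x. picard (w x) n p l) \<in> borel_measurable M"
proof (induction p arbitrary: l)
  case (Suc p)
  have m: "(\<lambda>x. mult_matrix (w x) i j) \<in> borel_measurable M" for i j
    unfolding mult_matrix_def using assms by measurable
  have c: "(\<lambda>x. correction n (picard (w x) n p) j) \<in> borel_measurable M" for j
    unfolding correction_def using Suc by measurable
  have a: "(\<lambda>x. action (w x) n (picard (w x) n p) j) \<in> borel_measurable M" for j
    unfolding action_def by (intro borel_measurable_add borel_measurable_suminf borel_measurable_times m c)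
  show ?case unfolding picard.simps picard_step_def
    by (intro borel_measurable_diff borel_measurable_times a c)
qed simp

text \<open>The eigenvalue is a limit of Picard iterates, each of which is built from the coefficients by sums and products.\<close>

lemma measurable_eigenvalue:
  assumes "\<And>k. (\<lambda>x. w x k) \<in> borel_measurable M"
  shows "(\<lambda>x. eigenvalue (w x) n) \<in> borel_measurable M"
  unfolding eigenvalue_def residual_def
  by (intro borel_measurable_diff borel_measurable_const borel_measurable_lim_metric measurable_picard assms)

section \<open>Variation of one Fourier coefficient of the potential\<close>

lemma abs_summable_on_imp_summable:
  fixes f :: "nat \<Rightarrow> real"
  assumes "(\<lambda>n. norm (f n)) summable_on UNIV"
  shows "summable (\<lambda>n. \<bar>f n\<bar>)"
proof -
  obtain S where S: "((\<lambda>n. norm (f n)) has_sum S) UNIV"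
    using assms summable_on_def by blast
  have "(\<Sum>n<N. norm (f n)) \<le> S" for N
    by (rule has_sum_mono_neutral[OF has_sum_finite S]) auto
  then show ?thesis by (intro summableI_nonneg_bounded[of _ S]) auto
qed

lemma infsum_eq_suminf_real:
  fixes f :: "nat \<Rightarrow> real"
  assumes "summable (\<lambda>n. \<bar>f n\<bar>)"
  shows "f summable_on UNIV" "infsum f UNIV = suminf f"
proof -
  have "summable (\<lambda>n. norm (f n))" using assms by simp
  then have "(f has_sum suminf f) UNIV"
    using norm_summable_imp_has_sum[of f "suminf f"] summable_rabs_cancel[OF assms] summable_sums by blast
  then show "f summable_on UNIV" "infsum f UNIV = suminf f"
    by (auto simp: summable_on_def infsumI)
qed

text \<open>Fubini's theorem for double series indexed by natural numbers.\<close>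

lemma suminf_swap_abs:
  fixes B :: "nat \<Rightarrow> nat \<Rightarrow> real"
  assumes s: "\<And>j. summable (\<lambda>l. \<bar>B l j\<bar>)" and t: "summable (\<lambda>j. \<Sum>l. \<bar>B l j\<bar>)"
  shows "summable (\<lambda>l. \<bar>\<Sum>j. B l j\<bar>)" "(\<Sum>l. \<Sum>j. B l j) = (\<Sum>j. \<Sum>l. B l j)"
    and "summable (\<lambda>j. \<bar>B l j\<bar>)"
proof -
  have i: "infsum (\<lambda>l. \<bar>B l j\<bar>) UNIV = (\<Sum>l. \<bar>B l j\<bar>)" for j
    using infsum_eq_suminf_real(2)[of "\<lambda>l. \<bar>B l j\<bar>"] s by simp
  have n: "0 \<le> (\<Sum>l. \<bar>B l j\<bar>)" for j by (intro suminf_nonneg s) simp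
  have "(\<lambda>x. norm (case x of (j, l) \<Rightarrow> B l j)) summable_on Sigma UNIV (\<lambda>_. UNIV)"
    unfolding Infinite_Sum.abs_summable_on_Sigma_iff
    using infsum_eq_suminf_real(1)[of "\<lambda>l. \<bar>B l j\<bar>" for j] infsum_eq_suminf_real(1)[of "\<lambda>j. \<Sum>l. \<bar>B l j\<bar>"] s t n
    by (simp add: i)
  then have "(\<lambda>x. norm (case x of (l, j) \<Rightarrow> B l j)) summable_on (prod.swap ` (UNIV \<times> UNIV))"
    by (subst summable_on_reindex) (auto simp: o_def case_prod_unfold)
  then have a: "(\<lambda>x. norm (case x of (l, j) \<Rightarrow> B l j)) summable_on Sigma UNIV (\<lambda>_. UNIV)"
    by (simp add: product_swap)
  then have a1: "\<forall>l. (\<lambda>j. norm (B l j)) summable_on UNIV"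
    and a2: "(\<lambda>l. norm (infsum (\<lambda>j. \<bar>B l j\<bar>) UNIV)) summable_on UNIV"
    unfolding Infinite_Sum.abs_summable_on_Sigma_iff by simp_all
  have s': "summable (\<lambda>j. \<bar>B l j\<bar>)" for l
    using a1 abs_summable_on_imp_summable by blast
  then show "summable (\<lambda>j. \<bar>B l j\<bar>)" .
  have i': "infsum (\<lambda>j. \<bar>B l j\<bar>) UNIV = (\<Sum>j. \<bar>B l j\<bar>)" for l
    using infsum_eq_suminf_real(2)[of "\<lambda>j. \<bar>B l j\<bar>"] s' by simp
  have t': "summable (\<lambda>l. \<bar>\<Sum>j. \<bar>B l j\<bar>\<bar>)"
    using abs_summable_on_imp_summable[OF a2] by (simp add: i')
  show u: "summable (\<lambda>l. \<bar>\<Sum>j. B l j\<bar>)"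
  proof (rule summable_comparison_test'[OF t', of 0])
    show "norm \<bar>\<Sum>j. B l j\<bar> \<le> \<bar>\<Sum>j. \<bar>B l j\<bar>\<bar>" for l
      using summable_rabs[OF s', of l] by simp
  qed
  have t2: "summable (\<lambda>j. \<bar>\<Sum>l. B l j\<bar>)"
  proof (rule summable_comparison_test'[OF t, of 0])
    show "norm \<bar>\<Sum>l. B l j\<bar> \<le> (\<Sum>l. \<bar>B l j\<bar>)" for j
      using summable_rabs[OF s, of j] by simp
  qed
  have "infsum (\<lambda>l. infsum (\<lambda>j. B l j) UNIV) UNIV = infsum (\<lambda>j. infsum (\<lambda>l. B l j) UNIV) UNIV"
    by (rule infsum_swap_banach) (use Infinite_Sum.abs_summable_summable[OF a] in simp)
  then show "(\<Sum>l. \<Sum>j. B l j) = (\<Sum>j. \<Sum>l. B l j)"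
    using infsum_eq_suminf_real(2)[OF s] infsum_eq_suminf_real(2)[OF s']
      infsum_eq_suminf_real(2)[OF u] infsum_eq_suminf_real(2)[OF t2] by simp
qed

lemma abs_suminf_le:
  fixes f :: "nat \<Rightarrow> real"
  assumes "\<And>l. \<bar>f l\<bar> \<le> g l" "summable g"
  shows "summable (\<lambda>l. \<bar>f l\<bar>)" "\<bar>suminf f\<bar> \<le> suminf g"
proof -
  show s: "summable (\<lambda>l. \<bar>f l\<bar>)"
    by (rule summable_comparison_test'[OF assms(2), of 0]) (use assms(1) in simp)
  have "\<bar>suminf f\<bar> \<le> (\<Sum>l. \<bar>f l\<bar>)" by (rule summable_rabs[OF s])
  also have "\<dots> \<le> suminf g" by (rule suminf_le[OF assms(1) s assms(2)])
  finally show "\<bar>suminf f\<bar> \<le> suminf g" .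
qed

lemma mult_matrix_column_suminf:
  assumes "small_coeffs \<delta> w"
  shows "summable (\<lambda>l. \<bar>mult_matrix w l j\<bar>)" "(\<Sum>l. \<bar>mult_matrix w l j\<bar>) \<le> 2 * \<delta>"
proof -
  show s: "summable (\<lambda>l. \<bar>mult_matrix w l j\<bar>)"
    by (rule summableI_nonneg_bounded[OF _ mult_matrix_column[OF assms]]) simp
  show "(\<Sum>l. \<bar>mult_matrix w l j\<bar>) \<le> 2 * \<delta>"
    by (rule suminf_le_const[OF s mult_matrix_column[OF assms]])
qed

text \<open>Absolute convergence of \<open>\<Sum>l j. a l * A l j * b j\<close> for bounded \<open>a\<close> and summable \<open>b\<close>, from the bound on the columns.\<close>

lemma mult_matrix_double_series:
  assumes w: "small_coeffs \<delta> w" and a: "\<forall>l. \<bar>a l\<bar> \<le> C" and b: "summable (\<lambda>j. \<bar>b j\<bar>)"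
  shows "summable (\<lambda>l. \<bar>\<Sum>j. a l * (mult_matrix w l j * b j)\<bar>)"
    and "(\<Sum>l. \<Sum>j. a l * (mult_matrix w l j * b j)) = (\<Sum>j. \<Sum>l. a l * (mult_matrix w l j * b j))"
proof -
  have C: "0 \<le> C" using a[THEN spec, of 0] by linarith
  have le: "\<bar>a l * (mult_matrix w l j * b j)\<bar> \<le> C * \<bar>b j\<bar> * \<bar>mult_matrix w l j\<bar>" for l j
    using mult_right_mono[OF a[THEN spec, of l], of "\<bar>b j\<bar> * \<bar>mult_matrix w l j\<bar>"] by (simp add: abs_mult mult_ac)
  have sm: "summable (\<lambda>l. C * \<bar>b j\<bar> * \<bar>mult_matrix w l j\<bar>)" for j
    by (intro summable_mult mult_matrix_column_suminf[OF w])
  have s: "summable (\<lambda>l. \<bar>a l * (mult_matrix w l j * b j)\<bar>)" for j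
    by (rule abs_suminf_le(1)[OF le sm])
  have "(\<Sum>l. \<bar>a l * (mult_matrix w l j * b j)\<bar>) \<le> C * (2 * \<delta>) * \<bar>b j\<bar>" for j
  proof -
    have "(\<Sum>l. \<bar>a l * (mult_matrix w l j * b j)\<bar>) \<le> (\<Sum>l. C * \<bar>b j\<bar> * \<bar>mult_matrix w l j\<bar>)"
      by (rule suminf_le[OF le s sm])
    also have "\<dots> = C * \<bar>b j\<bar> * (\<Sum>l. \<bar>mult_matrix w l j\<bar>)"
      by (intro suminf_mult mult_matrix_column_suminf[OF w])
    also have "\<dots> \<le> C * \<bar>b j\<bar> * (2 * \<delta>)"
      using C by (intro mult_left_mono mult_matrix_column_suminf[OF w]) auto
    finally show ?thesis by (simp add: mult_ac)
  qed
  then have "\<bar>\<Sum>l. \<bar>a l * (mult_matrix w l j * b j)\<bar>\<bar> \<le> C * (2 * \<delta>) * \<bar>b j\<bar>" for j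
    using suminf_nonneg[OF s, of j] by simp
  from abs_suminf_le(1)[OF this summable_mult[OF b]]
  have t: "summable (\<lambda>j. \<Sum>l. \<bar>a l * (mult_matrix w l j * b j)\<bar>)"
    by (rule summable_rabs_cancel)
  show "summable (\<lambda>l. \<bar>\<Sum>j. a l * (mult_matrix w l j * b j)\<bar>)"
    and "(\<Sum>l. \<Sum>j. a l * (mult_matrix w l j * b j)) = (\<Sum>j. \<Sum>l. a l * (mult_matrix w l j * b j))"
    by (rule suminf_swap_abs[OF s t])+
qed

lemma abs_le_suminf_abs:
  fixes c :: "nat \<Rightarrow> real"
  assumes "summable (\<lambda>l. \<bar>c l\<bar>)"
  shows "\<bar>c l\<bar> \<le> (\<Sum>l. \<bar>c l\<bar>)"
  using sum_le_suminf[OF assms, of "{l}"] by simp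

lemma mult_matrix_symmetric_form:
  assumes w: "small_coeffs \<delta> w" and a: "summable (\<lambda>l. \<bar>a l\<bar>)" and b: "summable (\<lambda>l. \<bar>b l\<bar>)"
  shows "(\<Sum>l. a l * (\<Sum>j. mult_matrix w l j * b j)) = (\<Sum>j. b j * (\<Sum>l. mult_matrix w j l * a l))"
    and "summable (\<lambda>l. a l * (\<Sum>j. mult_matrix w l j * b j))"
proof -
  have al: "\<forall>l. \<bar>a l\<bar> \<le> (\<Sum>l. \<bar>a l\<bar>)" by (intro allI abs_le_suminf_abs[OF a])
  have sr: "summable (\<lambda>j. mult_matrix w l j * c j)" if c: "summable (\<lambda>j. \<bar>c j\<bar>)" for c l
  proof (rule summable_rabs_cancel[OF abs_suminf_le(1)[OF _ summable_mult[OF c, of \<delta>]]])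
    show "\<bar>mult_matrix w l j * c j\<bar> \<le> \<delta> * \<bar>c j\<bar>" for j
      unfolding abs_mult by (intro mult_right_mono mult_matrix_le[OF w]) simp
  qed
  have 1: "(\<Sum>j. a l * (mult_matrix w l j * b j)) = a l * (\<Sum>j. mult_matrix w l j * b j)" for l
    by (rule suminf_mult[OF sr[OF b]])
  have 2: "(\<Sum>l. a l * (mult_matrix w l j * b j)) = b j * (\<Sum>l. mult_matrix w j l * a l)" for j
  proof -
    have "(\<Sum>l. a l * (mult_matrix w l j * b j)) = (\<Sum>l. b j * (mult_matrix w j l * a l))"
      by (simp add: mult_ac mult_matrix_sym[of w j])
    also have "\<dots> = b j * (\<Sum>l. mult_matrix w j l * a l)" by (rule suminf_mult[OF sr[OF a]])
    finally show ?thesis .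
  qed
  show "summable (\<lambda>l. a l * (\<Sum>j. mult_matrix w l j * b j))"
    using mult_matrix_double_series(1)[OF w al b] unfolding 1 by (rule summable_rabs_cancel)
  show "(\<Sum>l. a l * (\<Sum>j. mult_matrix w l j * b j)) = (\<Sum>j. b j * (\<Sum>l. mult_matrix w j l * a l))"
    using mult_matrix_double_series(2)[OF w al b] unfolding 1 2 .
qed

context
  fixes \<delta> \<tau> :: real and w w' :: "nat \<Rightarrow> real" and i n :: nat
  assumes w: "small_coeffs \<delta> w" and w': "small_coeffs \<delta> w'"
    and shift: "w' = (\<lambda>k. w k + (if k = 2 * i then \<tau> else 0))"
    and i: "i \<ge> 1" and n: "n \<ge> 1" and \<delta>: "\<delta> \<le> 1 / 1000"
begin

private abbreviation "c \<equiv> eigencoeff w n"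
private abbreviation "c' \<equiv> eigencoeff w' n"
private abbreviation "u \<equiv> correction n (residual w n)"
private abbreviation "u' \<equiv> correction n (residual w' n)"
private abbreviation "D \<equiv> mult_matrix (\<lambda>k. if k = 2 * i then 1 else 0)"
private abbreviation "m \<equiv> max (real n) (2 * real i)"

lemma small_delta: "\<delta> \<le> 1 / 26" and delta_nonneg: "0 \<le> \<delta>" and weight_ge_1: "m \<ge> 1"
  using \<delta> small_coeffs_nonneg[OF w] i n by auto

lemma shift_matrix_small: "small_coeffs (2 * real i) (\<lambda>k. if k = 2 * i then 1 else 0)"
  unfolding small_coeffs_def using i by auto

lemma mult_matrix_shift: "mult_matrix w' l j = mult_matrix w l j + \<tau> * D l j"
  unfolding shift mult_matrix_def by (simp add: field_simps)

lemma shift_matrix_mult_le: "\<bar>D l j * x\<bar> \<le> \<bar>x\<bar>" and shift_matrix_zero: "real l + real j < 2 * real i \<Longrightarrow> D l j = 0"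
proof -
  have "\<bar>D l j\<bar> \<le> 1" by (simp add: mult_matrix_def)
  then show "\<bar>D l j * x\<bar> \<le> \<bar>x\<bar>" unfolding abs_mult using mult_right_mono[of "\<bar>D l j\<bar>" 1 "\<bar>x\<bar>"] by simp
  show "real l + real j < 2 * real i \<Longrightarrow> D l j = 0" by (auto simp: mult_matrix_def)
qed

text \<open>The matrix of \<open>cos (2 * i * x)\<close> couples \<open>l\<close> and \<open>j\<close> only when \<open>2 * i \<le> l + j\<close>. The weight that the corrections can afford,
\<open>(l + n) * (j + n)\<close>, therefore dominates both \<open>n\<close> and \<open>2 * i\<close>.\<close>

lemma shift_matrix_weighted: "\<bar>D l j * x\<bar> \<le> (real l + real n) * (real j + real n) * \<bar>x\<bar> / m"
proof (cases "D l j = 0")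
  case True
  then show ?thesis using weight_ge_1 by simp
next
  case False
  then have "2 * real i \<le> real l + real j" using shift_matrix_zero[of l j] by linarith
  moreover have "real l + real j \<le> (real l + real n) * (real j + real n)"
  proof -
    have "(real l + real j) * 1 \<le> (real l + real j) * real n" using n by (intro mult_left_mono) auto
    also have "\<dots> \<le> (real l + real j) * real n + (real l * real j + real n * real n)" by simp
    also have "\<dots> = (real l + real n) * (real j + real n)" by (simp add: algebra_simps)
    finally show ?thesis by simp
  qed
  moreover have "real n \<le> (real l + real n) * (real j + real n)"
    using mult_mono[of "real n" "real l + real n" 1 "real j + real n"] n by simp
  ultimately have "m \<le> (real l + real n) * (real j + real n)" by simp
  then have "m * \<bar>x\<bar> \<le> (real l + real n) * (real j + real n) * \<bar>x\<bar>" by (intro mult_right_mono) auto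
  then have "\<bar>x\<bar> \<le> (real l + real n) * (real j + real n) * \<bar>x\<bar> / m" using weight_ge_1 by (simp add: field_simps)
  then show ?thesis using shift_matrix_mult_le[of l j x] by linarith
qed

lemma shift_matrix_weighted_row: "\<bar>D n j * x\<bar> \<le> (real j + real n) * \<bar>x\<bar> / m"
proof (cases "D n j = 0")
  case True
  then show ?thesis using weight_ge_1 by simp
next
  case False
  then have "m \<le> real j + real n" using shift_matrix_zero[of n j] by force
  then have "m * \<bar>x\<bar> \<le> (real j + real n) * \<bar>x\<bar>" by (intro mult_right_mono) auto
  then have "\<bar>x\<bar> \<le> (real j + real n) * \<bar>x\<bar> / m" using weight_ge_1 by (simp add: field_simps)
  then show ?thesis using shift_matrix_mult_le[of n j x] by linarith
qed

text \<open>Expanding both eigenvectors as \<open>e\<^sub>n + u\<close> leaves the diagonal entry and three terms in which at least one correction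
occurs. The coupling condition on the shift matrix converts the weights of the corrections into the factor \<open>1 / max n (2 * i)\<close>.\<close>

lemma shift_form_near_diagonal:
  "\<bar>(\<Sum>l. c l * (\<Sum>j. D l j * c' j)) - D n n\<bar> \<le> 27 * \<delta> / m"
proof -
  let ?U = "\<lambda>l. (real l + real n) * \<bar>u l\<bar>" and ?U' = "\<lambda>l. (real l + real n) * \<bar>u' l\<bar>"
  note U = weighted_correction_summable[OF w small_delta, of n] and U' = weighted_correction_summable[OF w' small_delta, of n]
  have split: "(\<lambda>l. (if l = n then f n else 0) + u l * f l) = (\<lambda>l. c l * f l)"
    "(\<lambda>l. (if l = n then f n else 0) + u' l * f l) = (\<lambda>l. c' l * f l)" for f
    by (auto simp: eigencoeff_def algebra_simps)
  have spike: "(\<lambda>l. if l = n then f n else 0) sums f n" for f :: "nat \<Rightarrow> real"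
    using sums_If_finite[of "\<lambda>l. l = n" "\<lambda>_. f n"] by simp
  have row: "(\<Sum>j. D l j * c' j) = D l n + (\<Sum>j. D l j * u' j)" for l
  proof -
    have "summable (\<lambda>j. \<bar>D l j * u' j\<bar>)"
      by (rule abs_suminf_le(1)[OF shift_matrix_mult_le correction_summable(1)[OF w' small_delta]])
    from sums_add[OF spike[of "D l"] summable_sums[OF summable_rabs_cancel[OF this]]]
    have "(\<lambda>j. c' j * D l j) sums (D l n + (\<Sum>j. D l j * u' j))"
      using split(2)[of "D l"] by (simp add: mult.commute)
    then show ?thesis by (simp add: sums_iff mult.commute)
  qed
  have inner: "\<bar>u l * (\<Sum>j. D l j * u' j)\<bar> \<le> (13 * \<delta> / m) * ?U l" for l
  proof -
    have su: "summable (\<lambda>j. D l j * u' j)"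
      by (rule summable_rabs_cancel[OF abs_suminf_le(1)[OF shift_matrix_mult_le correction_summable(1)[OF w' small_delta]]])
    have e: "u l * (\<Sum>j. D l j * u' j) = (\<Sum>j. D l j * (u l * u' j))"
      using suminf_mult[OF su, of "u l"] by (simp add: mult_ac)
    have "\<bar>\<Sum>j. D l j * (u l * u' j)\<bar> \<le> (\<Sum>j. (?U l / m) * ?U' j)"
    proof (rule abs_suminf_le(2)[OF _ summable_mult[OF U'(1)]])
      show "\<bar>D l j * (u l * u' j)\<bar> \<le> (?U l / m) * ?U' j" for j
        using shift_matrix_weighted[of l j "u l * u' j"] by (simp add: abs_mult mult_ac)
    qed
    also have "\<dots> = (?U l / m) * suminf ?U'" by (rule suminf_mult[OF U'(1)])
    also have "\<dots> \<le> (?U l / m) * (13 * \<delta>)" using weight_ge_1 by (intro mult_left_mono U'(2)) auto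
    finally show ?thesis unfolding e by (simp add: mult_ac)
  qed
  have T1: "\<bar>\<Sum>j. D n j * u' j\<bar> \<le> 13 * \<delta> / m"
  proof -
    have "\<bar>\<Sum>j. D n j * u' j\<bar> \<le> (\<Sum>j. (1 / m) * ?U' j)"
      by (rule abs_suminf_le(2)[OF _ summable_mult[OF U'(1)]]) (use shift_matrix_weighted_row in simp)
    also have "\<dots> = (1 / m) * suminf ?U'" by (rule suminf_mult[OF U'(1)])
    also have "\<dots> \<le> (1 / m) * (13 * \<delta>)" using weight_ge_1 by (intro mult_left_mono U'(2)) auto
    finally show ?thesis by simp
  qed
  have T2b: "\<bar>u l * D l n\<bar> \<le> (1 / m) * ?U l" for l
    using shift_matrix_weighted_row[of l "u l"] unfolding mult_matrix_sym[of _ n l] by (simp add: mult.commute)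
  have T2s: "summable (\<lambda>l. u l * D l n)"
    by (rule summable_rabs_cancel[OF abs_suminf_le(1)[OF T2b summable_mult[OF U(1)]]])
  have T2: "\<bar>\<Sum>l. u l * D l n\<bar> \<le> 13 * \<delta> / m"
  proof -
    have "\<bar>\<Sum>l. u l * D l n\<bar> \<le> (\<Sum>l. (1 / m) * ?U l)"
      by (rule abs_suminf_le(2)[OF T2b summable_mult[OF U(1)]])
    also have "\<dots> = (1 / m) * suminf ?U" by (rule suminf_mult[OF U(1)])
    also have "\<dots> \<le> (1 / m) * (13 * \<delta>)" using weight_ge_1 by (intro mult_left_mono U(2)) auto
    finally show ?thesis by simp
  qed
  have T3s: "summable (\<lambda>l. u l * (\<Sum>j. D l j * u' j))"
    by (rule summable_rabs_cancel[OF abs_suminf_le(1)[OF inner summable_mult[OF U(1)]]])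
  have T3: "\<bar>\<Sum>l. u l * (\<Sum>j. D l j * u' j)\<bar> \<le> \<delta> / m"
  proof -
    have "\<bar>\<Sum>l. u l * (\<Sum>j. D l j * u' j)\<bar> \<le> (\<Sum>l. (13 * \<delta> / m) * ?U l)"
      by (rule abs_suminf_le(2)[OF inner summable_mult[OF U(1)]])
    also have "\<dots> = (13 * \<delta> / m) * suminf ?U" by (rule suminf_mult[OF U(1)])
    also have "\<dots> \<le> (13 * \<delta> / m) * (13 * \<delta>)" using weight_ge_1 delta_nonneg by (intro mult_left_mono U(2)) auto
    also have "\<dots> \<le> \<delta> / m * 1"
      using mult_left_mono[of "169 * \<delta>" 1 "\<delta> / m"] \<delta> delta_nonneg weight_ge_1 by (simp add: field_simps)
    finally show ?thesis by simp
  qed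
  have "(\<lambda>l. (if l = n then \<Sum>j. D n j * c' j else 0) + (u l * D l n + u l * (\<Sum>j. D l j * u' j)))
      sums ((\<Sum>j. D n j * c' j) + ((\<Sum>l. u l * D l n) + (\<Sum>l. u l * (\<Sum>j. D l j * u' j))))"
    by (intro sums_add spike[of "\<lambda>l. \<Sum>j. D l j * c' j"] summable_sums T2s T3s)
  moreover have "(\<lambda>l. (if l = n then \<Sum>j. D n j * c' j else 0) + (u l * D l n + u l * (\<Sum>j. D l j * u' j)))
      = (\<lambda>l. c l * (\<Sum>j. D l j * c' j))"
    unfolding split(1)[symmetric, of "\<lambda>l. \<Sum>j. D l j * c' j"] by (simp add: row distrib_left)
  ultimately have "(\<Sum>l. c l * (\<Sum>j. D l j * c' j)) =
      D n n + (\<Sum>j. D n j * u' j) + ((\<Sum>l. u l * D l n) + (\<Sum>l. u l * (\<Sum>j. D l j * u' j)))"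
    by (simp add: sums_iff row)
  then have "\<bar>(\<Sum>l. c l * (\<Sum>j. D l j * c' j)) - D n n\<bar> \<le> 13 * \<delta> / m + 13 * \<delta> / m + \<delta> / m"
    using T1 T2 T3 by linarith
  then show ?thesis by (simp add: add_divide_distrib[symmetric])
qed

lemma coeff_inner:
  "summable (\<lambda>l. c l * c' l)" "\<bar>(\<Sum>l. c l * c' l) - 1\<bar> \<le> 1 / 1000"
proof -
  have b: "\<bar>u l * u' l\<bar> \<le> 13 * \<delta> * \<bar>u l\<bar>" for l
  proof -
    have "\<bar>u' l\<bar> \<le> (\<Sum>l. \<bar>u' l\<bar>)" by (rule abs_le_suminf_abs[OF correction_summable(1)[OF w' small_delta]])
    also have "\<dots> \<le> 13 * \<delta> / real n" by (rule correction_sum_le[OF w' small_delta n])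
    also have "\<dots> \<le> 13 * \<delta> / 1" using n delta_nonneg by (intro divide_left_mono) auto
    also have "\<dots> = 13 * \<delta>" by simp
    finally show ?thesis unfolding abs_mult by (subst mult.commute) (intro mult_right_mono, auto)
  qed
  note su = correction_summable(1)[OF w small_delta, of n]
  have s: "summable (\<lambda>l. u l * u' l)"
    by (rule summable_rabs_cancel[OF abs_suminf_le(1)[OF b summable_mult[OF su]]])
  have spike: "(\<lambda>l. if l = n then 1 else 0) sums (1::real)"
    using sums_If_finite[of "\<lambda>l. l = n" "\<lambda>_. 1 :: real"] by simp
  have "(\<lambda>l. (if l = n then 1 else 0) + u l * u' l) sums (1 + (\<Sum>l. u l * u' l))"
    by (intro sums_add spike summable_sums s)
  moreover have "(\<lambda>l. (if l = n then 1 else 0) + u l * u' l) = (\<lambda>l. c l * c' l)"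
    by (auto simp: eigencoeff_def correction_def)
  ultimately have e: "(\<lambda>l. c l * c' l) sums (1 + (\<Sum>l. u l * u' l))" by simp
  then show "summable (\<lambda>l. c l * c' l)" by (simp add: sums_iff)
  have "\<bar>\<Sum>l. u l * u' l\<bar> \<le> (\<Sum>l. 13 * \<delta> * \<bar>u l\<bar>)"
    by (rule abs_suminf_le(2)[OF b summable_mult[OF su]])
  also have "\<dots> = 13 * \<delta> * (\<Sum>l. \<bar>u l\<bar>)" by (rule suminf_mult[OF su])
  also have "\<dots> \<le> 13 * \<delta> * (40 * \<delta>)"
    using delta_nonneg by (intro mult_left_mono correction_summable(2)[OF w small_delta]) auto
  also have "\<dots> \<le> 1 / 1000" using mult_mono[OF \<delta> \<delta>] delta_nonneg by simp
  finally show "\<bar>(\<Sum>l. c l * c' l) - 1\<bar> \<le> 1 / 1000" using e by (simp add: sums_iff)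
qed

text \<open>The Hellmann--Feynman formula for a finite change of the potential. Pairing the eigenvector of each potential with the equation of the
other makes it exact.\<close>

lemma eigenvalue_shift_identity:
  "(eigenvalue w' n - eigenvalue w n) * (\<Sum>l. c l * c' l) = \<tau> * (\<Sum>l. c l * (\<Sum>j. D l j * c' j))"
proof -
  note sc = eigencoeff_summable[OF w small_delta, of n] and sc' = eigencoeff_summable[OF w' small_delta, of n]
  have row: "(\<Sum>j. mult_matrix w' l j * c' j) = (\<Sum>j. mult_matrix w l j * c' j) + \<tau> * (\<Sum>j. D l j * c' j)" for l
  proof -
    have 1: "summable (\<lambda>j. mult_matrix w l j * c' j)"
      by (rule summable_rabs_cancel[OF mult_matrix_l1(2)[OF w small_delta sc']])
    have 2: "summable (\<lambda>j. D l j * c' j)"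
      by (rule summable_rabs_cancel[OF abs_suminf_le(1)[OF shift_matrix_mult_le sc']])
    show ?thesis unfolding mult_matrix_shift distrib_right mult.assoc
      by (simp add: suminf_add[OF 1 summable_mult[OF 2], symmetric] suminf_mult[OF 2])
  qed
  have pt: "(eigenvalue w' n - eigenvalue w n) * (c l * c' l) =
     c l * (\<Sum>j. mult_matrix w l j * c' j) - c' l * (\<Sum>j. mult_matrix w l j * c j)
     + \<tau> * (c l * (\<Sum>j. D l j * c' j))" for l
  proof -
    have "eigenvalue w' n * c' l = (real l)\<^sup>2 * c' l + ((\<Sum>j. mult_matrix w l j * c' j) + \<tau> * (\<Sum>j. D l j * c' j))"
      using eigencoeff_equation[OF w' small_delta, of l n] row by simp
    moreover have "eigenvalue w n * c l = (real l)\<^sup>2 * c l + (\<Sum>j. mult_matrix w l j * c j)"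
      using eigencoeff_equation[OF w small_delta, of l n] by simp
    moreover have "(eigenvalue w' n - eigenvalue w n) * (c l * c' l) =
        c l * (eigenvalue w' n * c' l) - c' l * (eigenvalue w n * c l)" by (simp add: algebra_simps)
    ultimately show ?thesis by (simp add: algebra_simps)
  qed
  note f1 = mult_matrix_symmetric_form[OF w sc sc'] and f2 = mult_matrix_symmetric_form(2)[OF w sc' sc]
  have f3: "summable (\<lambda>l. c l * (\<Sum>j. D l j * c' j))"
    by (rule mult_matrix_symmetric_form(2)[OF shift_matrix_small sc sc'])
  have "(eigenvalue w' n - eigenvalue w n) * (\<Sum>l. c l * c' l) =
      (\<Sum>l. (eigenvalue w' n - eigenvalue w n) * (c l * c' l))"
    by (rule suminf_mult[OF coeff_inner(1), symmetric])
  also have "\<dots> = (\<Sum>l. c l * (\<Sum>j. mult_matrix w l j * c' j)) - (\<Sum>l. c' l * (\<Sum>j. mult_matrix w l j * c j))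
     + \<tau> * (\<Sum>l. c l * (\<Sum>j. D l j * c' j))"
    unfolding pt suminf_mult[OF f3, symmetric] suminf_diff[OF f1(2) f2]
    by (rule suminf_add[symmetric, OF summable_diff[OF f1(2) f2] summable_mult[OF f3]])
  also have "\<dots> = \<tau> * (\<Sum>l. c l * (\<Sum>j. D l j * c' j))" using f1(1) by simp
  finally show ?thesis .
qed

text \<open>For \<open>n = i\<close> the diagonal entry of the matrix of \<open>cos (2 * i * x)\<close> is \<open>- 1 / 2\<close>.\<close>

lemma eigenvalue_shift_diagonal:
  assumes "n = i" shows "\<bar>eigenvalue w' n - eigenvalue w n\<bar> \<ge> \<bar>\<tau>\<bar> / 4"
proof -
  let ?S = "\<Sum>l. c l * c' l" and ?G = "\<Sum>l. c l * (\<Sum>j. D l j * c' j)"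
  have "D n n = - 1 / 2" using assms i by (simp add: mult_matrix_def)
  moreover have "27 * \<delta> / m \<le> 27 * \<delta> / 1" using weight_ge_1 delta_nonneg by (intro divide_left_mono) auto
  ultimately have "\<bar>?G\<bar> \<ge> 1 / 2 - 27 / 1000" using shift_form_near_diagonal \<delta> by linarith
  then have "\<bar>\<tau>\<bar> * (2 / 5) \<le> \<bar>\<tau>\<bar> * \<bar>?G\<bar>" by (intro mult_left_mono) auto
  also have "\<dots> = \<bar>eigenvalue w' n - eigenvalue w n\<bar> * \<bar>?S\<bar>"
    unfolding abs_mult[symmetric] eigenvalue_shift_identity ..
  also have "\<dots> \<le> \<bar>eigenvalue w' n - eigenvalue w n\<bar> * (1001 / 1000)"
  proof (rule mult_left_mono)
    show "\<bar>?S\<bar> \<le> 1001 / 1000" using coeff_inner(2) by linarith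
  qed simp
  finally have "\<bar>\<tau>\<bar> * (2 / 5) \<le> \<bar>eigenvalue w' n - eigenvalue w n\<bar> * (1001 / 1000)" .
  moreover have "T / 4 \<le> X" if "T * (2 / 5) \<le> X * (1001 / 1000)" "0 \<le> T" for T X :: real
    using that by linarith
  ultimately show ?thesis by simp
qed

lemma eigenvalue_shift_off_diagonal:
  assumes "n \<noteq> i" shows "\<bar>eigenvalue w' n - eigenvalue w n\<bar> \<le> 30 * \<delta> * \<bar>\<tau>\<bar> / max (real n) (real i)"
proof -
  let ?S = "\<Sum>l. c l * c' l" and ?G = "\<Sum>l. c l * (\<Sum>j. D l j * c' j)"
  have "D n n = 0" using assms i by (simp add: mult_matrix_def)
  then have G: "\<bar>?G\<bar> \<le> 27 * \<delta> / m" using shift_form_near_diagonal by simp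
  have "\<bar>eigenvalue w' n - eigenvalue w n\<bar> * (9 / 10) \<le> \<bar>eigenvalue w' n - eigenvalue w n\<bar> * \<bar>?S\<bar>"
  proof (rule mult_left_mono)
    show "9 / 10 \<le> \<bar>?S\<bar>" using coeff_inner(2) by linarith
  qed simp
  also have "\<dots> = \<bar>\<tau>\<bar> * \<bar>?G\<bar>"
    unfolding abs_mult[symmetric] eigenvalue_shift_identity ..
  also have "\<dots> \<le> \<bar>\<tau>\<bar> * (27 * \<delta> / m)" by (intro mult_left_mono G) auto
  also have "\<dots> \<le> \<bar>\<tau>\<bar> * (27 * \<delta> / max (real n) (real i))"
    using delta_nonneg n i by (intro mult_left_mono divide_left_mono mult_pos_pos) auto
  finally have "\<bar>eigenvalue w' n - eigenvalue w n\<bar> * (9 / 10) \<le> \<bar>\<tau>\<bar> * (27 * \<delta> / max (real n) (real i))" .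
  moreover have scale: "X * (9 / 10) \<le> Y \<Longrightarrow> X \<le> (10 / 9) * Y" for X Y :: real by linarith
  ultimately have "\<bar>eigenvalue w' n - eigenvalue w n\<bar> \<le> (10 / 9) * (\<bar>\<tau>\<bar> * (27 * \<delta> / max (real n) (real i)))"
    using scale by blast
  also have "\<dots> = 30 * \<delta> * \<bar>\<tau>\<bar> / max (real n) (real i)" by simp
  finally show ?thesis .
qed

end

lemma sum_inverse_sqrt_le: "(\<Sum>n=1..N. 1 / sqrt (real n)) \<le> 2 * sqrt (real N)"
proof (induction N)
  case (Suc N)
  define a b where "a = sqrt (real N)" and "b = sqrt (real (Suc N))"
  have ab: "0 \<le> a" "a \<le> b" "0 < b" "b * b = a * a + 1" by (auto simp: a_def b_def)
  have "(b - a) * (2 * b) \<ge> (b - a) * (a + b)" using ab by (intro mult_left_mono) auto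
  then have "1 \<le> (2 * b - 2 * a) * b" using ab by (simp add: algebra_simps)
  then have "1 / b \<le> 2 * b - 2 * a" using ab by (simp add: divide_le_eq)
  then show ?case using Suc unfolding a_def b_def by simp
qed simp

text \<open>The sum of \<open>1 / max n i\<close> over \<open>n\<close> diverges logarithmically; the extra factor \<open>1 / sqrt n\<close> makes it converge, and the value
compares with \<open>1 / sqrt i\<close>. The term \<open>- 2 / sqrt N\<close> is what the induction on \<open>N\<close> needs.\<close>

lemma schur_weight_sum:
  assumes "1 \<le> i" "i \<le> N"
  shows "(\<Sum>n=1..N. 1 / (sqrt (real n) * max (real n) (real i))) \<le> 4 / sqrt (real i) - 2 / sqrt (real N)"
  using assms(2)
proof (induction N rule: dec_induct)
  case base
  have "(\<Sum>n=1..i. 1 / (sqrt (real n) * max (real n) (real i))) = (\<Sum>n=1..i. 1 / sqrt (real n)) / real i"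
    unfolding sum_divide_distrib by (intro sum.cong) (auto simp: max_def)
  also have "\<dots> \<le> 2 * sqrt (real i) / real i"
    by (intro divide_right_mono sum_inverse_sqrt_le) auto
  also have "\<dots> = 2 / sqrt (real i)" using assms(1) by (simp add: field_simps flip: power2_eq_square)
  finally show ?case by (simp add: field_simps)
next
  case (step N)
  define a b where "a = sqrt (real N)" and "b = sqrt (real (Suc N))"
  have ab: "0 < a" "a \<le> b" "0 < b" "b * b = a * a + 1" using assms(1) step by (auto simp: a_def b_def)
  have bb: "max (real (Suc N)) (real i) = b * b" using step by (simp add: b_def max_def)
  have "a * (a + b) \<le> b * (2 * b)" using ab by (intro mult_mono) auto
  then have "1 / (b * (b * b)) \<le> 2 / (b * (a * (a + b)))"
  proof -
    assume h: "a * (a + b) \<le> b * (2 * b)"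
    have "2 / (b * (b * (2 * b))) \<le> 2 / (b * (a * (a + b)))"
      using ab h by (intro divide_left_mono mult_left_mono mult_pos_pos) auto
    then show ?thesis by simp
  qed
  also have "2 / (b * (a * (a + b))) = 2 / a - 2 / b"
  proof -
    have "(a + b) * (b - a) = 1" using ab by (simp add: algebra_simps)
    then have "b - a = 1 / (a + b)" using ab by (simp add: field_simps)
    then have "2 * (b - a) / (a * b) = 2 / (b * (a * (a + b)))" by simp
    moreover have "2 * (b - a) / (a * b) = 2 / a - 2 / b" using ab by (simp add: field_simps)
    ultimately show ?thesis by simp
  qed
  finally have f: "1 / (b * (b * b)) \<le> 2 / a - 2 / b" .
  have "(\<Sum>n=1..Suc N. 1 / (sqrt (real n) * max (real n) (real i))) =
      (\<Sum>n=1..N. 1 / (sqrt (real n) * max (real n) (real i))) + 1 / (b * (b * b))"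
    using bb by (simp add: b_def)
  then show ?case using f step.IH unfolding a_def b_def by linarith
qed

text \<open>Schur's test. With \<open>i\<close> chosen to maximise \<open>\<bar>z n\<bar> * sqrt n\<close>, the effect on the other eigenvalues adds up to at most half of the effect on the
\<open>i\<close>-th one, uniformly in the number of frequencies involved; the maximum of \<open>\<bar>z n\<bar>\<close> itself would only
give a bound that deteriorates logarithmically.\<close>

lemma combination_shift:
  fixes z :: "nat \<Rightarrow> int" and \<delta> :: real
  assumes z: "\<exists>n\<in>{1..N}. z n \<noteq> 0" and \<delta>: "\<delta> \<le> 1 / 1000"
  obtains i where "i \<in> {1..N}" "z i \<noteq> 0"
    "\<And>w w' \<tau>. small_coeffs \<delta> w \<Longrightarrow> small_coeffs \<delta> w' \<Longrightarrow>
       w' = (\<lambda>k. w k + (if k = 2 * i then \<tau> else 0)) \<Longrightarrow>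
       \<bar>(\<Sum>n=1..N. z n * eigenvalue w' n) - (\<Sum>n=1..N. z n * eigenvalue w n)\<bar> \<ge> \<bar>\<tau>\<bar> / 8"
proof -
  let ?g = "\<lambda>n. \<bar>real_of_int (z n)\<bar> * sqrt (real n)"
  have ne: "{1..N} \<noteq> {}" using z by auto
  \<comment> \<open>The index \<open>i\<close> maximises \<open>\<bar>z n\<bar> * sqrt n\<close>.\<close>
  define g where "g = Max (?g ` {1..N})"
  have "g \<in> ?g ` {1..N}" unfolding g_def using ne by (intro Max_in) auto
  then obtain i where i: "i \<in> {1..N}" "g = ?g i" by auto
  have max: "?g n \<le> ?g i" if "n \<in> {1..N}" for n
    using that unfolding i(2)[symmetric] g_def by (intro Max_ge) auto
  have zi: "z i \<noteq> 0"
  proof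
    assume "z i = 0"
    obtain n where n: "n \<in> {1..N}" "z n \<noteq> 0" using z by auto
    then have "0 < ?g n" by simp
    with max[OF n(1)] \<open>z i = 0\<close> show False by simp
  qed
  show ?thesis
  proof (rule that[OF i(1) zi])
    fix w w' \<tau> assume w: "small_coeffs \<delta> w" and w': "small_coeffs \<delta> w'"
      and sh: "w' = (\<lambda>k. w k + (if k = 2 * i then \<tau> else 0))"
    have \<delta>0: "0 \<le> \<delta>" using w by (rule small_coeffs_nonneg)
    have i1: "i \<ge> 1" using i(1) by simp
    let ?d = "\<lambda>n. eigenvalue w' n - eigenvalue w n"
    have off: "\<bar>z n * ?d n\<bar> \<le> 30 * \<delta> * \<bar>\<tau>\<bar> * ?g i * (1 / (sqrt (real n) * max (real n) (real i)))"
      if "n \<in> {1..N} - {i}" for n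
    proof -
      have n: "n \<ge> 1" "n \<noteq> i" "n \<in> {1..N}" using that by auto
      have "\<bar>real_of_int (z n)\<bar> \<le> ?g i / sqrt (real n)"
        using max[OF n(3)] n(1) by (simp add: field_simps)
      then have "\<bar>z n\<bar> * \<bar>?d n\<bar> \<le> (?g i / sqrt (real n)) * (30 * \<delta> * \<bar>\<tau>\<bar> / max (real n) (real i))"
        using eigenvalue_shift_off_diagonal[OF w w' sh i1 n(1) \<delta> n(2)]
        by (intro mult_mono) auto
      then show ?thesis by (simp add: abs_mult mult_ac)
    qed
    have "\<bar>\<Sum>n\<in>{1..N} - {i}. z n * ?d n\<bar> \<le> (\<Sum>n\<in>{1..N} - {i}. \<bar>z n * ?d n\<bar>)" by (rule sum_abs)
    also have "\<dots> \<le> (\<Sum>n\<in>{1..N} - {i}. 30 * \<delta> * \<bar>\<tau>\<bar> * ?g i * (1 / (sqrt (real n) * max (real n) (real i))))"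
      by (rule sum_mono[OF off])
    also have "\<dots> \<le> (\<Sum>n=1..N. 30 * \<delta> * \<bar>\<tau>\<bar> * ?g i * (1 / (sqrt (real n) * max (real n) (real i))))"
      using \<delta>0 by (intro sum_mono2) auto
    also have "\<dots> = 30 * \<delta> * \<bar>\<tau>\<bar> * ?g i * (\<Sum>n=1..N. 1 / (sqrt (real n) * max (real n) (real i)))"
      by (simp only: sum_distrib_left)
    also have "\<dots> \<le> 30 * \<delta> * \<bar>\<tau>\<bar> * ?g i * (4 / sqrt (real i))"
    proof (intro mult_left_mono)
      have "0 \<le> 2 / sqrt (real N)" by simp
      then show "(\<Sum>n=1..N. 1 / (sqrt (real n) * max (real n) (real i))) \<le> 4 / sqrt (real i)"
        using schur_weight_sum[OF i1, of N] i(1) by (smt (verit, best) atLeastAtMost_iff)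
    qed (use \<delta>0 in auto)
    also have "\<dots> = 120 * \<delta> * \<bar>\<tau>\<bar> * \<bar>real_of_int (z i)\<bar>" using i1 by simp
    also have "\<dots> \<le> (1 / 8) * (\<bar>\<tau>\<bar> * \<bar>real_of_int (z i)\<bar>)"
      using mult_right_mono[of "120 * \<delta>" "1 / 8" "\<bar>\<tau>\<bar> * \<bar>real_of_int (z i)\<bar>"] \<delta> by (simp add: mult_ac)
    finally have rest: "\<bar>\<Sum>n\<in>{1..N} - {i}. z n * ?d n\<bar> \<le> (1 / 8) * (\<bar>\<tau>\<bar> * \<bar>real_of_int (z i)\<bar>)" .
    have "\<bar>real_of_int (z i)\<bar> * (\<bar>\<tau>\<bar> / 4) \<le> \<bar>z i * ?d i\<bar>"
      unfolding abs_mult using eigenvalue_shift_diagonal[OF w w' sh i1 i1 \<delta> refl] by (intro mult_left_mono) auto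
    moreover have "(\<Sum>n=1..N. z n * eigenvalue w' n) - (\<Sum>n=1..N. z n * eigenvalue w n) = (\<Sum>n=1..N. z n * ?d n)"
      by (simp add: sum_subtractf right_diff_distrib)
    moreover have "(\<Sum>n=1..N. z n * ?d n) = z i * ?d i + (\<Sum>n\<in>{1..N} - {i}. z n * ?d n)"
      using i(1) by (subst sum.remove[of _ i]) auto
    moreover have "\<bar>\<tau>\<bar> * 1 \<le> \<bar>\<tau>\<bar> * \<bar>real_of_int (z i)\<bar>" using zi by (intro mult_left_mono) linarith+
    moreover have est: "T / 8 \<le> \<bar>A + B\<bar>" if "Z * (T / 4) \<le> \<bar>A\<bar>" "\<bar>B\<bar> \<le> (1 / 8) * (T * Z)" "T * 1 \<le> T * Z"
      for A B T Z :: real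
    proof -
      have "Z * (T / 4) = (T * Z) / 4" by simp
      with that show ?thesis by linarith
    qed
    ultimately show "\<bar>(\<Sum>n=1..N. z n * eigenvalue w' n) - (\<Sum>n=1..N. z n * eigenvalue w n)\<bar> \<ge> \<bar>\<tau>\<bar> / 8"
      using rest est[of "\<bar>real_of_int (z i)\<bar>" "\<bar>\<tau>\<bar>"] by (simp only:)
  qed
qed

section \<open>The Dirichlet spectrum of a small potential\<close>

definition sine_series :: "(nat \<Rightarrow> real) \<Rightarrow> real \<Rightarrow> real" where
  "sine_series c x = (\<Sum>l. c l * sin (real l * x))"

definition cosine_series :: "(nat \<Rightarrow> real) \<Rightarrow> real \<Rightarrow> real" where
  "cosine_series c x = (\<Sum>l. c l * cos (real l * x))"

lemma trig_terms_le: "\<bar>c * sin y\<bar> \<le> \<bar>c\<bar>" "\<bar>c * cos y\<bar> \<le> \<bar>c\<bar>" for c y :: real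
  using mult_left_mono[OF abs_sin_le_one, of "\<bar>c\<bar>" y] mult_left_mono[OF abs_cos_le_one, of "\<bar>c\<bar>" y]
  by (simp_all add: abs_mult)

lemma trig_series_summable:
  assumes "summable (\<lambda>l. \<bar>c l\<bar>)"
  shows "summable (\<lambda>l. c l * sin (real l * x))" "summable (\<lambda>l. c l * cos (real l * x))"
  by (rule summable_rabs_cancel[OF abs_suminf_le(1)[OF trig_terms_le(1) assms]],
      rule summable_rabs_cancel[OF abs_suminf_le(1)[OF trig_terms_le(2) assms]])

lemma trig_series_derivative:
  assumes s: "summable (\<lambda>l. \<bar>real l * c l\<bar>)"
  shows "(sine_series c has_real_derivative cosine_series (\<lambda>l. real l * c l) x) (at x)"
    and "(cosine_series c has_real_derivative - sine_series (\<lambda>l. real l * c l) x) (at x)"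
    and "summable (\<lambda>l. \<bar>c l\<bar>)"
proof -
  show sc: "summable (\<lambda>l. \<bar>c l\<bar>)"
  proof (rule summable_comparison_test'[OF s, of 1])
    fix l :: nat assume "1 \<le> l"
    then have "1 * \<bar>c l\<bar> \<le> real l * \<bar>c l\<bar>" by (intro mult_right_mono) auto
    then show "norm \<bar>c l\<bar> \<le> \<bar>real l * c l\<bar>" by (simp add: abs_mult)
  qed
  have u1: "uniformly_convergent_on UNIV (\<lambda>n x. \<Sum>l<n. (real l * c l) * cos (real l * x))"
    by (rule Weierstrass_m_test'[OF _ s]) (simp only: real_norm_def trig_terms_le)
  have u2: "uniformly_convergent_on UNIV (\<lambda>n x. \<Sum>l<n. - (real l * c l) * sin (real l * x))"
    by (rule Weierstrass_m_test'[OF _ s]) (simp only: real_norm_def, rule order.trans[OF trig_terms_le(1)], simp)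
  have d: "((\<lambda>x. c l * sin (real l * x)) has_real_derivative (real l * c l) * cos (real l * x)) (at x)" for l x
    by (auto intro!: derivative_eq_intros)
  have "((\<lambda>x. \<Sum>l. c l * sin (real l * x)) has_real_derivative (\<Sum>l. (real l * c l) * cos (real l * x))) (at x)"
    using has_field_derivative_series'(2)[of UNIV "\<lambda>l x. c l * sin (real l * x)"
        "\<lambda>l x. (real l * c l) * cos (real l * x)" 0 x, OF convex_UNIV d u1 UNIV_I trig_series_summable(1)[OF sc, of 0]]
    by simp
  then show "(sine_series c has_real_derivative cosine_series (\<lambda>l. real l * c l) x) (at x)"
    unfolding sine_series_def[abs_def] cosine_series_def .
  have d2: "((\<lambda>x. c l * cos (real l * x)) has_real_derivative - (real l * c l) * sin (real l * x)) (at x)" for l x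
    by (auto intro!: derivative_eq_intros)
  have "((\<lambda>x. \<Sum>l. c l * cos (real l * x)) has_real_derivative (\<Sum>l. - (real l * c l) * sin (real l * x))) (at x)"
    using has_field_derivative_series'(2)[of UNIV "\<lambda>l x. c l * cos (real l * x)"
        "\<lambda>l x. - (real l * c l) * sin (real l * x)" 0 x, OF convex_UNIV d2 u2 UNIV_I trig_series_summable(2)[OF sc, of 0]]
    by simp
  moreover have "(\<Sum>l. - (real l * c l) * sin (real l * x)) = - sine_series (\<lambda>l. real l * c l) x"
    unfolding sine_series_def using suminf_minus[OF trig_series_summable(1)[OF s, of x]] by simp
  ultimately show "(cosine_series c has_real_derivative - sine_series (\<lambda>l. real l * c l) x) (at x)"
    unfolding cosine_series_def[abs_def] by simp
qed

lemma trig_series_continuous: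
  assumes s: "summable (\<lambda>l. \<bar>c l\<bar>)"
  shows "continuous_on A (sine_series c)" "continuous_on A (cosine_series c)"
proof -
  have "uniform_limit A (\<lambda>n x. \<Sum>l<n. c l * sin (real l * x)) (sine_series c) sequentially"
    unfolding sine_series_def[abs_def]
    by (rule Weierstrass_m_test[OF _ s]) (simp only: real_norm_def trig_terms_le)
  then show "continuous_on A (sine_series c)"
    by (rule uniform_limit_theorem[rotated]) (auto intro!: always_eventually continuous_intros)
  have "uniform_limit A (\<lambda>n x. \<Sum>l<n. c l * cos (real l * x)) (cosine_series c) sequentially"
    unfolding cosine_series_def[abs_def]
    by (rule Weierstrass_m_test[OF _ s]) (simp only: real_norm_def trig_terms_le)
  then show "continuous_on A (cosine_series c)"
    by (rule uniform_limit_theorem[rotated]) (auto intro!: always_eventually continuous_intros)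
qed

lemma sin_linear_bounds:
  assumes "0 \<le> x" "x \<le> pi"
  shows "\<bar>sin (real l * x)\<bar> \<le> real l * x" "\<bar>sin (real l * x)\<bar> \<le> real l * (pi - x)"
proof -
  show "\<bar>sin (real l * x)\<bar> \<le> real l * x" using abs_sin_x_le_abs_x[of "real l * x"] assms by simp
  have "sin (real l * (pi - x)) = - (cos (real l * pi) * sin (real l * x))"
    by (simp add: right_diff_distrib sin_diff mult.commute)
  then have "\<bar>sin (real l * (pi - x))\<bar> = \<bar>sin (real l * x)\<bar>"
    by (simp add: abs_mult mult.commute[of "real l" pi])
  then show "\<bar>sin (real l * x)\<bar> \<le> real l * (pi - x)"
    using abs_sin_x_le_abs_x[of "real l * (pi - x)"] assms by simp
qed

text \<open>The approximating test functions are the partial sums of the series, multiplied by cut-offs that tend to \<open>1\<close>. Partial sums vanish linearly at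
the end points with a slope bounded by \<open>\<Sum>l. \<bar>l * c l\<bar>\<close>, so the derivatives stay bounded and dominated convergence applies.\<close>

lemma sine_series_sobolev_1_0:
  assumes s: "summable (\<lambda>l. \<bar>real l * c l\<bar>)"
    and weak: "has_weak_deriv {0<..<pi} 1 (sine_series c) (cosine_series (\<lambda>l. real l * c l))"
  shows "sine_series c \<in> sobolev_1_0 {0<..<pi}"
proof -
  note sc = trig_series_derivative(3)[OF s]
  let ?f = "sine_series c" and ?g = "cosine_series (\<lambda>l. real l * c l)"
  define P where "P = (\<lambda>j x. \<Sum>l<j. c l * sin (real l * x))"
  define P' where "P' = (\<lambda>j x. \<Sum>l<j. real l * c l * cos (real l * x))"
  define C0 where "C0 = (\<Sum>l. \<bar>c l\<bar>)"
  define C1 where "C1 = (\<Sum>l. \<bar>real l * c l\<bar>)"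
  have C: "0 \<le> C0" "0 \<le> C1" unfolding C0_def C1_def by (intro suminf_nonneg sc s; simp)+
  have dP: "(P j has_real_derivative P' j x) (at x)" for j x
    unfolding P_def P'_def by (auto intro!: derivative_eq_intros DERIV_sum simp: mult_ac)
  have sP: "smooth (P j)" for j
    unfolding P_def by (intro smooth_sum smooth_mult[OF smooth_const smooth_sin])
  have P'b: "\<bar>P' j x\<bar> \<le> C1" for j x
  proof -
    have "\<bar>P' j x\<bar> \<le> (\<Sum>l<j. \<bar>real l * c l\<bar>)"
      unfolding P'_def by (intro order.trans[OF sum_abs] sum_mono trig_terms_le)
    also have "\<dots> \<le> C1" unfolding C1_def by (intro sum_le_suminf s) auto
    finally show ?thesis .
  qed
  have Pb: "\<bar>P j x\<bar> \<le> C0" for j x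
  proof -
    have "\<bar>P j x\<bar> \<le> (\<Sum>l<j. \<bar>c l\<bar>)"
      unfolding P_def by (intro order.trans[OF sum_abs] sum_mono trig_terms_le)
    also have "\<dots> \<le> C0" unfolding C0_def by (intro sum_le_suminf sc) auto
    finally show ?thesis .
  qed
  have Plin: "\<bar>P j x\<bar> \<le> C1 * y" if y: "0 \<le> y" "\<And>l. \<bar>sin (real l * x)\<bar> \<le> real l * y" for j x y
  proof -
    have "\<bar>P j x\<bar> \<le> (\<Sum>l<j. \<bar>real l * c l\<bar> * y)"
      unfolding P_def
    proof (intro order.trans[OF sum_abs] sum_mono)
      fix l
      show "\<bar>c l * sin (real l * x)\<bar> \<le> \<bar>real l * c l\<bar> * y"
        using mult_left_mono[OF y(2)[of l], of "\<bar>c l\<bar>"] by (simp add: abs_mult mult_ac)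
    qed
    also have "\<dots> = (\<Sum>l<j. \<bar>real l * c l\<bar>) * y" by (simp only: sum_distrib_right)
    also have "\<dots> \<le> C1 * y" unfolding C1_def using y by (intro mult_right_mono sum_le_suminf s) auto
    finally show ?thesis .
  qed
  obtain K where K: "K > 0" "\<And>x. \<bar>deriv smooth_step x\<bar> \<le> K" using deriv_smooth_step_bounded by blast
  \<comment> \<open>Both the number of terms and the cut-off scale tend to infinity with \<open>j\<close>.\<close>
  define \<phi> where "\<phi> = (\<lambda>j x. cutoff (real (Suc j)) x * P j x)"
  define \<phi>' where "\<phi>' = (\<lambda>j x. cutoff' (real (Suc j)) x * P j x + P' j x * cutoff (real (Suc j)) x)"
  have d\<phi>: "(\<phi> j has_real_derivative \<phi>' j x) (at x)" for j x
    unfolding \<phi>_def \<phi>'_def by (rule DERIV_mult[OF cutoff_derivative dP])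
  have deriv\<phi>: "deriv (\<phi> j) = \<phi>' j" for j using DERIV_imp_deriv[OF d\<phi>] by blast
  have t\<phi>: "\<phi> j \<in> test_functions {0<..<pi}" for j
    unfolding \<phi>_def by (rule cutoff_times_test_function[OF _ sP]) simp
  have c\<phi>: "continuous_on A (\<phi> j)" "continuous_on A (\<phi>' j)" for j A
    using smooth_continuous_on[OF test_function_smooth[OF t\<phi>]]
      smooth_continuous_on[OF test_function_smooth[OF deriv_test_function[OF t\<phi>]]] by (simp_all add: deriv\<phi>)
  have cf: "continuous_on A ?f" "continuous_on A ?g" for A
    by (rule trig_series_continuous[OF sc] trig_series_continuous[OF s])+
  have \<phi>b: "\<bar>\<phi> j x\<bar> \<le> C0" for j x
    using mult_mono[OF cutoff_bounds(2) Pb] cutoff_bounds[of "real (Suc j)" x] C by (simp add: \<phi>_def abs_mult)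
  have \<phi>'b: "\<bar>\<phi>' j x\<bar> \<le> 4 * K * C1 + C1" if x: "x \<in> {0<..<pi}" for j x
  proof -
    have "\<bar>cutoff' (real (Suc j)) x * P j x\<bar> \<le> 4 * K * C1"
      using x C by (intro cutoff'_times_le K Plin sin_linear_bounds) auto
    moreover have "\<bar>P' j x * cutoff (real (Suc j)) x\<bar> \<le> C1 * 1"
      unfolding abs_mult using cutoff_bounds[of "real (Suc j)" x] C by (intro mult_mono P'b) auto
    ultimately show ?thesis unfolding \<phi>'_def by linarith
  qed
  have fb: "\<bar>?f x\<bar> \<le> C0" "\<bar>?g x\<bar> \<le> C1" for x
    unfolding sine_series_def cosine_series_def C0_def C1_def
    by (rule abs_suminf_le(2)[OF trig_terms_le(1) sc], rule abs_suminf_le(2)[OF trig_terms_le(2) s])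
  have ev: "eventually (\<lambda>j. \<phi> j x = P j x \<and> \<phi>' j x = P' j x) sequentially" if x: "x \<in> {0<..<pi}" for x
  proof -
    have l: "(\<lambda>j. 2 / real (Suc j)) \<longlonglongrightarrow> 0"
      using tendsto_mult_right_zero[OF LIMSEQ_inverse_real_of_nat, of 2] by (simp add: divide_inverse)
    have "eventually (\<lambda>j. 2 / real (Suc j) < x) sequentially" "eventually (\<lambda>j. 2 / real (Suc j) < pi - x) sequentially"
      by (rule order_tendstoD(2)[OF l]; use x in simp)+
    then show ?thesis
    proof eventually_elim
      case (elim j)
      then show ?case using cutoff_one[of "real (Suc j)" x] by (simp add: \<phi>_def \<phi>'_def)
    qed
  qed
  have lim: "(\<lambda>j. \<phi> j x) \<longlonglongrightarrow> ?f x" "(\<lambda>j. \<phi>' j x) \<longlonglongrightarrow> ?g x" if x: "x \<in> {0<..<pi}" for x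
  proof -
    have l: "(\<lambda>j. P j x) \<longlonglongrightarrow> ?f x" "(\<lambda>j. P' j x) \<longlonglongrightarrow> ?g x"
      unfolding P_def P'_def sine_series_def cosine_series_def
      by (rule summable_LIMSEQ[OF trig_series_summable(1)[OF sc]], rule summable_LIMSEQ[OF trig_series_summable(2)[OF s]])
    have e: "eventually (\<lambda>j. P j x = \<phi> j x) sequentially" "eventually (\<lambda>j. P' j x = \<phi>' j x) sequentially"
      by (rule eventually_mono[OF ev[OF x]]; simp)+
    show "(\<lambda>j. \<phi> j x) \<longlonglongrightarrow> ?f x" "(\<lambda>j. \<phi>' j x) \<longlonglongrightarrow> ?g x"
      by (rule Lim_transform_eventually[OF l(1) e(1)], rule Lim_transform_eventually[OF l(2) e(2)])
  qed
  have dom: "(\<lambda>j. LINT x|leb_0_pi. (u x - v j x)\<^sup>2) \<longlonglongrightarrow> 0"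
    if "continuous_on {0<..<pi} u" "\<And>j. continuous_on {0<..<pi} (v j)" "\<And>x. x \<in> {0<..<pi} \<Longrightarrow> \<bar>u x\<bar> \<le> B"
      "\<And>j x. x \<in> {0<..<pi} \<Longrightarrow> \<bar>v j x\<bar> \<le> B" "\<And>x. x \<in> {0<..<pi} \<Longrightarrow> (\<lambda>j. v j x) \<longlonglongrightarrow> u x" for u :: "real \<Rightarrow> real" and v and B :: real
  proof (rule dominated_square_limit[where w = "\<lambda>_. (2 * B)\<^sup>2"])
    show "AE x in leb_0_pi. (u x - v j x)\<^sup>2 \<le> (2 * B)\<^sup>2" for j
    proof (rule AE_I2)
      fix x assume "x \<in> space leb_0_pi"
      then have "\<bar>u x - v j x\<bar> \<le> 2 * B" using that(3)[of x] that(4)[of x j] by auto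
      then have "\<bar>u x - v j x\<bar>\<^sup>2 \<le> (2 * B)\<^sup>2" by (intro power_mono) auto
      then show "(u x - v j x)\<^sup>2 \<le> (2 * B)\<^sup>2" by simp
    qed
    show "AE x in leb_0_pi. (\<lambda>j. v j x) \<longlonglongrightarrow> u x" by (rule AE_I2) (use that(5) in simp)
    show "integrable leb_0_pi (\<lambda>_. (2 * B)\<^sup>2)" by (intro continuous_integrable_0_pi continuous_intros)
  qed (intro continuous_measurable_0_pi that)+
  have l1: "(\<lambda>j. LINT x|leb_0_pi. (?f x - \<phi> j x)\<^sup>2) \<longlonglongrightarrow> 0"
    by (rule dom[where B = C0]) (use cf c\<phi> fb \<phi>b lim in auto)
  have l2: "(\<lambda>j. LINT x|leb_0_pi. (?g x - \<phi>' j x)\<^sup>2) \<longlonglongrightarrow> 0"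
  proof (rule dom[where B = "4 * K * C1 + C1"])
    have "0 \<le> 4 * K * C1" using K C by simp
    then show "\<bar>?g x\<bar> \<le> 4 * K * C1 + C1" for x using fb(2)[of x] by linarith
  qed (use cf c\<phi> \<phi>'b lim in auto)
  have "\<exists>\<psi>\<in>test_functions {0<..<pi}. (LINT x|leb_0_pi. (?f x - \<psi> x)\<^sup>2) + (LINT x|leb_0_pi. (?g x - deriv \<psi> x)\<^sup>2) < \<epsilon>"
    if "\<epsilon> > 0" for \<epsilon>
  proof -
    have "(\<lambda>j. (LINT x|leb_0_pi. (?f x - \<phi> j x)\<^sup>2) + (LINT x|leb_0_pi. (?g x - \<phi>' j x)\<^sup>2)) \<longlonglongrightarrow> 0 + 0"
      by (intro tendsto_add l1 l2)
    then have "eventually (\<lambda>j. (LINT x|leb_0_pi. (?f x - \<phi> j x)\<^sup>2) + (LINT x|leb_0_pi. (?g x - \<phi>' j x)\<^sup>2) < \<epsilon>) sequentially"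
      by (rule order_tendstoD(2)) (use that in simp)
    then obtain j where "(LINT x|leb_0_pi. (?f x - \<phi> j x)\<^sup>2) + (LINT x|leb_0_pi. (?g x - \<phi>' j x)\<^sup>2) < \<epsilon>"
      using eventually_sequentially by auto
    then show ?thesis by (intro bexI[OF _ t\<phi>[of j]]) (simp add: deriv\<phi>)
  qed
  then show ?thesis unfolding sobolev_1_0_def using weak by blast
qed

text \<open>The formula \<open>sin (a + b) + sin (a - b) = 2 * sin a * cos b\<close>, after reindexing. The frequencies \<open>j - k\<close> with \<open>k > j\<close> are
negative; folding them back is the origin of the second term of the matrix.\<close>

lemma mult_matrix_sine_row:
  assumes w: "small_coeffs \<delta> w"
  shows "(\<Sum>l. mult_matrix w l j * sin (real l * x)) = cosine_series w x * sin (real j * x)"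
proof -
  have w0: "w 0 = 0" using w unfolding small_coeffs_def by blast
  note s = small_coeffs_summable(1)[OF w]
  let ?a = "\<lambda>k. w k * sin (real j * x + real k * x)" and ?b = "\<lambda>k. w k * sin (real j * x - real k * x)"
  have sa: "summable ?a" "summable ?b"
    by (rule summable_rabs_cancel[OF abs_suminf_le(1)[OF trig_terms_le(1) s]])+
  have ab: "suminf ?a + suminf ?b = 2 * (cosine_series w x * sin (real j * x))"
  proof -
    have "suminf ?a + suminf ?b = (\<Sum>k. ?a k + ?b k)" by (rule suminf_add[OF sa])
    also have "(\<lambda>k. ?a k + ?b k) = (\<lambda>k. (2 * sin (real j * x)) * (w k * cos (real k * x)))"
      by (auto simp: sin_add sin_diff algebra_simps)
    also have "(\<Sum>k. (2 * sin (real j * x)) * (w k * cos (real k * x))) = (2 * sin (real j * x)) * cosine_series w x"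
      unfolding cosine_series_def by (rule suminf_mult[OF trig_series_summable(2)[OF s]])
    finally show ?thesis by simp
  qed
  let ?p = "\<lambda>l. w ((l - j) + (j - l)) * sin (real l * x)" and ?q = "\<lambda>l. w (l + j) * sin (real l * x)"
  have tp: "?p (k + j) = ?a k" for k by (simp add: algebra_simps)
  have sp: "summable ?p" using summable_iff_shift[of ?p j] sa(1) unfolding tp by blast
  have tq: "?q k = - ?b (k + j)" for k
  proof -
    have "real j * x - real (k + j) * x = - (real k * x)" by (simp add: algebra_simps)
    then show ?thesis by simp
  qed
  have sb': "summable (\<lambda>k. ?b (k + j))" using summable_iff_shift[of ?b j] sa(2) by blast
  have sq: "summable ?q" unfolding tq by (rule summable_minus[OF sb'])
  have "suminf ?p = (\<Sum>k. ?p (k + j)) + (\<Sum>l<j. ?p l)" by (rule suminf_split_initial_segment[OF sp])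
  then have p: "suminf ?p = suminf ?a + (\<Sum>l<j. ?p l)" unfolding tp .
  have "suminf ?b = (\<Sum>k. ?b (k + j)) + (\<Sum>l<j. ?b l)" by (rule suminf_split_initial_segment[OF sa(2)])
  moreover have "suminf ?q = - (\<Sum>k. ?b (k + j))" unfolding tq by (rule suminf_minus[OF sb'])
  ultimately have q: "suminf ?q = (\<Sum>l<j. ?b l) - suminf ?b" by simp
  have e: "(\<Sum>l<j. ?p l) = (\<Sum>l<j. ?b l)"
  proof -
    have "(\<Sum>l<j. ?p l) = (\<Sum>l\<in>{1..<j}. ?p l)" by (rule sum.mono_neutral_right) (auto simp: not_le)
    also have "\<dots> = (\<Sum>k\<in>{1..<j}. ?b k)"
      by (rule sum.reindex_bij_witness[of _ "\<lambda>k. j - k" "\<lambda>k. j - k"])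
         (auto simp: of_nat_diff left_diff_distrib)
    also have "\<dots> = (\<Sum>k<j. ?b k)" by (rule sum.mono_neutral_left) (auto simp: w0 not_le)
    finally show ?thesis .
  qed
  have "(\<Sum>l. mult_matrix w l j * sin (real l * x)) = (\<Sum>l. (1 / 2) * (?p l - ?q l))"
    unfolding mult_matrix_def by (simp add: field_simps)
  also have "\<dots> = (1 / 2) * (suminf ?p - suminf ?q)"
    using suminf_mult[OF summable_diff[OF sp sq], of "1/2"] suminf_diff[OF sp sq] by simp
  also have "\<dots> = cosine_series w x * sin (real j * x)" unfolding p q e using ab by simp
  finally show ?thesis .
qed

abbreviation "eigenfunction w n \<equiv> sine_series (eigencoeff w n)"
abbreviation "eigenfunction'' w n \<equiv> (\<lambda>x. - sine_series (\<lambda>l. real l * (real l * eigencoeff w n l)) x)"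

context
  fixes \<delta> :: real and w :: "nat \<Rightarrow> real"
  assumes w: "small_coeffs \<delta> w" and \<delta>: "\<delta> \<le> 1 / 1000"
begin

lemma small_potential_delta: "\<delta> \<le> 1 / 26" using \<delta> by simp

lemma potential_times_sine_series:
  assumes c: "summable (\<lambda>l. \<bar>c l\<bar>)"
  shows "sine_series (\<lambda>l. \<Sum>j. mult_matrix w l j * c j) x = cosine_series w x * sine_series c x"
proof -
  have b: "\<forall>l. \<bar>sin (real l * x)\<bar> \<le> 1" by simp
  have sr: "summable (\<lambda>j. mult_matrix w l j * c j)" for l
    by (rule summable_rabs_cancel[OF mult_matrix_l1(2)[OF w small_potential_delta c]])
  have "sine_series (\<lambda>l. \<Sum>j. mult_matrix w l j * c j) x = (\<Sum>l. \<Sum>j. sin (real l * x) * (mult_matrix w l j * c j))"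
    unfolding sine_series_def suminf_mult[OF sr] by (simp only: mult.commute)
  also have "\<dots> = (\<Sum>j. \<Sum>l. sin (real l * x) * (mult_matrix w l j * c j))"
    by (rule mult_matrix_double_series(2)[OF w b c])
  also have "\<dots> = (\<Sum>j. cosine_series w x * (c j * sin (real j * x)))"
  proof (rule arg_cong[where f = suminf], rule ext)
    fix j
    have s: "summable (\<lambda>l. mult_matrix w l j * sin (real l * x))"
      by (rule trig_series_summable(1)[OF mult_matrix_column_suminf(1)[OF w]])
    have "(\<Sum>l. sin (real l * x) * (mult_matrix w l j * c j)) = (\<Sum>l. c j * (mult_matrix w l j * sin (real l * x)))"
      by (simp add: mult_ac)
    also have "\<dots> = c j * (\<Sum>l. mult_matrix w l j * sin (real l * x))" by (rule suminf_mult[OF s])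
    also have "\<dots> = cosine_series w x * (c j * sin (real j * x))" unfolding mult_matrix_sine_row[OF w] by simp
    finally show "(\<Sum>l. sin (real l * x) * (mult_matrix w l j * c j)) = cosine_series w x * (c j * sin (real j * x))" .
  qed
  also have "\<dots> = cosine_series w x * sine_series c x"
    unfolding sine_series_def by (rule suminf_mult[OF trig_series_summable(1)[OF c]])
  finally show ?thesis .
qed

text \<open>By the eigenvalue equation, \<open>l\<^sup>2 * c l\<close> is a combination of two summable sequences. Eigenfunctions are thus classical
solutions.\<close>

lemma eigencoeff_summable2: "summable (\<lambda>l. \<bar>real l * (real l * eigencoeff w n l)\<bar>)"
proof -
  note sc = eigencoeff_summable[OF w small_potential_delta, of n]
  have 1: "summable (\<lambda>l. \<bar>\<Sum>j. mult_matrix w l j * eigencoeff w n j\<bar>)"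
    by (rule summableI_nonneg_bounded[OF _ mult_matrix_l1(1)[OF w small_potential_delta sc]]) simp
  have "summable (\<lambda>l. \<bar>eigenvalue w n\<bar> * \<bar>eigencoeff w n l\<bar> + \<bar>\<Sum>j. mult_matrix w l j * eigencoeff w n j\<bar>)"
    by (intro summable_add summable_mult sc 1)
  moreover have "\<bar>real l * (real l * eigencoeff w n l)\<bar> \<le>
      \<bar>eigenvalue w n\<bar> * \<bar>eigencoeff w n l\<bar> + \<bar>\<Sum>j. mult_matrix w l j * eigencoeff w n j\<bar>" for l
  proof -
    have "real l * (real l * eigencoeff w n l) = eigenvalue w n * eigencoeff w n l - (\<Sum>j. mult_matrix w l j * eigencoeff w n j)"
      using eigencoeff_equation[OF w small_potential_delta, of l n] by (simp add: power2_eq_square mult.assoc)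
    then show ?thesis by (simp add: abs_mult[symmetric])
  qed
  ultimately show ?thesis by (intro abs_suminf_le(1))
qed

lemma eigenfunction_continuous: "continuous_on A (eigenfunction w n)"
  by (intro trig_series_continuous eigencoeff_summable[OF w small_potential_delta])

lemma eigenfunction_equation:
  "- eigenfunction'' w n x + cosine_series w x * eigenfunction w n x = eigenvalue w n * eigenfunction w n x"
proof -
  note sc = eigencoeff_summable[OF w small_potential_delta, of n]
  note s2 = eigencoeff_summable2[of n]
  have 1: "summable (\<lambda>l. \<bar>\<Sum>j. mult_matrix w l j * eigencoeff w n j\<bar>)"
    by (rule summableI_nonneg_bounded[OF _ mult_matrix_l1(1)[OF w small_potential_delta sc]]) simp
  have "- eigenfunction'' w n x + cosine_series w x * eigenfunction w n x =
     (\<Sum>l. real l * (real l * eigencoeff w n l) * sin (real l * x)) + (\<Sum>l. (\<Sum>j. mult_matrix w l j * eigencoeff w n j) * sin (real l * x))"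
    unfolding potential_times_sine_series[OF sc, symmetric] by (simp add: sine_series_def)
  also have "\<dots> = (\<Sum>l. real l * (real l * eigencoeff w n l) * sin (real l * x) + (\<Sum>j. mult_matrix w l j * eigencoeff w n j) * sin (real l * x))"
    by (intro suminf_add trig_series_summable s2 1)
  also have "\<dots> = (\<Sum>l. eigenvalue w n * (eigencoeff w n l * sin (real l * x)))"
    using eigencoeff_equation[OF w small_potential_delta, of _ n]
    by (simp add: distrib_right[symmetric] power2_eq_square mult.assoc[symmetric])
  also have "\<dots> = eigenvalue w n * eigenfunction w n x"
    unfolding sine_series_def by (rule suminf_mult[OF trig_series_summable(1)[OF sc]])
  finally show ?thesis .
qed

lemma eigenfunction_near_sine:
  "eigenfunction w n x = sin (real n * x) + (\<Sum>l. correction n (residual w n) l * sin (real l * x))"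
proof -
  have "(\<lambda>l. (if l = n then sin (real n * x) else 0) + correction n (residual w n) l * sin (real l * x)) sums
     (sin (real n * x) + (\<Sum>l. correction n (residual w n) l * sin (real l * x)))"
    using sums_If_finite[of "\<lambda>l. l = n" "\<lambda>_. sin (real n * x)"]
    by (intro sums_add summable_sums trig_series_summable correction_summable[OF w small_potential_delta]) simp
  moreover have "(\<lambda>l. (if l = n then sin (real n * x) else 0) + correction n (residual w n) l * sin (real l * x))
      = (\<lambda>l. eigencoeff w n l * sin (real l * x))"
    by (auto simp: eigencoeff_def algebra_simps)
  ultimately show ?thesis unfolding sine_series_def by (simp add: sums_iff)
qed

lemma correction_sum_le_tenth: "(\<Sum>l. \<bar>correction n (residual w n) l\<bar>) \<le> 1 / 10"
  using correction_summable(2)[OF w small_potential_delta, of n] \<delta> by simp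

end

context
  fixes \<delta> :: real and w :: "nat \<Rightarrow> real"
  assumes w: "small_coeffs \<delta> w" and \<delta>: "\<delta> \<le> 1 / 1000"
begin

text \<open>The factor \<open>k\<close> is there to normalise the eigenfunction in \<open>L\<^sup>2\<close>.\<close>

lemma scaled_eigenfunction_eigenpair:
  "dirichlet_eigenpair (cosine_series w) (eigenvalue w n) (\<lambda>x. k * eigenfunction w n x)"
proof -
  let ?c = "\<lambda>l. k * eigencoeff w n l"
  note s2 = eigencoeff_summable2[OF w \<delta>, of n]
  note s1 = trig_series_derivative(3)[OF s2] note s0 = trig_series_derivative(3)[OF s1]
  have t2: "summable (\<lambda>l. \<bar>real l * (real l * ?c l)\<bar>)"
    using summable_mult[OF s2, of "\<bar>k\<bar>"] by (simp add: abs_mult mult_ac)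
  note t1 = trig_series_derivative(3)[OF t2]
  have e: "sine_series (\<lambda>l. k * a l) x = k * sine_series a x" if "summable (\<lambda>l. \<bar>a l\<bar>)" for a x
    unfolding sine_series_def using suminf_mult[OF trig_series_summable(1)[OF that, of x], of k] by (simp add: mult.assoc)
  have f: "sine_series ?c = (\<lambda>x. k * eigenfunction w n x)" using e[OF s0] by blast
  let ?h = "\<lambda>x. - sine_series (\<lambda>l. real l * (real l * ?c l)) x"
  have h: "?h x = k * eigenfunction'' w n x" for x
    using e[OF s2, of x] by (simp add: mult_ac)
  have ch: "continuous_on UNIV ?h" by (intro continuous_on_minus trig_series_continuous t2)
  note wd = classical_imp_weak_deriv[OF trig_series_derivative(1)[OF t1] trig_series_derivative(2)[OF t2] ch]
  have "\<exists>g. has_weak_deriv {0<..<pi} j (sine_series ?c) g" if "j \<le> 2" for j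
  proof -
    have "j = 0 \<or> j = 1 \<or> j = 2" using that by auto
    then show ?thesis using wd by blast
  qed
  then have "sine_series ?c \<in> sobolev {0<..<pi} 2" unfolding sobolev_def by blast
  moreover have "sine_series ?c \<in> sobolev_1_0 {0<..<pi}"
    by (rule sine_series_sobolev_1_0[OF t1 wd(2)])
  moreover have "AE x in leb_0_pi. - ?h x + cosine_series w x * sine_series ?c x = eigenvalue w n * sine_series ?c x"
  proof (rule AE_I2)
    fix x
    have "- ?h x + cosine_series w x * sine_series ?c x =
      k * (- eigenfunction'' w n x + cosine_series w x * eigenfunction w n x)"
      unfolding h f by (simp add: algebra_simps)
    also have "\<dots> = eigenvalue w n * sine_series ?c x"
      unfolding eigenfunction_equation[OF w \<delta>] f by simp
    finally show "- ?h x + cosine_series w x * sine_series ?c x = eigenvalue w n * sine_series ?c x" .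
  qed
  ultimately show ?thesis unfolding dirichlet_eigenpair_def f[symmetric] using wd(3) by blast
qed

lemma eigenvalue_strict_mono: "strict_mono_on {1..} (eigenvalue w)"
proof (rule strict_mono_onI)
  fix m n :: nat assume mn: "m \<in> {1..}" "n \<in> {1..}" "m < n"
  have b: "\<bar>eigenvalue w k - (real k)\<^sup>2\<bar> \<le> 1" if "k \<ge> 1" for k
  proof -
    have "\<delta> / real k \<le> \<delta> / 1" using that small_coeffs_nonneg[OF w] by (intro divide_left_mono) auto
    then show ?thesis using eigenvalue_asymptotics[OF w _ that] \<delta> by linarith
  qed
  have m1: "1 \<le> real m" and nm: "real m + 1 \<le> real n" using mn by auto
  have "(real m + 1)\<^sup>2 \<le> (real n)\<^sup>2" using nm by (intro power_mono) auto
  moreover have "(real m + 1)\<^sup>2 = (real m)\<^sup>2 + 2 * real m + 1" by (simp add: power2_sum)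
  ultimately have "(real m)\<^sup>2 + 3 \<le> (real n)\<^sup>2" using m1 by linarith
  then show "eigenvalue w m < eigenvalue w n" using b[of m] b[of n] mn by auto
qed

lemma eigenfunction_square_pos: "0 < (LINT x|leb_0_pi. (eigenfunction w n x)\<^sup>2)" if n: "n \<ge> 1"
proof -
  let ?f = "eigenfunction w n"
  have d: "((\<lambda>x. x / 2 - sin (2 * real n * x) / (4 * real n)) has_real_derivative (sin (real n * x))\<^sup>2) (at x)" for x
  proof -
    have "((\<lambda>x. x / 2 - sin (2 * real n * x) / (4 * real n)) has_real_derivative
        1 / 2 - cos (2 * real n * x) / 2) (at x)"
      using n by (auto intro!: derivative_eq_intros)
    moreover have "1 / 2 - cos (2 * real n * x) / 2 = (sin (real n * x))\<^sup>2"
      using cos_double_sin[of "real n * x"] by (simp add: mult.assoc field_simps)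
    ultimately show ?thesis by simp
  qed
  have "sin (2 * real n * pi) = 0" using sin_npi[of "2 * n"] by simp
  then have "(LINT x|leb_0_pi. (sin (real n * x))\<^sup>2) = pi / 2"
    using integral_derivative_0_pi[OF d] by (simp add: continuous_intros)
  moreover have "(LINT x|leb_0_pi. (?f x + (sin (real n * x) - ?f x))\<^sup>2) \<le>
     2 * (LINT x|leb_0_pi. (?f x)\<^sup>2) + 2 * (LINT x|leb_0_pi. (sin (real n * x) - ?f x)\<^sup>2)"
    by (intro integral_square_sum_le continuous_square_integrable continuous_intros eigenfunction_continuous[OF w \<delta>])
  moreover have "(LINT x|leb_0_pi. (sin (real n * x) - ?f x)\<^sup>2) \<le> pi * (1 / 10)\<^sup>2"
  proof (rule integral_square_bounded)
    show "(\<lambda>x. sin (real n * x) - ?f x) \<in> borel_measurable leb_0_pi"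
      by (intro continuous_measurable_0_pi continuous_intros eigenfunction_continuous[OF w \<delta>])
    fix x
    have "\<bar>\<Sum>l. correction n (residual w n) l * sin (real l * x)\<bar> \<le> (\<Sum>l. \<bar>correction n (residual w n) l\<bar>)"
      by (rule abs_suminf_le(2)[OF trig_terms_le(1) correction_summable(1)[OF w small_potential_delta[OF w \<delta>]]])
    then show "\<bar>sin (real n * x) - ?f x\<bar> \<le> 1 / 10"
      unfolding eigenfunction_near_sine[OF w \<delta>] using correction_sum_le_tenth[OF w \<delta>, of n] by linarith
  qed simp
  ultimately have "pi / 2 \<le> 2 * (LINT x|leb_0_pi. (?f x)\<^sup>2) + 2 * (pi * (1 / 10)\<^sup>2)" by simp
  moreover have "pi * (1 / 10)\<^sup>2 = pi / 100" by (simp add: power2_eq_square)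
  ultimately show ?thesis using pi_gt_zero by linarith
qed

text \<open>Each eigenfunction is the sine of the same index plus a combination of sines whose coefficients have sum below \<open>1 / 4\<close>. Replacing the sines in
that combination by their current approximations halves the error at every round.\<close>

lemma sine_near_eigenfunctions:
  "1 \<le> k \<Longrightarrow> \<exists>f. lin_comb (eigenfunction w) f \<and> (\<forall>x. \<bar>sin (real k * x) - f x\<bar> \<le> (1 / 2) ^ p)"
proof (induction p arbitrary: k)
  case 0
  show ?case by (intro exI[of _ "\<lambda>_. 0"]) (simp add: lin_comb.zero)
next
  case (Suc p)
  let ?b = "eigenfunction w"
  let ?u = "correction k (residual w k)"
  note su = correction_summable(1)[OF w small_potential_delta[OF w \<delta>], of k]
  have "\<exists>f. lin_comb ?b f \<and> (\<forall>x. \<bar>sin (real l * x) - f x\<bar> \<le> (1 / 2) ^ p)" for l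
  proof (cases "l = 0")
    case True
    then show ?thesis by (intro exI[of _ "\<lambda>_. 0"]) (simp add: lin_comb.zero)
  next
    case False
    then show ?thesis by (intro Suc.IH) simp
  qed
  then obtain g where g: "\<And>l. lin_comb ?b (g l)" "\<And>l x. \<bar>sin (real l * x) - g l x\<bar> \<le> (1 / 2) ^ p"
    by metis
  have "(\<lambda>L. \<Sum>l<L. \<bar>?u l\<bar>) \<longlonglongrightarrow> (\<Sum>l. \<bar>?u l\<bar>)" by (rule summable_LIMSEQ[OF su])
  then have "eventually (\<lambda>L. (\<Sum>l. \<bar>?u l\<bar>) - (1 / 4) * (1 / 2) ^ p < (\<Sum>l<L. \<bar>?u l\<bar>)) sequentially"
    by (rule order_tendstoD(1)) simp
  then obtain L where L: "(\<Sum>l. \<bar>?u l\<bar>) - (1 / 4) * (1 / 2) ^ p < (\<Sum>l<L. \<bar>?u l\<bar>)"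
    by (auto simp: eventually_sequentially)
  have split: "(\<Sum>l. \<bar>?u l\<bar>) = (\<Sum>l. \<bar>?u (l + L)\<bar>) + (\<Sum>l<L. \<bar>?u l\<bar>)"
    by (rule suminf_split_initial_segment[OF su])
  define f where "f = (\<lambda>x. ?b k x + (\<Sum>l<L. (- ?u l) * g l x))"
  have "lin_comb ?b f" unfolding f_def
    by (intro lin_comb_add lin_comb_sum lin_comb_cmult g lin_comb_base Suc.prems)
  moreover have "\<bar>sin (real k * x) - f x\<bar> \<le> (1 / 2) ^ Suc p" for x
  proof -
    let ?t = "\<lambda>l. ?u l * sin (real l * x)"
    have st: "summable ?t" by (rule trig_series_summable(1)[OF su])
    have "suminf ?t = (\<Sum>l. ?t (l + L)) + (\<Sum>l<L. ?t l)" by (rule suminf_split_initial_segment[OF st])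
    then have e: "sin (real k * x) - f x = - (\<Sum>l. ?t (l + L)) - (\<Sum>l<L. ?u l * (sin (real l * x) - g l x))"
      unfolding f_def eigenfunction_near_sine[OF w \<delta>] by (simp add: right_diff_distrib sum_subtractf sum_negf)
    have "\<bar>\<Sum>l. ?t (l + L)\<bar> \<le> (\<Sum>l. \<bar>?u (l + L)\<bar>)"
      by (rule abs_suminf_le(2)[OF trig_terms_le(1)]) (use su summable_iff_shift[of "\<lambda>l. \<bar>?u l\<bar>" L] in blast)
    then have 1: "\<bar>\<Sum>l. ?t (l + L)\<bar> \<le> (1 / 4) * (1 / 2) ^ p" using L split by linarith
    have "\<bar>\<Sum>l<L. ?u l * (sin (real l * x) - g l x)\<bar> \<le> (\<Sum>l<L. \<bar>?u l\<bar> * (1 / 2) ^ p)"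
      by (rule order.trans[OF sum_abs sum_mono]) (unfold abs_mult, intro mult_left_mono g(2), simp)
    also have "\<dots> = (\<Sum>l<L. \<bar>?u l\<bar>) * (1 / 2) ^ p" by (simp only: sum_distrib_right)
    also have "\<dots> \<le> (1 / 4) * (1 / 2) ^ p"
    proof (rule mult_right_mono)
      have "(\<Sum>l<L. \<bar>?u l\<bar>) \<le> (\<Sum>l. \<bar>?u l\<bar>)" by (intro sum_le_suminf su) auto
      then show "(\<Sum>l<L. \<bar>?u l\<bar>) \<le> 1 / 4" using correction_sum_le_tenth[OF w \<delta>, of k] by linarith
    qed simp
    finally show ?thesis unfolding e power_Suc using 1 by linarith
  qed
  ultimately show ?case by blast
qed

lemma lin_comb_sine_near_eigenfunctions:
  assumes "lin_comb sine f" "e > 0"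
  shows "\<exists>g. lin_comb (eigenfunction w) g \<and> (\<forall>x. \<bar>f x - g x\<bar> \<le> e)"
  using assms
proof (induction arbitrary: e rule: lin_comb.induct)
  case zero
  then show ?case by (intro exI[of _ "\<lambda>_. 0"]) (simp add: lin_comb.zero)
next
  case (step f n a)
  have "0 < e / 2 / (\<bar>a\<bar> + 1)" using step.prems by simp
  then obtain p where p: "(1 / 2) ^ p < e / 2 / (\<bar>a\<bar> + 1)" using real_arch_pow_inv[of _ "1/2"] by auto
  obtain g where g: "lin_comb (eigenfunction w) g" "\<forall>x. \<bar>f x - g x\<bar> \<le> e / 2"
    using step.IH[of "e / 2"] step.prems by auto
  obtain h where h: "lin_comb (eigenfunction w) h" "\<forall>x. \<bar>sin (real n * x) - h x\<bar> \<le> (1 / 2) ^ p"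
    using sine_near_eigenfunctions[OF step.hyps(2)] by blast
  have "\<bar>(f x + a * sin (real n * x)) - (g x + a * h x)\<bar> \<le> e" for x
  proof -
    have "\<bar>a * (sin (real n * x) - h x)\<bar> \<le> (\<bar>a\<bar> + 1) * (e / 2 / (\<bar>a\<bar> + 1))"
      unfolding abs_mult using h(2) p by (intro mult_mono) (auto intro: order.trans less_imp_le)
    also have "\<dots> = e / 2"
    proof -
      have "\<bar>a\<bar> + 1 \<noteq> 0" using abs_ge_zero[of a] by linarith
      moreover have "B * (C / B) = C" if "B \<noteq> 0" for B C :: real using that by simp
      ultimately show ?thesis by blast
    qed
    finally have "\<bar>a * (sin (real n * x) - h x)\<bar> \<le> e / 2" .
    moreover have "\<bar>f x - g x\<bar> \<le> e / 2" using g(2) by blast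
    moreover have "(f x + a * sin (real n * x)) - (g x + a * h x) = (f x - g x) + a * (sin (real n * x) - h x)"
      by (simp add: algebra_simps)
    ultimately show ?thesis by linarith
  qed
  moreover have "lin_comb (eigenfunction w) (\<lambda>x. g x + a * h x)"
    by (intro lin_comb_add[OF lin_comb_cmult[OF h(1)] g(1)])
  ultimately show ?case by blast
qed

lemma lin_comb_eigenfunctions_continuous:
  "lin_comb (eigenfunction w) f \<Longrightarrow> continuous_on A f"
proof (induction rule: lin_comb.induct)
  case (step f n a)
  then show ?case by (intro continuous_intros eigenfunction_continuous[OF w \<delta>])
qed simp

lemma lin_comb_scale:
  assumes "lin_comb b f" "\<And>n. n \<ge> 1 \<Longrightarrow> k n \<noteq> 0"
  shows "lin_comb (\<lambda>n x. k n * b n x) f"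
  using assms(1)
proof (induction rule: lin_comb.induct)
  case (step f n a)
  then show ?case using lin_comb.step[OF step.IH step.hyps(2), of "a / k n"] assms(2)[OF step.hyps(2)] by simp
qed (rule lin_comb.zero)

theorem dirichlet_spectrum_small_potential: "is_dirichlet_spectrum (cosine_series w) (eigenvalue w)"
proof -
  let ?b = "eigenfunction w"
  define A where "A = (\<lambda>n. LINT x|leb_0_pi. (?b n x)\<^sup>2)"
  define k where "k = (\<lambda>n. 1 / sqrt (A n))"
  define F where "F = (\<lambda>n x. k n * ?b n x)"
  have A: "A n > 0" if "n \<ge> 1" for n unfolding A_def using eigenfunction_square_pos[OF that] .
  have k0: "k n \<noteq> 0" if "n \<ge> 1" for n using A[OF that] by (simp add: k_def)
  have ep: "dirichlet_eigenpair (cosine_series w) (eigenvalue w n) (F n)" for n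
    unfolding F_def by (rule scaled_eigenfunction_eigenpair)
  have cF: "continuous_on B (F n)" for n B unfolding F_def by (intro continuous_intros eigenfunction_continuous[OF w \<delta>])
  have on: "(LINT x|leb_0_pi. F m x * F n x) = (if m = n then 1 else 0)" if "m \<ge> 1" "n \<ge> 1" for m n
  proof (cases "m = n")
    case True
    have "(LINT x|leb_0_pi. F n x * F n x) = (LINT x|leb_0_pi. (k n * k n) * (?b n x)\<^sup>2)"
      by (simp add: F_def power2_eq_square mult_ac)
    also have "\<dots> = (k n * k n) * A n" unfolding A_def by simp
    also have "\<dots> = 1" using A[OF that(2)] by (simp add: k_def)
    finally show ?thesis using True by simp
  next
    case False
    then have "eigenvalue w m \<noteq> eigenvalue w n"
      using eigenvalue_strict_mono that by (metis atLeast_iff less_irrefl linorder_neqE_nat strict_mono_onD)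
    then show ?thesis using eigenpair_orthogonal[OF ep ep] False by simp
  qed
  have complete: "\<exists>N c. (LINT x|leb_0_pi. (g x - (\<Sum>n=1..N. c n * F n x))\<^sup>2) < e"
    if g: "g \<in> square_integrable leb_0_pi" and e: "e > 0" for g e
  proof -
    obtain f where f: "lin_comb sine f" "(LINT x|leb_0_pi. (g x - f x)\<^sup>2) < e / 4"
      using sine_approximation[OF g, of "e / 4"] e by auto
    define d where "d = sqrt (e / (8 * pi))"
    have d: "d > 0" "d\<^sup>2 = e / (8 * pi)" using e by (auto simp: d_def)
    obtain h where h: "lin_comb ?b h" "\<forall>x. \<bar>f x - h x\<bar> \<le> d"
      using lin_comb_sine_near_eigenfunctions[OF f(1) d(1)] by blast
    obtain M c where c: "\<forall>x. f x = (\<Sum>n=1..M. c n * sin (real n * x))" using lin_comb_explicit[OF f(1)] by blast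
    have cf: "continuous_on B f" for B
      using c by (subst continuous_on_cong[OF refl, of _ _ "\<lambda>x. \<Sum>n=1..M. c n * sin (real n * x)"]) (auto intro!: continuous_intros)
    note ch = lin_comb_eigenfunctions_continuous[OF h(1)]
    have "(LINT x|leb_0_pi. (f x - h x)\<^sup>2) \<le> pi * d\<^sup>2"
      by (rule integral_square_bounded) (use h(2) d in \<open>auto intro!: continuous_measurable_0_pi continuous_intros cf ch\<close>)
    moreover have "(LINT x|leb_0_pi. ((g x - f x) + (f x - h x))\<^sup>2) \<le> 2 * (LINT x|leb_0_pi. (g x - f x)\<^sup>2) + 2 * (LINT x|leb_0_pi. (f x - h x)\<^sup>2)"
      by (intro integral_square_sum_le square_integrable_diff g continuous_square_integrable cf ch)
    moreover have "2 * (pi * d\<^sup>2) = e / 4" unfolding d(2) by simp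
    ultimately have "(LINT x|leb_0_pi. (g x - h x)\<^sup>2) < e" using f(2) e by simp
    moreover obtain N c' where "\<forall>x. h x = (\<Sum>n=1..N. c' n * F n x)"
      using lin_comb_explicit[OF lin_comb_scale[OF h(1), of k]] k0 unfolding F_def by blast
    ultimately show ?thesis by auto
  qed
  have "hilbert_basis leb_0_pi F"
    unfolding hilbert_basis_def using on complete continuous_square_integrable[OF cF] by blast
  then show ?thesis
    unfolding is_dirichlet_spectrum_def using eigenvalue_strict_mono ep unfolding dirichlet_eigenpair_def by blast
qed

end

section \<open>Fourier coefficients of the potential\<close>

definition decay :: "real \<Rightarrow> nat \<Rightarrow> real" where
  "decay s k = japanese_bracket (real k) powr (- s)"

text \<open>The coefficient of index \<open>0\<close> is set to \<open>0\<close>: the series starts at \<open>k = 1\<close>.\<close>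

definition potential_coeffs :: "real \<Rightarrow> (nat \<Rightarrow> real) \<Rightarrow> nat \<Rightarrow> real" where
  "potential_coeffs s a k = (if k = 0 then 0 else a k * decay s k)"

lemma japanese_bracket_bounds: "1 \<le> japanese_bracket x" "\<bar>x\<bar> \<le> japanese_bracket x"
  "(japanese_bracket x)\<^sup>2 = 1 + x\<^sup>2" "japanese_bracket x \<le> 1 + \<bar>x\<bar>"
proof -
  show "1 \<le> japanese_bracket x" "\<bar>x\<bar> \<le> japanese_bracket x"
    unfolding japanese_bracket_def by (auto intro!: real_le_rsqrt)
  show "(japanese_bracket x)\<^sup>2 = 1 + x\<^sup>2"
    unfolding japanese_bracket_def by (intro real_sqrt_pow2 add_nonneg_nonneg) auto
  show "japanese_bracket x \<le> 1 + \<bar>x\<bar>"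
    unfolding japanese_bracket_def by (intro real_le_lsqrt) (auto simp: power2_sum)
qed

lemma decay_pos: "0 < decay s k"
  unfolding decay_def using japanese_bracket_bounds(1)[of "real k"] by simp

lemma decay_summable:
  assumes "s > 1" shows "summable (decay s)"
proof (rule summable_comparison_test'[of _ 1])
  show "summable (\<lambda>k. real k powr (- s))" using assms by (subst summable_real_powr_iff) simp
  fix k :: nat assume "1 \<le> k"
  then show "norm (decay s k) \<le> real k powr (- s)"
    using decay_pos[of s k] japanese_bracket_bounds(2)[of "real k"] assms
    by (auto simp: decay_def intro!: powr_mono2')
qed

lemma potential_eq_cosine_series:
  assumes "summable (\<lambda>k. \<bar>potential_coeffs s a k\<bar>)"
  shows "potential s a = cosine_series (potential_coeffs s a)"
proof
  fix x
  let ?f = "\<lambda>k. potential_coeffs s a k * cos (real k * x)"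
  have sm: "summable (\<lambda>k. \<bar>?f k\<bar>)" by (rule abs_suminf_le(1)[OF trig_terms_le(2) assms])
  have "potential s a x = infsum ?f UNIV"
    unfolding potential_def
    by (rule infsum_cong_neutral) (auto simp: potential_coeffs_def decay_def)
  also have "\<dots> = suminf ?f" by (rule infsum_eq_suminf_real(2)[OF sm])
  finally show "potential s a x = cosine_series (potential_coeffs s a) x" by (simp add: cosine_series_def)
qed

lemma integral_torus_derivative:
  fixes F f :: "real \<Rightarrow> real"
  assumes "\<And>x. (F has_real_derivative f x) (at x)" "continuous_on {0..2*pi} f"
  shows "(LINT x|lebesgue_on {0..2*pi}. f x) = F (2 * pi) - F 0"
proof -
  have "(f has_integral (F (2*pi) - F 0)) {0..2*pi}"
    by (rule fundamental_theorem_of_calculus)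
       (auto intro: has_field_derivative_at_within[OF assms(1)] simp flip: has_real_derivative_iff_has_vector_derivative)
  then show ?thesis
    using lebesgue_integral_eq_integral[OF continuous_imp_integrable_real[OF assms(2)]] by (simp add: integral_unique)
qed

lemma sin_nat_two_pi: "sin (real n * (2 * pi)) = 0"
  using sin_npi[of "2 * n"] by (simp add: mult_ac)

lemma cosine_orthogonal:
  assumes n: "n \<ge> 1"
  shows "(LINT x|lebesgue_on {0..2*pi}. cos (real k * x) * cos (real n * x)) = (if k = n then pi else 0)"
proof (cases "k = n")
  case True
  have d: "((\<lambda>x. x / 2 + sin (real (2 * n) * x) / (4 * real n)) has_real_derivative cos (real k * x) * cos (real n * x)) (at x)" for x
  proof -
    have "((\<lambda>x. x / 2 + sin (real (2 * n) * x) / (4 * real n)) has_real_derivative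
        1 / 2 + cos (2 * (real n * x)) / 2) (at x)"
      using n by (auto intro!: derivative_eq_intros simp: mult.assoc)
    moreover have "1 / 2 + cos (2 * (real n * x)) / 2 = cos (real k * x) * cos (real n * x)"
      using True cos_double_cos[of "real n * x"] by (simp add: power2_eq_square field_simps)
    ultimately show ?thesis by simp
  qed
  have "(LINT x|lebesgue_on {0..2*pi}. cos (real k * x) * cos (real n * x)) =
     (2 * pi / 2 + sin (real (2 * n) * (2 * pi)) / (4 * real n)) - (0 / 2 + sin (real (2 * n) * 0) / (4 * real n))"
    by (rule integral_torus_derivative[OF d]) (intro continuous_intros)
  then show ?thesis using True unfolding sin_nat_two_pi by simp
next
  case False
  define d where "d = real k - real n"
  have d0: "d \<noteq> 0" using False by (simp add: d_def)
  have sd: "sin (d * (2 * pi)) = 0"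
    using sin_nat_two_pi[of k] sin_nat_two_pi[of n] unfolding d_def left_diff_distrib sin_diff by simp
  have dd: "((\<lambda>x. sin (d * x) / (2 * d) + sin (real (k + n) * x) / (2 * real (k + n)))
      has_real_derivative cos (real k * x) * cos (real n * x)) (at x)" for x
  proof -
    have "((\<lambda>x. sin (d * x) / (2 * d) + sin (real (k + n) * x) / (2 * real (k + n)))
      has_real_derivative cos (d * x) / 2 + cos (real (k + n) * x) / 2) (at x)"
      using n d0 by (auto intro!: derivative_eq_intros simp del: of_nat_add)
    moreover have "cos (d * x) / 2 + cos (real (k + n) * x) / 2 = cos (real k * x) * cos (real n * x)"
      unfolding d_def by (simp add: left_diff_distrib distrib_right cos_diff cos_add field_simps)
    ultimately show ?thesis by simp
  qed
  have "(LINT x|lebesgue_on {0..2*pi}. cos (real k * x) * cos (real n * x)) =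
     (sin (d * (2 * pi)) / (2 * d) + sin (real (k + n) * (2 * pi)) / (2 * real (k + n))) -
     (sin (d * 0) / (2 * d) + sin (real (k + n) * 0) / (2 * real (k + n)))"
    by (rule integral_torus_derivative[OF dd]) (intro continuous_intros)
  then show ?thesis using False unfolding sin_nat_two_pi sd by simp
qed

lemma cosine_series_coefficient:
  assumes w: "summable (\<lambda>k. \<bar>w k\<bar>)" and n: "n \<ge> 1"
  shows "(LINT x|lebesgue_on {0..2*pi}. cosine_series w x * cos (real n * x)) = pi * w n"
proof -
  let ?M = "lebesgue_on {0..2*pi}"
  let ?f = "\<lambda>k x. w k * (cos (real k * x) * cos (real n * x))"
  have i: "integrable ?M (?f k)" for k
    by (intro continuous_imp_integrable_real continuous_intros)
  have le: "\<bar>?f k x\<bar> \<le> \<bar>w k\<bar>" for k x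
  proof -
    have "\<bar>cos (real k * x) * cos (real n * x)\<bar> \<le> 1 * 1" unfolding abs_mult by (intro mult_mono) auto
    then have "\<bar>w k\<bar> * \<bar>cos (real k * x) * cos (real n * x)\<bar> \<le> \<bar>w k\<bar> * 1" by (intro mult_left_mono) auto
    then show ?thesis by (simp add: abs_mult)
  qed
  have s: "summable (\<lambda>k. norm (?f k x))" for x
    unfolding real_norm_def by (rule abs_suminf_le(1)[OF le w])
  have ile: "(LINT x|?M. norm (?f k x)) \<le> 2 * pi * \<bar>w k\<bar>" for k
  proof -
    have "(LINT x|?M. norm (?f k x)) \<le> (LINT x|?M. \<bar>w k\<bar>)"
    proof (rule integral_mono)
      show "integrable ?M (\<lambda>x. norm (?f k x))" by (rule integrable_norm[OF i])
      show "integrable ?M (\<lambda>x. \<bar>w k\<bar>)" by (intro continuous_imp_integrable_real continuous_intros)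
    qed (use le in simp)
    also have "\<dots> = 2 * pi * \<bar>w k\<bar>" by (simp add: measure_restrict_space)
    finally show ?thesis .
  qed
  have si: "summable (\<lambda>k. LINT x|?M. norm (?f k x))"
    by (rule summable_comparison_test'[OF summable_mult[OF w, of "2 * pi"], of 0]) (use ile in simp)
  have "(LINT x|?M. (\<Sum>k. ?f k x)) = (\<Sum>k. LINT x|?M. ?f k x)"
    by (rule integral_suminf[OF i _ si]) (use s in simp)
  also have "(\<lambda>k. LINT x|?M. ?f k x) = (\<lambda>k. if k = n then pi * w n else 0)"
    using cosine_orthogonal[OF n] by auto
  also have "(\<Sum>k. if k = n then pi * w n else 0) = pi * w n"
    using sums_If_finite[of "\<lambda>k. k = n" "\<lambda>_. pi * w n"] by (simp add: sums_iff)
  finally have "(LINT x|?M. (\<Sum>k. ?f k x)) = pi * w n" .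
  moreover have "(\<Sum>k. ?f k x) = cosine_series w x * cos (real n * x)" for x
    unfolding cosine_series_def
    using suminf_mult2[OF trig_series_summable(2)[OF w, of x], of "cos (real n * x)"] by (simp add: mult.assoc)
  ultimately show ?thesis by simp
qed

lemma fourier_coeff_lower:
  assumes w: "summable (\<lambda>k. \<bar>w k\<bar>)" and n: "n \<ge> 1"
  shows "\<bar>w n\<bar> / 2 \<le> norm (fourier_coeff (cosine_series w) (int n))"
proof -
  let ?M = "lebesgue_on {0..2*pi}"
  let ?g = "\<lambda>x. complex_of_real (cosine_series w x) * cis (- real_of_int (int n) * x)"
  have "continuous_on {0..2*pi} ?g"
    unfolding cis_conv_exp by (intro continuous_intros trig_series_continuous w)
  then have ig: "integrable ?M ?g" by (rule continuous_imp_integrable_real)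
  have "Re (LINT x|?M. ?g x) = (LINT x|?M. Re (?g x))"
    using integral_Re[OF ig] by simp
  also have "\<dots> = (LINT x|?M. cosine_series w x * cos (real n * x))" by (simp)
  also have "\<dots> = pi * w n" by (rule cosine_series_coefficient[OF w n])
  finally have "Re (fourier_coeff (cosine_series w) (int n)) = w n / 2"
    unfolding fourier_coeff_def
    using Re_divide_of_real[of "LINT x|?M. ?g x" "2 * pi"] by simp
  then show ?thesis using abs_Re_le_cmod[of "fourier_coeff (cosine_series w) (int n)"] by simp
qed

text \<open>Splits \<open>a\<close> into a summable part and a part controlled by the Sobolev norm, in place of the Cauchy--Schwarz inequality for sums.\<close>

lemma weighted_young:
  fixes \<eta> K a :: real
  assumes "\<eta> > 0" "K > 0"
  shows "a \<le> \<eta> / 2 * (1 / K) + 1 / (2 * \<eta>) * (K * a\<^sup>2)"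
proof -
  have "2 * (K * a) * \<eta> \<le> (K * a)\<^sup>2 + \<eta>\<^sup>2" by (rule sum_squares_bound)
  then have "a * (2 * K * \<eta>) \<le> (K * a)\<^sup>2 + \<eta>\<^sup>2" by (simp add: mult_ac)
  then have "a \<le> ((K * a)\<^sup>2 + \<eta>\<^sup>2) / (2 * K * \<eta>)" using assms by (subst pos_le_divide_eq) auto
  also have "\<dots> = (K * a)\<^sup>2 / (2 * K * \<eta>) + \<eta>\<^sup>2 / (2 * K * \<eta>)" by (rule add_divide_distrib)
  also have "(K * a)\<^sup>2 / (2 * K * \<eta>) = 1 / (2 * \<eta>) * (K * a\<^sup>2)" using assms by (simp add: power2_eq_square)
  also have "\<eta>\<^sup>2 / (2 * K * \<eta>) = \<eta> / 2 * (1 / K)" using assms by (simp add: power2_eq_square)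
  finally show ?thesis by simp
qed

text \<open>The coefficient \<open>w k\<close> is recovered from the real part of the \<open>k\<close>-th Fourier coefficient, which is \<open>w k / 2\<close>; the \<open>H\<^sup>1\<close> norm bounds
\<open>\<Sum>k. \<langle>k\<rangle>\<^sup>2 * (w k)\<^sup>2\<close>.\<close>

lemma small_coeffs_of_H1:
  assumes w: "summable (\<lambda>k. \<bar>w k\<bar>)" "w 0 = 0" and \<eta>: "\<eta> > 0"
    and H: "cosine_series w \<in> H1_torus" "H1_torus_norm (cosine_series w) \<le> \<eta>"
  shows "small_coeffs (4 * \<eta>) w"
proof -
  let ?t = "\<lambda>n::int. (japanese_bracket (real_of_int n))\<^sup>2 * (norm (fourier_coeff (cosine_series w) n))\<^sup>2"
  have sm: "?t summable_on UNIV" using H(1) unfolding H1_torus_def by blast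
  have S0: "0 \<le> infsum ?t UNIV" by (rule infsum_nonneg) simp
  have "sqrt (infsum ?t UNIV) \<le> \<eta>" using H(2) unfolding H1_torus_norm_def .
  then have "(sqrt (infsum ?t UNIV))\<^sup>2 \<le> \<eta>\<^sup>2" using S0 by (intro power_mono) auto
  then have S: "infsum ?t UNIV \<le> \<eta>\<^sup>2" using S0 by simp
  let ?J = "\<lambda>k::nat. (japanese_bracket (real k))\<^sup>2"
  have fin: "(\<Sum>k\<in>F. ?J k * (w k)\<^sup>2) \<le> 4 * \<eta>\<^sup>2" if F: "finite F" for F
  proof -
    have "(\<Sum>k\<in>F. ?J k * (w k)\<^sup>2) \<le> (\<Sum>k\<in>F. 4 * ?t (int k))"
    proof (rule sum_mono)
      fix k
      have "(\<bar>w k\<bar> / 2)\<^sup>2 \<le> (norm (fourier_coeff (cosine_series w) (int k)))\<^sup>2"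
      proof (cases "k = 0")
        case False
        then show ?thesis using fourier_coeff_lower[OF w(1), of k] by (intro power_mono) auto
      qed (simp add: w)
      then have "?J k * (\<bar>w k\<bar> / 2)\<^sup>2 \<le> ?J k * (norm (fourier_coeff (cosine_series w) (int k)))\<^sup>2"
        by (rule mult_left_mono) simp
      then show "?J k * (w k)\<^sup>2 \<le> 4 * ?t (int k)" by (simp add: power_divide)
    qed
    also have "\<dots> = 4 * (\<Sum>n\<in>int ` F. ?t n)" by (simp add: sum.reindex sum_distrib_left)
    also have "\<dots> \<le> 4 * infsum ?t UNIV" using F by (intro mult_left_mono finite_sum_le_infsum sm) auto
    also have "\<dots> \<le> 4 * \<eta>\<^sup>2" using S by simp
    finally show ?thesis .
  qed
  have 1: "real k * \<bar>w k\<bar> \<le> 4 * \<eta>" for k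
  proof -
    have "(real k * \<bar>w k\<bar>)\<^sup>2 \<le> ?J k * (w k)\<^sup>2"
      unfolding power_mult_distrib power2_abs japanese_bracket_bounds(3) by (intro mult_right_mono) auto
    also have "\<dots> \<le> 4 * \<eta>\<^sup>2" using fin[of "{k}"] by simp
    also have "\<dots> \<le> (4 * \<eta>)\<^sup>2" by (simp add: power_mult_distrib)
    finally show ?thesis by (rule power2_le_imp_le) (use \<eta> in simp)
  qed
  have 2: "(\<Sum>k<N. \<bar>w k\<bar>) \<le> 4 * \<eta>" for N
  proof -
    have pt: "\<bar>w k\<bar> \<le> \<eta> / 2 * (1 / (real k)\<^sup>2) + 1 / (2 * \<eta>) * (?J k * (w k)\<^sup>2)" if "k \<ge> 1" for k
    proof -
      have "\<bar>w k\<bar> \<le> \<eta> / 2 * (1 / (real k)\<^sup>2) + 1 / (2 * \<eta>) * ((real k)\<^sup>2 * \<bar>w k\<bar>\<^sup>2)"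
        using that \<eta> by (intro weighted_young) auto
      also have "\<dots> \<le> \<eta> / 2 * (1 / (real k)\<^sup>2) + 1 / (2 * \<eta>) * (?J k * (w k)\<^sup>2)"
        unfolding japanese_bracket_bounds(3) power2_abs using \<eta>
        by (intro add_left_mono mult_left_mono mult_right_mono) auto
      finally show ?thesis .
    qed
    have "(\<Sum>k<N. \<bar>w k\<bar>) \<le> (\<Sum>k=1..N. \<bar>w k\<bar>)"
    proof -
      have "(\<Sum>k<N. \<bar>w k\<bar>) = (\<Sum>k\<in>{1..<N}. \<bar>w k\<bar>)" using w(2) by (intro sum.mono_neutral_right) (auto simp: not_le)
      also have "\<dots> \<le> (\<Sum>k=1..N. \<bar>w k\<bar>)" by (intro sum_mono2) auto
      finally show ?thesis .
    qed
    also have "\<dots> \<le> (\<Sum>k=1..N. \<eta> / 2 * (1 / (real k)\<^sup>2) + 1 / (2 * \<eta>) * (?J k * (w k)\<^sup>2))"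
      by (intro sum_mono pt) auto
    also have "\<dots> = \<eta> / 2 * (\<Sum>k=1..N. 1 / (real k)\<^sup>2) + 1 / (2 * \<eta>) * (\<Sum>k=1..N. ?J k * (w k)\<^sup>2)"
      by (simp only: sum.distrib sum_distrib_left)
    also have "\<dots> \<le> \<eta> / 2 * 2 + 1 / (2 * \<eta>) * (4 * \<eta>\<^sup>2)"
      using \<eta> by (intro add_mono mult_left_mono sum_inverse_squares_le fin) auto
    also have "\<dots> \<le> 4 * \<eta>" using \<eta> by (simp add: power2_eq_square)
    finally show ?thesis .
  qed
  show ?thesis unfolding small_coeffs_def using w(2) 1 2 by blast
qed

section \<open>From small divisors to strong non-resonance\<close>

definition log_weight :: "(nat \<Rightarrow> int) \<Rightarrow> nat \<Rightarrow> real" where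
  "log_weight z N = (\<Sum>n=1..N. \<bar>real_of_int (z n)\<bar> * ln (2 * real n))"

lemma log_weight_nonneg: "0 \<le> log_weight z N"
  unfolding log_weight_def by (intro sum_nonneg mult_nonneg_nonneg) auto

lemma log_weight_Suc: "log_weight z (Suc N) = log_weight z N + \<bar>real_of_int (z (Suc N))\<bar> * ln (2 * real (Suc N))"
  by (simp add: log_weight_def)

lemma ln_le_log_weight:
  assumes "1 \<le> n" "n \<le> N" "z n \<noteq> 0"
  shows "ln (2 * real n) \<le> log_weight z N"
proof -
  have "1 * ln (2 * real n) \<le> \<bar>real_of_int (z n)\<bar> * ln (2 * real n)"
  proof (rule mult_right_mono)
    show "1 \<le> \<bar>real_of_int (z n)\<bar>" using assms(3) by linarith
  qed (use assms(1) in simp)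
  also have "\<dots> \<le> log_weight z N"
    unfolding log_weight_def using assms(1,2)
    by (intro member_le_sum[of n "{1..N}" "\<lambda>n. \<bar>real_of_int (z n)\<bar> * ln (2 * real n)"]) auto
  finally show ?thesis by simp
qed

lemma index_le_exp_log_weight:
  assumes "1 \<le> n" "n \<le> N" "z n \<noteq> 0"
  shows "real n \<le> exp (log_weight z N)"
proof -
  have "exp (ln (2 * real n)) \<le> exp (log_weight z N)"
    unfolding exp_le_cancel_iff by (rule ln_le_log_weight[of n N z, OF assms])
  then show ?thesis using assms(1) by simp
qed

text \<open>The indices beyond \<open>N\<close> are so large that their eigenvalues may be replaced by the integers \<open>n\<^sup>2\<close>, up to an error that is negligible against
the lower bound for the indices up to \<open>N\<close>. The resulting integer \<open>k\<close> is harmless: either it is so large that nothing can compensate it, or it is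
polynomially bounded by the indices up to \<open>N\<close>. Numerical constants, \<open>R\<close> and \<open>\<gamma>\<close> are collected in \<open>L\<close>.\<close>

lemma small_divisor_at_cutoff:
  fixes lam :: "nat \<Rightarrow> real" and z :: "nat \<Rightarrow> int" and M :: nat and R B \<gamma> :: real
  defines "F \<equiv> (\<Sum>n=1..M. real_of_int (z n) * lam n)"
    and "L \<equiv> ln (34 * R ^ 3 / \<gamma>)"
  assumes lam: "\<And>n. n \<ge> 1 \<Longrightarrow> \<bar>lam n - (real n)\<^sup>2\<bar> \<le> 1 / real n"
    and \<gamma>: "0 < \<gamma>" "\<gamma> \<le> 1" and B: "0 \<le> B"
    and lower: "\<And>k::int. \<bar>(\<Sum>n=1..N. real_of_int (z n) * lam n) + real_of_int k\<bar> \<ge>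
      \<gamma> * exp (- B * log_weight z N) / (1 + (real_of_int k)\<^sup>2)"
    and R: "R = (\<Sum>n=1..M. \<bar>real_of_int (z n)\<bar>)" "1 \<le> R"
    and N: "N \<le> M"
    and tail: "\<And>n. N < n \<Longrightarrow> n \<le> M \<Longrightarrow> z n \<noteq> 0 \<Longrightarrow> real n \<ge> exp ((B + 4) * (L + log_weight z N))"
  shows "\<bar>F\<bar> \<ge> exp (- (B + 4) * (L + log_weight z N))"
proof -
  define S where "S = log_weight z N"
  define b where "b = B + 4"
  have b: "b \<ge> 4" using B by (simp add: b_def)
  have S0: "0 \<le> S" unfolding S_def by (rule log_weight_nonneg)
  have R3: "1 \<le> R ^ 3" "R\<^sup>2 \<le> R ^ 3" using R(2) by (simp_all add: power_increasing)
  have "\<gamma> \<le> 34 * R ^ 3" using R3 \<gamma> by linarith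
  then have L1: "1 \<le> 34 * R ^ 3 / \<gamma>" using \<gamma> by (simp add: le_divide_eq)
  then have L0: "0 \<le> L" unfolding L_def by simp
  have "exp L = 34 * R ^ 3 / \<gamma>" unfolding L_def using L1 by (intro exp_ln) linarith
  then have eL: "exp (- L) = \<gamma> / (34 * R ^ 3)" by (simp only: exp_minus inverse_divide)
  have z0: "(\<Sum>n=1..N. \<bar>real_of_int (z n)\<bar>) \<le> R" "(\<Sum>n=Suc N..M. \<bar>real_of_int (z n)\<bar>) \<le> R"
    unfolding R(1) using N by (intro sum_mono2; auto)+
  define G where "G = (\<Sum>n=1..N. real_of_int (z n) * lam n)"
  define k where "k = (\<Sum>n=Suc N..M. z n * (int n)\<^sup>2)"
  define E where "E = (\<Sum>n=Suc N..M. real_of_int (z n) * (lam n - (real n)\<^sup>2))"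
  have "{1..M} = {1..N} \<union> {Suc N..M}" using N by auto
  then have "F = G + (\<Sum>n=Suc N..M. real_of_int (z n) * lam n)"
    unfolding F_def G_def by (simp add: sum.union_disjoint)
  also have "(\<Sum>n=Suc N..M. real_of_int (z n) * lam n) = real_of_int k + E"
    unfolding k_def E_def of_int_sum sum.distrib[symmetric] by (intro sum.cong) (auto simp: algebra_simps)
  finally have F: "F = G + real_of_int k + E" by simp
  have Ele: "\<bar>E\<bar> \<le> (\<Sum>n=Suc N..M. \<bar>real_of_int (z n)\<bar> * (1 / real n))"
    unfolding E_def
  proof (intro order.trans[OF sum_abs] sum_mono)
    fix n assume "n \<in> {Suc N..M}"
    then show "\<bar>real_of_int (z n) * (lam n - (real n)\<^sup>2)\<bar> \<le> \<bar>real_of_int (z n)\<bar> * (1 / real n)"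
      unfolding abs_mult by (intro mult_left_mono lam) auto
  qed
  have E1: "\<bar>E\<bar> \<le> R"
  proof -
    have "(\<Sum>n=Suc N..M. \<bar>real_of_int (z n)\<bar> * (1 / real n)) \<le> (\<Sum>n=Suc N..M. \<bar>real_of_int (z n)\<bar> * 1)"
      by (intro sum_mono mult_left_mono) auto
    then show ?thesis using Ele z0(2) by simp
  qed
  have E2: "\<bar>E\<bar> \<le> \<gamma> / (34 * R\<^sup>2) * exp (- b * S)"
  proof -
    have "(\<Sum>n=Suc N..M. \<bar>real_of_int (z n)\<bar> * (1 / real n)) \<le>
        (\<Sum>n=Suc N..M. \<bar>real_of_int (z n)\<bar> * exp (- b * (L + S)))"
    proof (intro sum_mono)
      fix n assume n: "n \<in> {Suc N..M}"
      show "\<bar>real_of_int (z n)\<bar> * (1 / real n) \<le> \<bar>real_of_int (z n)\<bar> * exp (- b * (L + S))"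
      proof (cases "z n = 0")
        case False
        then have "exp (b * (L + S)) \<le> real n" using tail[of n] n unfolding b_def S_def by auto
        then have "1 / real n \<le> 1 / exp (b * (L + S))" by (intro divide_left_mono) (use n in auto)
        also have "\<dots> = exp (- b * (L + S))" by (simp only: mult_minus_left exp_minus inverse_eq_divide)
        finally show ?thesis by (rule mult_left_mono) simp
      qed simp
    qed
    also have "\<dots> = (\<Sum>n=Suc N..M. \<bar>real_of_int (z n)\<bar>) * exp (- b * (L + S))"
      by (simp only: sum_distrib_right)
    also have "\<dots> \<le> R * exp (- b * (L + S))" by (intro mult_right_mono z0) simp
    also have "\<dots> = R * (exp (- b * L) * exp (- b * S))" by (simp add: exp_add[symmetric] algebra_simps)
    also have "\<dots> \<le> R * (exp (- L) * exp (- b * S))"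
      using R(2) b L0 mult_right_mono[of 1 b L] by (intro mult_left_mono mult_right_mono) auto
    also have "\<dots> = \<gamma> / (34 * R\<^sup>2) * exp (- b * S)"
      unfolding eL using R(2) by (simp add: power2_eq_square power3_eq_cube)
    finally show ?thesis using Ele by linarith
  qed
  have Gle: "\<bar>G\<bar> \<le> 2 * R * exp (2 * S)"
  proof -
    have "\<bar>G\<bar> \<le> (\<Sum>n=1..N. \<bar>real_of_int (z n)\<bar> * (2 * exp (2 * S)))"
      unfolding G_def
    proof (intro order.trans[OF sum_abs] sum_mono)
      fix n assume n: "n \<in> {1..N}"
      show "\<bar>real_of_int (z n) * lam n\<bar> \<le> \<bar>real_of_int (z n)\<bar> * (2 * exp (2 * S))"
      proof (cases "z n = 0")
        case False
        have n1: "1 \<le> real n" using n by simp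
        have "real n \<le> exp S" unfolding S_def using index_le_exp_log_weight[of n N z] n False by auto
        then have "(real n)\<^sup>2 \<le> (exp S)\<^sup>2" by (intro power_mono) auto
        also have "\<dots> = exp (2 * S)" by (simp add: exp_double)
        finally have 1: "(real n)\<^sup>2 \<le> exp (2 * S)" .
        have "1 / real n \<le> 1" "1 \<le> (real n)\<^sup>2" using n1 by auto
        moreover have "\<bar>lam n - (real n)\<^sup>2\<bar> \<le> 1 / real n" using lam n by simp
        ultimately have "\<bar>lam n\<bar> \<le> 2 * exp (2 * S)" using 1 by linarith
        then show ?thesis unfolding abs_mult by (rule mult_left_mono) simp
      qed simp
    qed
    also have "\<dots> = (\<Sum>n=1..N. \<bar>real_of_int (z n)\<bar>) * (2 * exp (2 * S))" by (simp only: sum_distrib_right)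
    also have "\<dots> \<le> R * (2 * exp (2 * S))" by (intro mult_right_mono z0) simp
    finally show ?thesis by simp
  qed
  have goal_small: "exp (- b * (L + S)) \<le> 1" using b L0 S0 by simp
  show ?thesis unfolding b_def[symmetric] S_def[symmetric]
  \<comment> \<open>Beyond this threshold \<open>\<bar>k\<bar>\<close> exceeds the low part and the error by at least \<open>1\<close>.\<close>
  proof (cases "\<bar>real_of_int k\<bar> \<ge> 2 * R * exp (2 * S) + R + 1")
    case True
    then have "\<bar>F\<bar> \<ge> 1" using Gle E1 unfolding F by linarith
    then show "exp (- b * (L + S)) \<le> \<bar>F\<bar>" using goal_small by linarith
  next
    case False
    have e1: "1 \<le> exp (2 * S)" using S0 by simp
    have "R * 1 \<le> R * exp (2 * S)" using R(2) e1 by (intro mult_left_mono) auto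
    with False R(2) have "\<bar>real_of_int k\<bar> \<le> 4 * (R * exp (2 * S))" by linarith
    then have "\<bar>real_of_int k\<bar>\<^sup>2 \<le> (4 * (R * exp (2 * S)))\<^sup>2" by (intro power_mono) auto
    also have "\<dots> = 16 * (R\<^sup>2 * exp (4 * S))" by (simp add: power_mult_distrib exp_double[symmetric])
    finally have "(real_of_int k)\<^sup>2 \<le> 16 * (R\<^sup>2 * exp (4 * S))" by simp
    moreover have "1 * 1 \<le> R\<^sup>2 * exp (4 * S)" using R(2) S0 by (intro mult_mono) auto
    ultimately have k2: "1 + (real_of_int k)\<^sup>2 \<le> 17 * (R\<^sup>2 * exp (4 * S))" by linarith
    have "2 * (\<gamma> / (34 * R\<^sup>2) * exp (- b * S)) = \<gamma> * exp (- B * S) / (17 * (R\<^sup>2 * exp (4 * S)))"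
    proof -
      have "exp (- b * S) = exp (- B * S - 4 * S)" by (simp add: b_def algebra_simps)
      also have "\<dots> = exp (- B * S) / exp (4 * S)" by (rule exp_diff)
      finally show ?thesis using R(2) by (simp add: field_simps)
    qed
    also have "\<dots> \<le> \<gamma> * exp (- B * S) / (1 + (real_of_int k)\<^sup>2)"
    proof (rule divide_left_mono[OF k2])
      have "0 < 1 + (real_of_int k)\<^sup>2" by (simp add: add_pos_nonneg)
      then show "0 < 17 * (R\<^sup>2 * exp (4 * S)) * (1 + (real_of_int k)\<^sup>2)" using R(2) by simp
    qed (use \<gamma> in simp)
    also have "\<dots> \<le> \<bar>G + real_of_int k\<bar>" unfolding G_def S_def by (rule lower)
    finally have "\<gamma> / (34 * R\<^sup>2) * exp (- b * S) \<le> \<bar>F\<bar>" using E2 unfolding F by linarith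
    moreover have "exp (- b * (L + S)) \<le> \<gamma> / (34 * R\<^sup>2) * exp (- b * S)"
    proof -
      have "exp (- b * (L + S)) = exp (- b * L) * exp (- b * S)" by (simp add: exp_add[symmetric] algebra_simps)
      also have "\<dots> \<le> exp (- L) * exp (- b * S)"
        using b L0 mult_right_mono[of 1 b L] by (intro mult_right_mono) auto
      also have "\<dots> \<le> \<gamma> / (34 * R\<^sup>2) * exp (- b * S)"
        unfolding eL using \<gamma> R R3 by (intro mult_right_mono divide_left_mono mult_left_mono mult_pos_pos) auto
      finally show ?thesis .
    qed
    ultimately show "exp (- b * (L + S)) \<le> \<bar>F\<bar>" by linarith
  qed
qed

text \<open>Let \<open>N\<close> grow from the smallest index \<open>N0\<close> on. If no cut-off applies at \<open>N\<close> and the next index carries the coefficient \<open>z\<close>, that index is at most exponential in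
\<open>A = L + log_weight z N\<close>, so passing it multiplies \<open>A\<close> by at most \<open>1 + (B + 5) * \<bar>z\<bar> \<le> exp ((B + 5) * \<bar>z\<bar>)\<close>. All
these factors together are bounded by \<open>exp ((B + 5) * R)\<close>. Keeping the product of the indices, rather than a power of the largest one,
is essential: the latter would lose a factor \<open>R\<close> at each step and end with \<open>R\<close> to the power \<open>R\<close>.\<close>

lemma small_divisor_chain:
  fixes lam :: "nat \<Rightarrow> real" and z :: "nat \<Rightarrow> int" and M :: nat and R B \<gamma> :: real
  defines "F \<equiv> (\<Sum>n=1..M. real_of_int (z n) * lam n)"
    and "L \<equiv> ln (34 * R ^ 3 / \<gamma>)"
  assumes lam: "\<And>n. n \<ge> 1 \<Longrightarrow> \<bar>lam n - (real n)\<^sup>2\<bar> \<le> 1 / real n"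
    and \<gamma>: "0 < \<gamma>" "\<gamma> \<le> 1" and B: "0 \<le> B"
    and lower: "\<And>N (k::int). \<exists>n\<in>{1..N}. z n \<noteq> 0 \<Longrightarrow>
      \<bar>(\<Sum>n=1..N. real_of_int (z n) * lam n) + real_of_int k\<bar> \<ge>
      \<gamma> * exp (- B * log_weight z N) / (1 + (real_of_int k)\<^sup>2)"
    and R: "R = (\<Sum>n=1..M. \<bar>real_of_int (z n)\<bar>)"
    and N0: "1 \<le> N0" "N0 \<le> M" "z N0 \<noteq> 0" "\<And>n. n < N0 \<Longrightarrow> z n = 0"
  shows "\<bar>F\<bar> \<ge> exp (- (B + 4) * ((L + R * ln (2 * real N0)) * exp ((B + 5) * R)))"
proof -
  define A where "A = (\<lambda>N. L + log_weight z N)"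
  define T where "T = (\<lambda>N. \<Sum>n=Suc N0..N. \<bar>real_of_int (z n)\<bar>)"
  have zN0: "1 \<le> \<bar>real_of_int (z N0)\<bar>" using N0(3) by linarith
  have zR: "\<bar>real_of_int (z N0)\<bar> \<le> R"
    unfolding R using N0 by (intro member_le_sum[of N0 "{1..M}" "\<lambda>n. \<bar>real_of_int (z n)\<bar>"]) auto
  have R1: "1 \<le> R" using zN0 zR by linarith
  have TR: "T N \<le> R" if "N \<le> M" for N
    unfolding T_def R using that N0 by (intro sum_mono2) auto
  have R3: "1 \<le> R ^ 3" using R1 by simp
  have "34 * 1 \<le> 34 * R ^ 3 * (1 / \<gamma>)" using R3 \<gamma> R1 by (intro mult_mono) auto
  then have L34: "34 \<le> 34 * R ^ 3 / \<gamma>" by simp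
  have L2: "ln 2 \<le> L" unfolding L_def using L34 by (subst ln_le_cancel_iff) auto
  have AL: "L \<le> A N" for N unfolding A_def using log_weight_nonneg[of z N] by linarith
  have A0: "0 \<le> A N" for N using AL[of N] L2 by (smt (verit) ln_ge_zero_iff)
  have cut: "\<bar>F\<bar> \<ge> exp (- (B + 4) * A N)"
    if "N0 \<le> N" "N \<le> M" "\<And>n. N < n \<Longrightarrow> n \<le> M \<Longrightarrow> z n \<noteq> 0 \<Longrightarrow> real n \<ge> exp ((B + 4) * A N)" for N
    unfolding F_def A_def L_def
  proof (rule small_divisor_at_cutoff[OF lam \<gamma> B _ R R1 that(2)])
    show "\<gamma> * exp (- B * log_weight z N) / (1 + (real_of_int k)\<^sup>2)
         \<le> \<bar>(\<Sum>n=1..N. real_of_int (z n) * lam n) + real_of_int k\<bar>" for k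
      using N0 that(1) by (intro lower) auto
    show "exp ((B + 4) * (ln (34 * R ^ 3 / \<gamma>) + log_weight z N)) \<le> real n" if "N < n" "n \<le> M" "z n \<noteq> 0" for n
      using that \<open>\<And>n. N < n \<Longrightarrow> n \<le> M \<Longrightarrow> z n \<noteq> 0 \<Longrightarrow> real n \<ge> exp ((B + 4) * A N)\<close>
      unfolding A_def L_def by blast
  qed
  have AN0: "A N0 \<le> L + R * ln (2 * real N0)"
  proof -
    have "log_weight z N0 = (\<Sum>n\<in>{N0}. \<bar>real_of_int (z n)\<bar> * ln (2 * real n))"
      unfolding log_weight_def using N0 by (intro sum.mono_neutral_right) auto
    also have "\<dots> \<le> R * ln (2 * real N0)" using zR N0 by (simp add: mult_right_mono)
    finally show ?thesis unfolding A_def by simp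
  qed
  \<comment> \<open>The logarithmic size of the indices up to \<open>N\<close> has grown at most exponentially in the coefficients passed.\<close>
  define Q where "Q = (\<lambda>N. A N \<le> A N0 * exp ((B + 5) * T N))"
  have chain: "(\<exists>N\<in>{N0..M}. Q N \<and> \<bar>F\<bar> \<ge> exp (- (B + 4) * A N)) \<or> Q N" if "N0 \<le> N" "N \<le> M" for N
    using that
  proof (induction N rule: dec_induct)
    case base
    then show ?case by (simp add: Q_def T_def)
  next
    case (step N)
    show ?case
    proof (cases "\<exists>N\<in>{N0..M}. Q N \<and> \<bar>F\<bar> \<ge> exp (- (B + 4) * A N)")
      case False
      then have QN: "Q N" using step by auto
      have TS: "T (Suc N) = T N + \<bar>real_of_int (z (Suc N))\<bar>" unfolding T_def using step(1) by simp
      have "Q (Suc N)"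
      proof (cases "z (Suc N) = 0")
        case True
        then show ?thesis using QN TS unfolding Q_def A_def by (simp add: log_weight_Suc)
      next
        case nz: False
        let ?x = "\<bar>real_of_int (z (Suc N))\<bar>"
        have "\<not> (real (Suc N) \<ge> exp ((B + 4) * A N))"
        proof
          assume a: "real (Suc N) \<ge> exp ((B + 4) * A N)"
          have "\<bar>F\<bar> \<ge> exp (- (B + 4) * A N)"
          proof (rule cut)
            show "exp ((B + 4) * A N) \<le> real n" if "N < n" for n
              using that a by (smt (verit, best) Suc_leI of_nat_le_iff)
          qed (use step in auto)
          then show False using False QN step by auto
        qed
        then have "ln (real (Suc N)) < ln (exp ((B + 4) * A N))" by (subst ln_less_cancel_iff) auto
        then have "ln (2 * real (Suc N)) \<le> ln 2 + (B + 4) * A N" by (subst ln_mult) auto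
        also have "\<dots> \<le> (B + 5) * A N" using L2 AL[of N] by (simp add: algebra_simps)
        finally have l: "ln (2 * real (Suc N)) \<le> (B + 5) * A N" .
        have "A (Suc N) = A N + ?x * ln (2 * real (Suc N))" unfolding A_def by (simp add: log_weight_Suc)
        also have "\<dots> \<le> A N + ?x * ((B + 5) * A N)" by (intro add_left_mono mult_left_mono l) auto
        also have "\<dots> = A N * (1 + (B + 5) * ?x)" by (simp add: algebra_simps)
        also have "\<dots> \<le> A N * exp ((B + 5) * ?x)" by (intro mult_left_mono A0 exp_ge_add_one_self)
        also have "\<dots> \<le> A N0 * exp ((B + 5) * T N) * exp ((B + 5) * ?x)"
          using QN unfolding Q_def by (intro mult_right_mono) auto
        also have "\<dots> = A N0 * exp ((B + 5) * T (Suc N))"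
          unfolding TS distrib_left exp_add by simp
        finally show ?thesis unfolding Q_def .
      qed
      then show ?thesis by simp
    qed simp
  qed
  have "\<exists>N\<in>{N0..M}. Q N \<and> \<bar>F\<bar> \<ge> exp (- (B + 4) * A N)"
  proof (cases "\<exists>N\<in>{N0..M}. Q N \<and> \<bar>F\<bar> \<ge> exp (- (B + 4) * A N)")
    case False
    then have "Q M" using chain[of M] N0 by auto
    moreover have "\<bar>F\<bar> \<ge> exp (- (B + 4) * A M)" using N0 by (intro cut) auto
    ultimately show ?thesis using N0 by auto
  qed
  then obtain N where N: "N \<in> {N0..M}" "Q N" "\<bar>F\<bar> \<ge> exp (- (B + 4) * A N)" by blast
  have "A N \<le> A N0 * exp ((B + 5) * T N)" using N(2) unfolding Q_def .
  also have "\<dots> \<le> (L + R * ln (2 * real N0)) * exp ((B + 5) * R)"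
    using N(1) TR B A0[of N0] AN0 by (intro mult_mono) (auto intro!: mult_left_mono order.trans[OF A0[of N0]])
  finally have "(B + 4) * A N \<le> (B + 4) * ((L + R * ln (2 * real N0)) * exp ((B + 5) * R))"
    using B by (intro mult_left_mono) auto
  then have "exp (- (B + 4) * ((L + R * ln (2 * real N0)) * exp ((B + 5) * R))) \<le> exp (- (B + 4) * A N)"
    by (simp add: minus_mult_left[symmetric] del: minus_add_distrib)
  then show ?thesis using N(3) by linarith
qed

text \<open>Only the factor \<open>exp (\<alpha> * R)\<close> is available on the right-hand side, so the polynomial factors in \<open>R\<close>, the logarithm of
\<open>1 / \<gamma>\<close> and the constants are all absorbed in the choice of \<open>\<alpha>\<close>.\<close>

lemma exponent_bound:
  fixes B \<gamma> R y N0 :: real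
  assumes B: "0 \<le> B" and \<gamma>: "0 < \<gamma>" "\<gamma> \<le> 1" and R: "1 \<le> R" and y: "2 \<le> y" and N0: "1 \<le> N0" "2 * N0 \<le> y"
  shows "(B + 4) * ((ln (34 * R ^ 3 / \<gamma>) + R * ln (2 * N0)) * exp ((B + 5) * R))
     \<le> exp ((B + 6 + ln ((B + 4) * (75 + 2 * ln (1 / \<gamma>)))) * R) * ln y"
proof -
  define g where "g = ln (1 / \<gamma>)"
  define C where "C = (B + 4) * (75 + 2 * g)"
  have g: "0 \<le> g" unfolding g_def using \<gamma> by simp
  have "1 * 1 \<le> (B + 4) * (75 + 2 * g)" using B g by (intro mult_mono) auto
  then have C1: "1 \<le> C" by (simp add: C_def)
  have lny: "1 / 2 \<le> ln y"
  proof -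
    have "1 / 2 \<le> ln (2::real)" using ln_add_one_self_le_self2[of "- (1/2)"] by (simp add: ln_div)
    also have "\<dots> \<le> ln y" using y by simp
    finally show ?thesis .
  qed
  have "ln (34 * R ^ 3 / \<gamma>) = ln 34 + 3 * ln R + g"
    unfolding g_def using R \<gamma> by (simp add: ln_mult ln_div ln_realpow)
  also have "\<dots> \<le> 34 + 3 * R + g"
    using ln_bound[of 34] ln_bound[of R] R by simp
  also have "\<dots> \<le> (37 + g) * R" using R g mult_left_mono[of 1 R "34 + g"] by (simp add: algebra_simps)
  also have "\<dots> \<le> (37 + g) * R * (2 * ln y)"
    using mult_left_mono[of 1 "2 * ln y" "(37 + g) * R"] lny R g by simp
  finally have 1: "ln (34 * R ^ 3 / \<gamma>) \<le> (74 + 2 * g) * R * ln y" by (simp add: algebra_simps)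
  have "R * ln (2 * N0) \<le> R * ln y" using R N0 y by (intro mult_left_mono) auto
  with 1 have 2: "ln (34 * R ^ 3 / \<gamma>) + R * ln (2 * N0) \<le> (75 + 2 * g) * R * ln y"
    by (simp add: algebra_simps)
  have "(B + 4) * ((ln (34 * R ^ 3 / \<gamma>) + R * ln (2 * N0)) * exp ((B + 5) * R))
      \<le> (B + 4) * (((75 + 2 * g) * R * ln y) * exp ((B + 5) * R))"
    using B by (intro mult_left_mono mult_right_mono 2) auto
  also have "\<dots> = (C * R) * exp ((B + 5) * R) * ln y" by (simp add: C_def)
  also have "\<dots> \<le> (exp (ln C * R) * exp R) * exp ((B + 5) * R) * ln y"
  proof (intro mult_right_mono mult_mono)
    have "ln C * 1 \<le> ln C * R" using C1 R by (intro mult_left_mono) auto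
    then have "exp (ln C) \<le> exp (ln C * R)" by simp
    then show "C \<le> exp (ln C * R)" using C1 by simp
    show "R \<le> exp R" using exp_ge_add_one_self[of R] by linarith
  qed (use lny R in auto)
  also have "(exp (ln C * R) * exp R) * exp ((B + 5) * R) = exp ((B + 6 + ln C) * R)"
    by (simp add: exp_add[symmetric] algebra_simps)
  finally show ?thesis unfolding C_def g_def .
qed

theorem strongly_non_resonant_of_small_divisors:
  fixes lam :: "nat \<Rightarrow> real" and B \<gamma> :: real
  assumes lam: "\<And>n. n \<ge> 1 \<Longrightarrow> \<bar>lam n - (real n)\<^sup>2\<bar> \<le> 1 / real n"
    and \<gamma>: "0 < \<gamma>" "\<gamma> \<le> 1" and B: "0 \<le> B"
    and lower: "\<And>N z (k::int). \<exists>n\<in>{1..N}. z n \<noteq> 0 \<Longrightarrow>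
      \<bar>(\<Sum>n=1..N. real_of_int (z n) * lam n) + real_of_int k\<bar> \<ge>
      \<gamma> * exp (- B * log_weight z N) / (1 + (real_of_int k)\<^sup>2)"
  shows "strongly_non_resonant {1..} (\<lambda>k. lam (nat k))"
proof -
  define \<alpha> where "\<alpha> = B + 6 + ln ((B + 4) * (75 + 2 * ln (1 / \<gamma>)))"
  have "0 \<le> ln (1 / \<gamma>)" using \<gamma> by simp
  then have "1 * 1 \<le> (B + 4) * (75 + 2 * ln (1 / \<gamma>))" using B by (intro mult_mono) auto
  then have \<alpha>: "0 < \<alpha>" unfolding \<alpha>_def using B by (simp add: add_pos_nonneg)
  have "1 * (2 * (MIN j\<in>{1..q}. japanese_bracket (real_of_int (h j))))
          powr (- exp (\<alpha> * real_of_int (\<Sum>j=1..q. \<bar>m j\<bar>)))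
      \<le> \<bar>\<Sum>j=1..q. real_of_int (m j) * lam (nat (h j))\<bar>"
    if q: "1 \<le> q" and m: "\<forall>j\<in>{1..q}. m j \<noteq> 0" and h: "h ` {1..q} \<subseteq> {1..}" "inj_on h {1..q}"
    for q :: nat and m h :: "nat \<Rightarrow> int"
  proof -
    let ?J = "{1..q}"
    have h1: "1 \<le> h j" if "j \<in> ?J" for j using h(1) that unfolding image_subset_iff by (metis atLeast_iff)
    define f where "f = (\<lambda>j. nat (h j))"
    have inj: "inj_on f ?J"
      using h1 h(2) unfolding f_def inj_on_def by (metis int_nat_eq order_trans zero_le_one)
    define z where "z = (\<lambda>n. if n \<in> f ` ?J then m (inv_into ?J f n) else 0)"
    have zf: "z (f j) = m j" if "j \<in> ?J" for j
      using that inj by (simp add: z_def inv_into_f_f)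
    define M where "M = Max (f ` ?J)"
    define N0 where "N0 = Min (f ` ?J)"
    have ne: "f ` ?J \<noteq> {}" using q by simp
    have fM: "f ` ?J \<subseteq> {1..M}"
      using h1 by (auto simp: M_def f_def intro!: Max_ge) (metis One_nat_def nat_le_iff nat_mono nat_1 of_nat_1)
    have "N0 \<in> f ` ?J" unfolding N0_def using ne by (intro Min_in) auto
    then obtain j0 where j0: "j0 \<in> ?J" "N0 = f j0" by auto
    have S: "(\<Sum>n=1..M. g (z n) n) = (\<Sum>j\<in>?J. g (m j) (f j))" if "\<And>n. g 0 n = 0" for g :: "int \<Rightarrow> nat \<Rightarrow> real"
    proof -
      have "(\<Sum>n=1..M. g (z n) n) = (\<Sum>n\<in>f ` ?J. g (z n) n)"
        using fM by (intro sum.mono_neutral_right) (auto simp: z_def that)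
      also have "\<dots> = (\<Sum>j\<in>?J. g (z (f j)) (f j))" by (subst sum.reindex[OF inj]) (simp add: o_def)
      also have "\<dots> = (\<Sum>j\<in>?J. g (m j) (f j))" by (intro sum.cong) (auto simp: zf)
      finally show ?thesis .
    qed
    have F: "(\<Sum>n=1..M. real_of_int (z n) * lam n) = (\<Sum>j=1..q. real_of_int (m j) * lam (nat (h j)))"
      using S[of "\<lambda>a n. real_of_int a * lam n"] by (simp add: f_def)
    define R where "R = (\<Sum>n=1..M. \<bar>real_of_int (z n)\<bar>)"
    have Rm: "R = real_of_int (\<Sum>j=1..q. \<bar>m j\<bar>)"
      unfolding R_def using S[of "\<lambda>a n. \<bar>real_of_int a\<bar>"] by simp
    have zN0: "z N0 \<noteq> 0" using j0 zf m by auto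
    have "N0 \<in> {1..M}" using fM j0 by blast
    then have N0: "1 \<le> N0" "N0 \<le> M" by auto
    have "1 \<le> \<bar>real_of_int (z N0)\<bar>" using zN0 by linarith
    also have "\<dots> \<le> R"
      unfolding R_def using N0 by (intro member_le_sum[of N0 "{1..M}" "\<lambda>n. \<bar>real_of_int (z n)\<bar>"]) auto
    finally have R1: "1 \<le> R" .
    have zlow: "z n = 0" if "n < N0" for n
    proof -
      have "n \<notin> f ` ?J" using that Min_le[of "f ` ?J" n] unfolding N0_def by force
      then show ?thesis by (simp add: z_def)
    qed
    \<comment> \<open>The factor \<open>2\<close> keeps \<open>ln y\<close> away from \<open>0\<close>.\<close>
    define y where "y = 2 * (MIN j\<in>?J. japanese_bracket (real_of_int (h j)))"
    have "(MIN j\<in>?J. japanese_bracket (real_of_int (h j))) \<in> (\<lambda>j. japanese_bracket (real_of_int (h j))) ` ?J"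
      using q by (intro Min_in) auto
    then obtain j1 where j1: "j1 \<in> ?J" "y = 2 * japanese_bracket (real_of_int (h j1))"
      unfolding y_def by auto
    have "real N0 \<le> real (f j1)" unfolding N0_def using j1 by (intro of_nat_mono Min_le) auto
    also have "\<dots> = real_of_int (h j1)" using h1[OF j1(1)] by (simp add: f_def)
    also have "\<dots> \<le> japanese_bracket (real_of_int (h j1))"
      unfolding japanese_bracket_def by (intro real_le_rsqrt) simp
    finally have y: "2 * real N0 \<le> y" unfolding j1(2) by simp
    have y2: "2 \<le> y" using y N0 by linarith
    have "y powr (- exp (\<alpha> * R)) = exp (- (exp (\<alpha> * R) * ln y))"
      using y2 by (simp add: powr_def)
    also have "\<dots> \<le> exp (- (B + 4) * ((ln (34 * R ^ 3 / \<gamma>) + R * ln (2 * real N0)) * exp ((B + 5) * R)))"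
      using exponent_bound[OF B \<gamma> R1 y2 _ y] N0 unfolding \<alpha>_def exp_le_cancel_iff minus_mult_left[symmetric]
      by (subst neg_le_iff_le) simp
    also have "\<dots> \<le> \<bar>\<Sum>n=1..M. real_of_int (z n) * lam n\<bar>"
      by (rule small_divisor_chain[OF lam \<gamma> B lower R_def N0 zN0 zlow])
    finally show ?thesis unfolding F Rm y_def by simp
  qed
  then show ?thesis unfolding strongly_non_resonant_def using \<alpha>
    by (intro exI[of _ \<alpha>] conjI exI[of _ "1::real"] allI impI) auto
qed

section \<open>Resonances of a Gaussian potential are improbable\<close>

lemma measurable_potential_coeffs:
  "(\<lambda>a. potential_coeffs s a k) \<in> borel_measurable (PiM {1..} (\<lambda>_. borel))"
proof (cases "k = 0")
  case False
  have "(\<lambda>a. a k) \<in> borel_measurable (PiM {1..} (\<lambda>_. borel :: real measure))"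
    by (rule measurable_component_singleton) (use False in simp)
  then show ?thesis using False unfolding potential_coeffs_def by simp
qed (simp add: potential_coeffs_def)

definition resonant :: "real \<Rightarrow> real \<Rightarrow> real \<Rightarrow> nat \<Rightarrow> (nat \<Rightarrow> int) \<Rightarrow> int \<Rightarrow> (nat \<Rightarrow> real) \<Rightarrow> bool" where
  "resonant s \<delta> \<epsilon> N z k a \<longleftrightarrow> small_coeffs \<delta> (potential_coeffs s a) \<and>
     \<bar>(\<Sum>n=1..N. real_of_int (z n) * eigenvalue (potential_coeffs s a) n) + real_of_int k\<bar> < \<epsilon>"

lemma resonant_measurable:
  "{a \<in> space (PiM {1..} (\<lambda>_. borel)). resonant s \<delta> \<epsilon> N z k a} \<in> sets (PiM {1..} (\<lambda>_. borel))"
proof -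
  note [measurable] = measurable_potential_coeffs measurable_eigenvalue[OF measurable_potential_coeffs]
  show ?thesis unfolding resonant_def small_coeffs_def by measurable
qed

text \<open>Two resonant potentials that differ in the coefficient \<open>2 * i\<close> only cannot be far apart, since the combination of eigenvalues is
expanding in that coefficient.\<close>

lemma resonant_slice:
  assumes z: "\<exists>n\<in>{1..N}. z n \<noteq> 0" and \<delta>: "\<delta> \<le> 1 / 1000"
  obtains i where "i \<in> {1..N}" "z i \<noteq> 0"
    "\<And>a a'. resonant s \<delta> \<epsilon> N z k a \<Longrightarrow> resonant s \<delta> \<epsilon> N z k a' \<Longrightarrow> (\<forall>j. j \<noteq> 2 * i \<longrightarrow> a j = a' j) \<Longrightarrow>
       \<bar>a (2 * i) - a' (2 * i)\<bar> \<le> 16 * \<epsilon> / decay s (2 * i)"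
proof (rule combination_shift[OF z \<delta>])
  fix i assume i: "i \<in> {1..N}" "z i \<noteq> 0"
    and sh: "\<And>w w' \<tau>. small_coeffs \<delta> w \<Longrightarrow> small_coeffs \<delta> w' \<Longrightarrow>
       w' = (\<lambda>k. w k + (if k = 2 * i then \<tau> else 0)) \<Longrightarrow>
       \<bar>(\<Sum>n=1..N. z n * eigenvalue w' n) - (\<Sum>n=1..N. z n * eigenvalue w n)\<bar> \<ge> \<bar>\<tau>\<bar> / 8"
  show thesis
  proof (rule that[OF i])
    fix a a' assume r: "resonant s \<delta> \<epsilon> N z k a" "resonant s \<delta> \<epsilon> N z k a'" and eq: "\<forall>j. j \<noteq> 2 * i \<longrightarrow> a j = a' j"
    let ?w = "potential_coeffs s a'" and ?w' = "potential_coeffs s a"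
    let ?\<tau> = "(a (2 * i) - a' (2 * i)) * decay s (2 * i)"
    have e: "?w' = (\<lambda>k. ?w k + (if k = 2 * i then ?\<tau> else 0))"
      using eq i(1) by (auto simp: potential_coeffs_def fun_eq_iff algebra_simps)
    have w: "small_coeffs \<delta> ?w" "small_coeffs \<delta> ?w'" using r unfolding resonant_def by auto
    have "\<bar>?\<tau>\<bar> / 8 \<le> \<bar>(\<Sum>n=1..N. z n * eigenvalue ?w' n) - (\<Sum>n=1..N. z n * eigenvalue ?w n)\<bar>"
      by (rule sh[OF w e])
    also have "\<dots> \<le> 2 * \<epsilon>" using r unfolding resonant_def by linarith
    finally have "\<bar>a (2 * i) - a' (2 * i)\<bar> * decay s (2 * i) \<le> 16 * \<epsilon>"
      using decay_pos[of s "2 * i"] by (simp add: abs_mult)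
    then show "\<bar>a (2 * i) - a' (2 * i)\<bar> \<le> 16 * \<epsilon> / decay s (2 * i)"
      using decay_pos[of s "2 * i"] by (simp add: pos_le_divide_eq)
  qed
qed

lemma standard_normal_interval:
  assumes "distributed M lborel X (normal_density 0 1)" "0 \<le> D"
  shows "emeasure M {\<omega> \<in> space M. \<bar>X \<omega> - t\<bar> \<le> D} \<le> ennreal (2 * D)"
proof -
  have X: "X \<in> measurable M lborel" and d: "distr M lborel X = density lborel (normal_density 0 1)"
    using assms(1) by (auto simp: distributed_def)
  have "{\<omega> \<in> space M. \<bar>X \<omega> - t\<bar> \<le> D} = X -` {t - D..t + D} \<inter> space M" by (auto simp: abs_le_iff)
  then have "emeasure M {\<omega> \<in> space M. \<bar>X \<omega> - t\<bar> \<le> D} = emeasure (distr M lborel X) {t - D..t + D}"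
    using X by (simp add: emeasure_distr)
  also have "\<dots> = (\<integral>\<^sup>+x. ennreal (normal_density 0 1 x) * indicator {t - D..t + D} x \<partial>lborel)"
    unfolding d by (subst emeasure_density) auto
  also have "\<dots> \<le> (\<integral>\<^sup>+x. indicator {t - D..t + D} x \<partial>lborel)"
  proof (rule nn_integral_mono)
    fix x :: real
    have "1 \<le> sqrt (2 * pi)" using pi_gt3 by (intro real_le_rsqrt) simp
    moreover have "exp (- x\<^sup>2 / 2) \<le> 1" by simp
    ultimately have "normal_density 0 1 x \<le> 1 * 1"
      unfolding normal_density_def by (intro mult_mono) (auto simp: divide_le_eq)
    then have "ennreal (normal_density 0 1 x) \<le> 1" by (simp add: ennreal_le_1)
    then show "ennreal (normal_density 0 1 x) * indicator {t - D..t + D} x \<le> indicator {t - D..t + D} x"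
      by (auto simp: indicator_def)
  qed
  also have "\<dots> = ennreal (2 * D)" using assms(2) by simp
  finally show ?thesis .
qed

text \<open>The coordinate \<open>c\<close> is independent of all others. By Fubini's theorem, the probability is an average of probabilities that a
standard Gaussian variable falls in a set of diameter at most \<open>D\<close>.\<close>

lemma (in prob_space) thin_slices_probability:
  fixes X :: "nat \<Rightarrow> 'a \<Rightarrow> real"
  assumes dist: "\<And>k. k \<ge> 1 \<Longrightarrow> distributed M lborel (X k) (normal_density 0 1)"
    and indep: "indep_vars (\<lambda>_. borel) X {1..}" and c: "c \<ge> 1" and D: "0 \<le> D"
    and P: "{a \<in> space (PiM {1..} (\<lambda>_. borel)). P a} \<in> sets (PiM {1..} (\<lambda>_. borel))"
    and slices: "\<And>a a'. P a \<Longrightarrow> P a' \<Longrightarrow> (\<forall>k. k \<noteq> c \<longrightarrow> a k = a' k) \<Longrightarrow> \<bar>a c - a' c\<bar> \<le> D"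
  shows "emeasure M {\<omega> \<in> space M. P (\<lambda>k\<in>{1..}. X k \<omega>)} \<le> ennreal (2 * D)"
proof -
  let ?A = "{c}" and ?B = "{1..} - {c}"
  let ?S = "PiM ?A (\<lambda>_. borel :: real measure)" and ?T = "PiM ?B (\<lambda>_. borel :: real measure)"
  define p where "p = (\<lambda>\<omega>. restrict (\<lambda>i. X i \<omega>) ?A)"
  define q where "q = (\<lambda>\<omega>. restrict (\<lambda>i. X i \<omega>) ?B)"
  have "indep_var ?S p ?T q"
    unfolding p_def q_def by (rule indep_var_restrict[OF indep]) (use c in auto)
  then have rv: "p \<in> measurable M ?S" "q \<in> measurable M ?T"
    and pr: "distr M ?S p \<Otimes>\<^sub>M distr M ?T q = distr M (?S \<Otimes>\<^sub>M ?T) (\<lambda>\<omega>. (p \<omega>, q \<omega>))"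
    unfolding indep_var_distribution_eq by auto
  have AB: "?A \<union> ?B = {1..}" using c by auto
  \<comment> \<open>The event in terms of the two independent blocks of coordinates.\<close>
  define G where "G = {x \<in> space (?S \<Otimes>\<^sub>M ?T). P (merge ?A ?B x)}"
  have mm: "merge ?A ?B \<in> measurable (?S \<Otimes>\<^sub>M ?T) (PiM {1..} (\<lambda>_. borel))"
    using measurable_merge[of ?A ?B "\<lambda>_. borel :: real measure"] unfolding AB .
  have "G = merge ?A ?B -` {a \<in> space (PiM {1..} (\<lambda>_. borel)). P a} \<inter> space (?S \<Otimes>\<^sub>M ?T)"
    unfolding G_def using measurable_space[OF mm] by auto
  then have G: "G \<in> sets (?S \<Otimes>\<^sub>M ?T)" using measurable_sets[OF mm P] by simp
  have mg: "merge ?A ?B (p \<omega>, q \<omega>) = (\<lambda>k\<in>{1..}. X k \<omega>)" for \<omega>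
    using c by (auto simp: merge_def p_def q_def restrict_def fun_eq_iff)
  have pq: "(\<lambda>\<omega>. (p \<omega>, q \<omega>)) \<in> measurable M (?S \<Otimes>\<^sub>M ?T)" using rv by simp
  have "{\<omega> \<in> space M. P (\<lambda>k\<in>{1..}. X k \<omega>)} = {\<omega> \<in> space M. P (merge ?A ?B (p \<omega>, q \<omega>))}"
    by (simp only: mg)
  also have "\<dots> = (\<lambda>\<omega>. (p \<omega>, q \<omega>)) -` G \<inter> space M"
    unfolding G_def using measurable_space[OF pq] by auto
  finally have "{\<omega> \<in> space M. P (\<lambda>k\<in>{1..}. X k \<omega>)} = (\<lambda>\<omega>. (p \<omega>, q \<omega>)) -` G \<inter> space M" .
  then have e1: "emeasure M {\<omega> \<in> space M. P (\<lambda>k\<in>{1..}. X k \<omega>)} = emeasure (distr M ?S p \<Otimes>\<^sub>M distr M ?T q) G"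
    unfolding pr using emeasure_distr[OF pq G] by simp
  interpret D1: prob_space "distr M ?S p" by (rule prob_space_distr[OF rv(1)])
  interpret D2: prob_space "distr M ?T q" by (rule prob_space_distr[OF rv(2)])
  interpret PP: pair_sigma_finite "distr M ?S p" "distr M ?T q" ..
  have G': "G \<in> sets (distr M ?S p \<Otimes>\<^sub>M distr M ?T q)" using G by (simp cong: sets_pair_measure_cong)
  have sl: "emeasure (distr M ?S p) ((\<lambda>x. (x, y)) -` G) \<le> ennreal (2 * D)" for y
  proof (cases "(\<lambda>x. (x, y)) -` G = {}")
    case False
    then obtain x0 where x0: "(x0, y) \<in> G" by auto
    define R where "R = {x \<in> space ?S. \<bar>x c - x0 c\<bar> \<le> D}"
    have "(\<lambda>x. x c) \<in> borel_measurable ?S" by (rule measurable_component_singleton) simp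
    then have R: "R \<in> sets ?S" unfolding R_def by measurable
    have "(\<lambda>x. (x, y)) -` G \<subseteq> R"
    proof
      fix x assume "x \<in> (\<lambda>x. (x, y)) -` G"
      then have x: "(x, y) \<in> G" by simp
      have "\<bar>merge ?A ?B (x, y) c - merge ?A ?B (x0, y) c\<bar> \<le> D"
        by (rule slices) (use x x0 in \<open>auto simp: G_def merge_def\<close>)
      then show "x \<in> R" using x by (auto simp: R_def G_def merge_def space_pair_measure)
    qed
    then have "emeasure (distr M ?S p) ((\<lambda>x. (x, y)) -` G) \<le> emeasure (distr M ?S p) R"
      using R by (intro emeasure_mono) auto
    also have "\<dots> = emeasure M (p -` R \<inter> space M)" by (rule emeasure_distr[OF rv(1) R])
    also have "p -` R \<inter> space M = {\<omega> \<in> space M. \<bar>X c \<omega> - x0 c\<bar> \<le> D}"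
      using measurable_space[OF rv(1)] by (auto simp: R_def p_def)
    also have "emeasure M \<dots> \<le> ennreal (2 * D)" by (rule standard_normal_interval[OF dist[OF c] D])
    finally show ?thesis .
  qed simp
  have "emeasure (distr M ?S p \<Otimes>\<^sub>M distr M ?T q) G =
      (\<integral>\<^sup>+y. emeasure (distr M ?S p) ((\<lambda>x. (x, y)) -` G) \<partial>distr M ?T q)"
    by (rule PP.emeasure_pair_measure_alt2[OF G'])
  also have "\<dots> \<le> (\<integral>\<^sup>+y. ennreal (2 * D) \<partial>distr M ?T q)" by (intro nn_integral_mono sl)
  also have "\<dots> = ennreal (2 * D)" using D2.emeasure_space_1 by simp
  finally show ?thesis using e1 by simp
qed

lemma inverse_decay_le:
  assumes "0 \<le> s" "1 \<le> i" "i \<le> N" "z i \<noteq> 0"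
  shows "1 / decay s (2 * i) \<le> 2 powr s * exp (s * log_weight z N)"
proof -
  have "1 / decay s (2 * i) = japanese_bracket (real (2 * i)) powr s"
    unfolding decay_def by (simp add: powr_minus field_simps)
  also have "\<dots> \<le> (2 * (2 * real i)) powr s"
    using japanese_bracket_bounds(4)[of "real (2 * i)"] japanese_bracket_bounds(1)[of "real (2 * i)"] assms
    by (intro powr_mono2) auto
  also have "\<dots> = 2 powr s * exp (s * ln (2 * real i))"
    using assms by (subst powr_mult) (auto simp: powr_def)
  also have "\<dots> \<le> 2 powr s * exp (s * log_weight z N)"
    using ln_le_log_weight[of i N z, OF assms(2-4)] assms(1) by (intro mult_left_mono) (auto intro!: mult_left_mono)
  finally show ?thesis .
qed

lemma sum_symmetric_int:
  fixes f :: "nat \<Rightarrow> real"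
  shows "(\<Sum>j\<in>{- int L..int L}. f (nat \<bar>j\<bar>)) = f 0 + 2 * (\<Sum>j=1..L. f j)"
proof (induction L)
  case (Suc L)
  have "{- int (Suc L)..int (Suc L)} = insert (int (Suc L)) (insert (- int (Suc L)) {- int L..int L})" by auto
  moreover have "nat (1 + int L) = Suc L" by simp
  ultimately show ?case using Suc by (simp add: nat_add_distrib)
qed simp

lemma sum_powers_le:
  fixes x :: real
  assumes "0 \<le> x" "x \<le> 1 / 4"
  shows "(\<Sum>j=1..L. x ^ j) \<le> 2 * x"
proof -
  have "(\<Sum>j=1..L. x ^ j) \<le> 2 * x - 2 * x ^ Suc L"
  proof (induction L)
    case (Suc L)
    have "2 * x ^ Suc (Suc L) \<le> x ^ Suc L"
      using mult_right_mono[of "2 * x" 1 "x ^ Suc L"] assms by simp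
    then show ?case using Suc by simp
  qed simp
  also have "\<dots> \<le> 2 * x" using assms by simp
  finally show ?thesis .
qed

text \<open>The weight is a product over \<open>n\<close>, so the sum over all exponents factors; the factor of index \<open>n\<close> is \<open>1 + O(1 / n\<^sup>2)\<close>.\<close>

lemma sum_weights_le:
  "(\<Sum>z\<in>PiE {1..N} (\<lambda>_. {- int L..int L}). exp (- 2 * log_weight z N)) \<le> exp 2"
proof -
  let ?x = "\<lambda>n::nat. (1 / (2 * real n)\<^sup>2)"
  have e: "exp (- 2 * log_weight z N) = (\<Prod>n=1..N. ?x n ^ nat \<bar>z n\<bar>)" for z
  proof -
    have "exp (- 2 * log_weight z N) = (\<Prod>n=1..N. exp (- 2 * (\<bar>real_of_int (z n)\<bar> * ln (2 * real n))))"
      unfolding log_weight_def sum_distrib_left by (rule exp_sum) simp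
    also have "\<dots> = (\<Prod>n=1..N. ?x n ^ nat \<bar>z n\<bar>)"
    proof (rule prod.cong[OF refl])
      fix n assume n: "n \<in> {1..N}"
      have L: "ln (1 / y\<^sup>2) = - 2 * ln y" if "y > 0" for y :: real
        using that by (simp add: ln_div ln_realpow)
      have "ln (?x n) = - 2 * ln (2 * real n)" by (rule L) (use n in simp)
      moreover have "\<bar>real_of_int (z n)\<bar> = real (nat \<bar>z n\<bar>)" by simp
      ultimately have "exp (- 2 * (\<bar>real_of_int (z n)\<bar> * ln (2 * real n))) = exp (real (nat \<bar>z n\<bar>) * ln (?x n))"
        by simp
      also have "\<dots> = exp (ln (?x n)) ^ nat \<bar>z n\<bar>" by (rule exp_of_nat_mult)
      also have "\<dots> = ?x n ^ nat \<bar>z n\<bar>" using n by simp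
      finally show "exp (- 2 * (\<bar>real_of_int (z n)\<bar> * ln (2 * real n))) = ?x n ^ nat \<bar>z n\<bar>" .
    qed
    finally show ?thesis .
  qed
  have "(\<Sum>z\<in>PiE {1..N} (\<lambda>_. {- int L..int L}). exp (- 2 * log_weight z N))
      = (\<Prod>n=1..N. \<Sum>j\<in>{- int L..int L}. ?x n ^ nat \<bar>j\<bar>)"
    unfolding e by (rule prod_sum_PiE[symmetric]) auto
  also have "\<dots> \<le> (\<Prod>n=1..N. exp (1 / (real n)\<^sup>2))"
  proof (rule prod_mono, intro conjI)
    fix n assume n: "n \<in> {1..N}"
    have "1 \<le> (real n)\<^sup>2" using n by simp
    then have x: "0 \<le> ?x n" "?x n \<le> 1 / 4" "4 * ?x n = 1 / (real n)\<^sup>2"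
      by (auto simp: power_mult_distrib divide_le_eq)
    have "(\<Sum>j\<in>{- int L..int L}. ?x n ^ nat \<bar>j\<bar>) = 1 + 2 * (\<Sum>j=1..L. ?x n ^ j)"
      using sum_symmetric_int[of "\<lambda>j. ?x n ^ j" L] by simp
    also have "\<dots> \<le> 1 + 4 * ?x n" using sum_powers_le[OF x(1,2), of L] by simp
    also have "\<dots> \<le> exp (1 / (real n)\<^sup>2)" unfolding x(3) by (rule exp_ge_add_one_self)
    finally show "(\<Sum>j\<in>{- int L..int L}. ?x n ^ nat \<bar>j\<bar>) \<le> exp (1 / (real n)\<^sup>2)" .
    show "0 \<le> (\<Sum>j\<in>{- int L..int L}. ?x n ^ nat \<bar>j\<bar>)" by (intro sum_nonneg) simp
  qed
  also have "\<dots> = exp (\<Sum>n=1..N. 1 / (real n)\<^sup>2)" by (rule exp_sum[symmetric]) simp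
  also have "\<dots> \<le> exp 2" using sum_inverse_squares_le[of N] by simp
  finally show ?thesis .
qed

lemma sum_inverse_squares_int_le: "(\<Sum>k\<in>{- int L..int L}. 1 / (1 + (real_of_int k)\<^sup>2)) \<le> 5"
proof -
  have "(\<Sum>k\<in>{- int L..int L}. 1 / (1 + (real_of_int k)\<^sup>2)) = (\<Sum>k\<in>{- int L..int L}. 1 / (1 + (real (nat \<bar>k\<bar>))\<^sup>2))"
    by (intro sum.cong) auto
  also have "\<dots> = 1 + 2 * (\<Sum>k=1..L. 1 / (1 + (real k)\<^sup>2))"
    using sum_symmetric_int[of "\<lambda>k. 1 / (1 + (real k)\<^sup>2)" L] by simp
  also have "(\<Sum>k=1..L. 1 / (1 + (real k)\<^sup>2)) \<le> (\<Sum>k=1..L. 1 / (real k)\<^sup>2)"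
    by (intro sum_mono divide_left_mono) (auto simp: add_pos_nonneg)
  also have "\<dots> \<le> 2" by (rule sum_inverse_squares_le)
  finally show ?thesis by simp
qed

context prob_space
begin

context
  fixes X :: "nat \<Rightarrow> 'a \<Rightarrow> real" and s \<delta> :: real
  assumes dist: "\<And>k. k \<ge> 1 \<Longrightarrow> distributed M lborel (X k) (normal_density 0 1)"
    and indep: "indep_vars (\<lambda>_. borel) X {1..}" and s: "s > 3 / 2" and \<delta>: "\<delta> \<le> 1 / 1000"
begin

text \<open>The exponent \<open>s + 2\<close> has two parts: \<open>s\<close> pays for the factor \<open>\<langle>2 * i\<rangle> powr s\<close> by which \<open>X (2 * i)\<close> is
damped in the potential, and \<open>2\<close> makes the sum over all \<open>z\<close> converge.\<close>

definition resonance_bound :: "real \<Rightarrow> nat \<Rightarrow> (nat \<Rightarrow> int) \<Rightarrow> int \<Rightarrow> real" where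
  "resonance_bound \<gamma> N z k = \<gamma> * exp (- (s + 2) * log_weight z N) / (1 + (real_of_int k)\<^sup>2)"

definition resonant_event :: "real \<Rightarrow> nat \<Rightarrow> (nat \<Rightarrow> int) \<Rightarrow> int \<Rightarrow> 'a set" where
  "resonant_event \<gamma> N z k = {\<omega> \<in> space M. resonant s \<delta> (resonance_bound \<gamma> N z k) N z k (\<lambda>k\<in>{1..}. X k \<omega>)}"

lemma resonant_event_measurable: "resonant_event \<gamma> N z k \<in> sets M"
proof -
  have "X k \<in> borel_measurable M" if "k \<ge> 1" for k
    using dist[OF that] by (simp add: distributed_def)
  then have m: "(\<lambda>\<omega>. \<lambda>k\<in>{1..}. X k \<omega>) \<in> measurable M (PiM {1..} (\<lambda>_. borel))"
    by (intro measurable_restrict) auto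
  show ?thesis
    unfolding resonant_event_def
    using measurable_sets[OF m resonant_measurable[of s \<delta> "resonance_bound \<gamma> N z k" N z k]] measurable_space[OF m]
    by (auto simp: vimage_def Int_def conj_commute cong: conj_cong)
qed

lemma resonant_event_prob:
  assumes z: "\<exists>n\<in>{1..N}. z n \<noteq> 0" and \<gamma>: "0 \<le> \<gamma>"
  shows "prob (resonant_event \<gamma> N z k) \<le> 32 * 2 powr s * \<gamma> * (exp (- 2 * log_weight z N) * (1 / (1 + (real_of_int k)\<^sup>2)))"
proof -
  let ?\<epsilon> = "resonance_bound \<gamma> N z k"
  have k0: "0 < 1 + (real_of_int k)\<^sup>2" by (simp add: add_pos_nonneg)
  have \<epsilon>: "0 \<le> ?\<epsilon>" unfolding resonance_bound_def using \<gamma> k0 by simp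
  obtain i where i: "i \<in> {1..N}" "z i \<noteq> 0" and sl:
    "\<And>a a'. resonant s \<delta> ?\<epsilon> N z k a \<Longrightarrow> resonant s \<delta> ?\<epsilon> N z k a' \<Longrightarrow> (\<forall>j. j \<noteq> 2 * i \<longrightarrow> a j = a' j) \<Longrightarrow>
       \<bar>a (2 * i) - a' (2 * i)\<bar> \<le> 16 * ?\<epsilon> / decay s (2 * i)"
    using resonant_slice[OF z \<delta>, of s ?\<epsilon> k] by blast
  have D: "0 \<le> 16 * ?\<epsilon> / decay s (2 * i)" using \<epsilon> decay_pos[of s "2 * i"] by simp
  have "emeasure M (resonant_event \<gamma> N z k) \<le> ennreal (2 * (16 * ?\<epsilon> / decay s (2 * i)))"
    unfolding resonant_event_def
    by (rule thin_slices_probability[OF dist indep _ D resonant_measurable sl]) (use i in auto)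
  then have "prob (resonant_event \<gamma> N z k) \<le> 2 * (16 * ?\<epsilon> / decay s (2 * i))"
    using D by (simp add: emeasure_eq_measure)
  also have "\<dots> = 32 * ?\<epsilon> * (1 / decay s (2 * i))" by simp
  also have "\<dots> \<le> 32 * ?\<epsilon> * (2 powr s * exp (s * log_weight z N))"
    using i s \<epsilon> by (intro mult_left_mono inverse_decay_le) auto
  also have "\<dots> = 32 * 2 powr s * \<gamma> * (exp (- (s + 2) * log_weight z N) * exp (s * log_weight z N) * (1 / (1 + (real_of_int k)\<^sup>2)))"
    unfolding resonance_bound_def by simp
  also have "exp (- (s + 2) * log_weight z N) * exp (s * log_weight z N) = exp (- 2 * log_weight z N)"
    unfolding exp_add[symmetric] by (simp add: algebra_simps)
  finally show ?thesis .
qed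

text \<open>The exponents and the integer are cut off at \<open>N\<close>, which keeps the union finite; the unions increase with \<open>N\<close>.\<close>

definition resonance_union :: "real \<Rightarrow> nat \<Rightarrow> 'a set" where
  "resonance_union \<gamma> N = (\<Union>(z, k)\<in>{z \<in> PiE {1..N} (\<lambda>_. {- int N..int N}). \<exists>n\<in>{1..N}. z n \<noteq> 0} \<times> {- int N..int N}.
      resonant_event \<gamma> N z k)"

lemma finite_exponents: "finite (PiE {1..N::nat} (\<lambda>_. {- int L..int L}))"
  by (intro finite_PiE) auto

lemma resonance_union_prob:
  assumes \<gamma>: "0 \<le> \<gamma>"
  shows "resonance_union \<gamma> N \<in> sets M" "prob (resonance_union \<gamma> N) \<le> 160 * 2 powr s * exp 2 * \<gamma>"
proof -
  let ?P = "PiE {1..N} (\<lambda>_. {- int N..int N})"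
  let ?Z = "{z \<in> ?P. \<exists>n\<in>{1..N}. z n \<noteq> 0}"
  let ?K = "{- int N..int N}"
  have fin: "finite (?Z \<times> ?K)" using finite_exponents[of N N] by simp
  show "resonance_union \<gamma> N \<in> sets M"
    unfolding resonance_union_def using fin resonant_event_measurable by (intro sets.finite_UN) auto
  let ?c = "32 * 2 powr s * \<gamma>"
  have "prob (resonance_union \<gamma> N) \<le> (\<Sum>(z, k)\<in>?Z \<times> ?K. prob (resonant_event \<gamma> N z k))"
    unfolding resonance_union_def case_prod_unfold
    by (rule finite_measure_subadditive_finite[OF fin]) (use resonant_event_measurable in auto)
  also have "\<dots> \<le> (\<Sum>(z, k)\<in>?Z \<times> ?K. ?c * (exp (- 2 * log_weight z N) * (1 / (1 + (real_of_int k)\<^sup>2))))"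
    using resonant_event_prob[OF _ \<gamma>] by (intro sum_mono) auto
  also have "\<dots> = ?c * ((\<Sum>z\<in>?Z. exp (- 2 * log_weight z N)) * (\<Sum>k\<in>?K. 1 / (1 + (real_of_int k)\<^sup>2)))"
  proof -
    have "(\<Sum>z\<in>?Z. exp (- 2 * log_weight z N)) * (\<Sum>k\<in>?K. 1 / (1 + (real_of_int k)\<^sup>2)) =
      (\<Sum>(z, k)\<in>?Z \<times> ?K. exp (- 2 * log_weight z N) * (1 / (1 + (real_of_int k)\<^sup>2)))"
      unfolding sum_product sum.cartesian_product ..
    note e = this
    show ?thesis unfolding e by (simp only: sum_distrib_left case_prod_unfold)
  qed
  also have "\<dots> \<le> ?c * (exp 2 * 5)"
  proof (intro mult_left_mono mult_mono)
    have "(\<Sum>z\<in>?Z. exp (- 2 * log_weight z N)) \<le> (\<Sum>z\<in>?P. exp (- 2 * log_weight z N))"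
      by (intro sum_mono2 finite_exponents) auto
    also have "\<dots> \<le> exp 2" by (rule sum_weights_le)
    finally show "(\<Sum>z\<in>?Z. exp (- 2 * log_weight z N)) \<le> exp 2" .
  qed (use \<gamma> sum_inverse_squares_int_le in \<open>auto intro!: sum_nonneg simp: add_nonneg_nonneg\<close>)
  finally show "prob (resonance_union \<gamma> N) \<le> 160 * 2 powr s * exp 2 * \<gamma>" by (simp add: mult_ac)
qed

lemma resonance_union_mono: "resonance_union \<gamma> N \<subseteq> resonance_union \<gamma> (Suc N)"
proof
  fix \<omega> assume "\<omega> \<in> resonance_union \<gamma> N"
  then obtain zk where zk: "zk \<in> {z \<in> PiE {1..N} (\<lambda>_. {- int N..int N}). \<exists>n\<in>{1..N}. z n \<noteq> 0} \<times> {- int N..int N}"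
    "\<omega> \<in> resonant_event \<gamma> N (fst zk) (snd zk)"
    unfolding resonance_union_def case_prod_unfold by blast
  define z k where "z = fst zk" and "k = snd zk"
  have z: "z \<in> PiE {1..N} (\<lambda>_. {- int N..int N})" "\<exists>n\<in>{1..N}. z n \<noteq> 0" "k \<in> {- int N..int N}"
    using zk(1) unfolding mem_Times_iff z_def k_def by blast+
  have r: "\<omega> \<in> resonant_event \<gamma> N z k" using zk(2) unfolding z_def k_def .
  define z' where "z' = z(Suc N := 0)"
  have eq: "z' n = z n" if "n \<in> {1..N}" for n using that by (simp add: z'_def)
  have lw: "log_weight z' (Suc N) = log_weight z N"
    unfolding log_weight_Suc unfolding log_weight_def by (simp add: z'_def)
  have F: "(\<Sum>n=1..Suc N. real_of_int (z' n) * g n) = (\<Sum>n=1..N. real_of_int (z n) * g n)" for g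
    by (simp add: z'_def)
  have "\<omega> \<in> resonant_event \<gamma> (Suc N) z' k"
    using r unfolding resonant_event_def resonant_def resonance_bound_def lw F .
  moreover have "z' \<in> PiE {1..Suc N} (\<lambda>_. {- int (Suc N)..int (Suc N)})"
  proof (rule PiE_I)
    fix n assume n: "n \<in> {1..Suc N}"
    show "z' n \<in> {- int (Suc N)..int (Suc N)}"
    proof (cases "n = Suc N")
      case False
      then have "z n \<in> {- int N..int N}" using n by (intro PiE_mem[OF z(1)]) auto
      then show ?thesis using False by (simp add: z'_def)
    qed (simp add: z'_def)
  next
    fix n assume "n \<notin> {1..Suc N}"
    then have "n \<notin> {1..N}" "n \<noteq> Suc N" by auto
    then show "z' n = undefined" using PiE_arb[OF z(1), of n] by (simp add: z'_def)
  qed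
  moreover have "\<exists>n\<in>{1..Suc N}. z' n \<noteq> 0" using z(2) eq by force
  moreover have "k \<in> {- int (Suc N)..int (Suc N)}" using z(3) by auto
  ultimately show "\<omega> \<in> resonance_union \<gamma> (Suc N)" unfolding resonance_union_def by blast
qed

lemma AE_nonresonant:
  "AE \<omega> in M. \<exists>\<gamma>>0. \<gamma> \<le> 1 \<and> (\<forall>N. \<omega> \<notin> resonance_union \<gamma> N)"
proof -
  \<comment> \<open>Countably many values of \<open>\<gamma>\<close>; the resonant set of each has probability of order \<open>\<gamma>\<close>.\<close>
  define g where "g = (\<lambda>j::nat. 1 / real (Suc j))"
  define U where "U = (\<lambda>j. \<Union>N. resonance_union (g j) N)"
  let ?C = "160 * 2 powr s * exp 2"
  have Us: "U j \<in> sets M" for j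
    unfolding U_def using resonance_union_prob(1)[of "g j"] by (intro sets.countable_UN) (auto simp: g_def)
  have UP: "prob (U j) \<le> ?C * g j" for j
  proof -
    have g0: "0 \<le> g j" by (simp add: g_def)
    have "(\<lambda>N. prob (resonance_union (g j) N)) \<longlonglongrightarrow> prob (U j)"
      unfolding U_def using resonance_union_prob(1)[OF g0] resonance_union_mono
      by (intro finite_Lim_measure_incseq) (auto intro!: incseq_SucI)
    then show ?thesis by (rule LIMSEQ_le_const2) (use resonance_union_prob(2)[OF g0] in blast)
  qed
  have I: "(\<Inter>j. U j) \<in> sets M" using Us by (intro sets.countable_INT) auto
  have le: "prob (\<Inter>j. U j) \<le> ?C * g j" for j
    using finite_measure_mono[of "\<Inter>j. U j" "U j"] Us UP[of j] by (meson INT_lower UNIV_I order_trans)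
  have lim: "(\<lambda>j. ?C * g j) \<longlonglongrightarrow> ?C * 0"
    using LIMSEQ_inverse_real_of_nat unfolding g_def inverse_eq_divide by (intro tendsto_mult tendsto_const)
  have "prob (\<Inter>j. U j) \<le> ?C * 0" by (rule LIMSEQ_le_const[OF lim]) (use le in blast)
  then have "prob (\<Inter>j. U j) = 0" by (intro antisym) auto
  then have "(\<Inter>j. U j) \<in> null_sets M" using I by (auto simp: null_sets_def emeasure_eq_measure)
  then have "AE \<omega> in M. \<omega> \<notin> (\<Inter>j. U j)" by (rule AE_not_in)
  then show ?thesis
  proof eventually_elim
    case (elim \<omega>)
    then obtain j where "\<omega> \<notin> U j" by auto
    then show ?case unfolding U_def by (intro exI[of _ "g j"]) (auto simp: g_def)
  qed
qed

text \<open>Padding \<open>z\<close> by zeros changes neither the combination nor its weight, so every \<open>z\<close> and \<open>k\<close> is covered by a large enough cut-off.\<close>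

lemma nonresonant_imp_lower_bound:
  assumes \<omega>: "\<omega> \<in> space M" "\<forall>N. \<omega> \<notin> resonance_union \<gamma> N"
    and w: "small_coeffs \<delta> (potential_coeffs s (\<lambda>k. X k \<omega>))" and z: "\<exists>n\<in>{1..N}. z n \<noteq> 0"
  shows "\<bar>(\<Sum>n=1..N. real_of_int (z n) * eigenvalue (potential_coeffs s (\<lambda>k. X k \<omega>)) n) + real_of_int k\<bar> \<ge>
      \<gamma> * exp (- (s + 2) * log_weight z N) / (1 + (real_of_int k)\<^sup>2)"
proof -
  have pc: "potential_coeffs s (\<lambda>k\<in>{1..}. X k \<omega>') = potential_coeffs s (\<lambda>k. X k \<omega>')" for \<omega>'
    by (auto simp: potential_coeffs_def fun_eq_iff)
  define Q where "Q = Max ((\<lambda>n. nat \<bar>z n\<bar>) ` {1..N} \<union> {N, nat \<bar>k\<bar>})"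
  have mem: "x \<le> Q" if "x \<in> (\<lambda>n. nat \<bar>z n\<bar>) ` {1..N} \<union> {N, nat \<bar>k\<bar>}" for x
    unfolding Q_def using that by (intro Max_ge) auto
  have Q: "N \<le> Q" "nat \<bar>k\<bar> \<le> Q" "\<And>n. n \<in> {1..N} \<Longrightarrow> nat \<bar>z n\<bar> \<le> Q"
    by (rule mem, simp, rule mem, simp, rule mem, blast)
  define z' where "z' = (\<lambda>n\<in>{1..Q}. if n \<le> N then z n else 0)"
  have lw: "log_weight z' Q = log_weight z N"
    unfolding log_weight_def using Q(1) by (intro sum.mono_neutral_cong_right) (auto simp: z'_def)
  have F: "(\<Sum>n=1..Q. real_of_int (z' n) * g n) = (\<Sum>n=1..N. real_of_int (z n) * g n)" for g
    using Q(1) by (intro sum.mono_neutral_cong_right) (auto simp: z'_def)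
  have "z' n \<in> {- int Q..int Q}" if "n \<in> {1..Q}" for n
    using Q(3)[of n] that by (auto simp: z'_def abs_le_iff nat_le_iff)
  then have "z' \<in> PiE {1..Q} (\<lambda>_. {- int Q..int Q})" unfolding z'_def by (auto simp: PiE_iff)
  moreover have "\<exists>n\<in>{1..Q}. z' n \<noteq> 0" using z Q(1) by (force simp: z'_def)
  moreover have "k \<in> {- int Q..int Q}" using Q(2) by auto
  ultimately have "\<omega> \<notin> resonant_event \<gamma> Q z' k" using \<omega>(2) unfolding resonance_union_def by blast
  then show ?thesis
    using \<omega>(1) w unfolding resonant_event_def resonant_def resonance_bound_def lw F pc by (auto simp: not_less)
qed

text \<open>The expectations of \<open>\<bar>X k\<bar>\<close> all coincide and are finite, and \<open>s > 1\<close>.\<close>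

lemma AE_coeffs_summable: "AE \<omega> in M. summable (\<lambda>k. \<bar>potential_coeffs s (\<lambda>k. X k \<omega>) k\<bar>)"
proof -
  define C where "C = (\<integral>\<^sup>+x. ennreal (normal_density 0 1 x) * ennreal \<bar>x\<bar> \<partial>lborel)"
  have C: "C < \<infinity>"
  proof -
    have "integrable lborel (\<lambda>x. normal_density 0 1 x * \<bar>x\<bar>)"
      using integrable_std_normal_moment_abs[of 1] by simp
    then have "(\<integral>\<^sup>+x. ennreal (norm (normal_density 0 1 x * \<bar>x\<bar>)) \<partial>lborel) < \<infinity>"
      by (simp add: integrable_iff_bounded)
    then show ?thesis unfolding C_def by (simp add: abs_mult ennreal_mult'')
  qed
  let ?f = "\<lambda>k \<omega>. ennreal \<bar>potential_coeffs s (\<lambda>k. X k \<omega>) k\<bar>"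
  have Xm: "X k \<in> borel_measurable M" if "k \<ge> 1" for k
    using dist[OF that] by (simp add: distributed_def)
  have m: "?f k \<in> borel_measurable M" for k
    using Xm[of k] by (cases "k = 0") (simp_all add: potential_coeffs_def)
  have i: "(\<integral>\<^sup>+\<omega>. ?f k \<omega> \<partial>M) \<le> ennreal (decay s k) * C" for k
  proof (cases "k = 0")
    case False
    then have k: "k \<ge> 1" by simp
    have "(\<integral>\<^sup>+\<omega>. ?f k \<omega> \<partial>M) = (\<integral>\<^sup>+\<omega>. ennreal (decay s k) * ennreal \<bar>X k \<omega>\<bar> \<partial>M)"
      using False decay_pos[of s k]
      by (intro nn_integral_cong) (simp add: potential_coeffs_def abs_mult ennreal_mult' mult.commute)
    also have "\<dots> = ennreal (decay s k) * (\<integral>\<^sup>+\<omega>. ennreal \<bar>X k \<omega>\<bar> \<partial>M)"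
      using Xm[OF k] by (intro nn_integral_cmult) auto
    also have "(\<integral>\<^sup>+\<omega>. ennreal \<bar>X k \<omega>\<bar> \<partial>M) = C"
      unfolding C_def using distributed_nn_integral[OF dist[OF k], of "\<lambda>x. ennreal \<bar>x\<bar>"] by simp
    finally show ?thesis by simp
  qed (simp add: potential_coeffs_def)
  have "(\<integral>\<^sup>+\<omega>. (\<Sum>k. ?f k \<omega>) \<partial>M) = (\<Sum>k. \<integral>\<^sup>+\<omega>. ?f k \<omega> \<partial>M)" by (rule nn_integral_suminf[OF m])
  also have "\<dots> \<le> (\<Sum>k. ennreal (decay s k) * C)" by (intro suminf_le i) auto
  also have "\<dots> = (\<Sum>k. ennreal (decay s k)) * C" by (rule ennreal_suminf_multc)
  also have "(\<Sum>k. ennreal (decay s k)) = ennreal (suminf (decay s))"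
    using decay_summable[of s] s decay_pos by (intro suminf_ennreal2) (auto intro: less_imp_le)
  also have "ennreal (suminf (decay s)) * C < \<infinity>" using C by (simp add: ennreal_mult_less_top)
  finally have "(\<integral>\<^sup>+\<omega>. (\<Sum>k. ?f k \<omega>) \<partial>M) \<noteq> \<infinity>" by simp
  then have "AE \<omega> in M. (\<Sum>k. ?f k \<omega>) \<noteq> \<infinity>"
    by (intro nn_integral_PInf_AE borel_measurable_suminf_order m)
  then show ?thesis
    by eventually_elim (rule summable_suminf_not_top, auto)
qed

end
end

section \<open>Strong non-resonance of the Dirichlet spectrum\<close>

lemma strongly_non_resonant_cong:
  assumes "strongly_non_resonant I \<omega>" "\<And>k. k \<in> I \<Longrightarrow> \<omega> k = \<omega>' k"
  shows "strongly_non_resonant I \<omega>'"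
proof -
  have "(\<Sum>j=1..q. real_of_int (m j) * \<omega> (h j)) = (\<Sum>j=1..q. real_of_int (m j) * \<omega>' (h j))"
    if "h ` {1..q} \<subseteq> I" for q m and h :: "nat \<Rightarrow> int"
  proof (rule sum.cong[OF refl])
    fix j assume "j \<in> {1..q}"
    then have "h j \<in> I" using that by blast
    then show "real_of_int (m j) * \<omega> (h j) = real_of_int (m j) * \<omega>' (h j)" using assms(2) by simp
  qed
  note sums = this
  obtain \<alpha> \<rho> where pos: "\<alpha> > 0" "\<rho> > 0" and bound: "\<forall>q\<ge>1. \<forall>m :: nat \<Rightarrow> int. \<forall>h :: nat \<Rightarrow> int.
        (\<forall>j\<in>{1..q}. m j \<noteq> 0) \<longrightarrow> (\<Sum>j=1..q. m j) = 0 \<longrightarrow> h ` {1..q} \<subseteq> I \<longrightarrow> inj_on h {1..q} \<longrightarrow>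
        \<bar>\<Sum>j=1..q. real_of_int (m j) * \<omega> (h j)\<bar> \<ge>
          \<rho> * (2 * (MIN j\<in>{1..q}. japanese_bracket (real_of_int (h j))))
                powr (- exp (\<alpha> * real_of_int (\<Sum>j=1..q. \<bar>m j\<bar>)))"
    using assms(1) unfolding strongly_non_resonant_def by blast
  show ?thesis
    unfolding strongly_non_resonant_def
  proof (intro exI conjI allI impI)
    fix q :: nat and m h :: "nat \<Rightarrow> int"
    assume "1 \<le> q" "\<forall>j\<in>{1..q}. m j \<noteq> 0" "(\<Sum>j=1..q. m j) = 0" and h: "h ` {1..q} \<subseteq> I" and "inj_on h {1..q}"
    then show "\<rho> * (2 * (MIN j\<in>{1..q}. japanese_bracket (real_of_int (h j))))
                powr (- exp (\<alpha> * real_of_int (\<Sum>j=1..q. \<bar>m j\<bar>)))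
        \<le> \<bar>\<Sum>j=1..q. real_of_int (m j) * \<omega>' (h j)\<bar>"
      unfolding sums[OF h, of m, symmetric] using bound by blast
  qed (use pos in auto)
qed

theorem proposition1p8:
  fixes M :: "'a measure" and X :: "nat \<Rightarrow> 'a \<Rightarrow> real" and s :: real
    and W :: "'a \<Rightarrow> real \<Rightarrow> real"
  assumes "prob_space M"
    and "s > 3 / 2"
    and "\<And>k. k \<ge> 1 \<Longrightarrow> distributed M lborel (X k) (normal_density 0 1)"
    and "prob_space.indep_vars M (\<lambda>_. borel) X {1..}"
    and "\<And>w. W w = potential s (\<lambda>k. X k w)"
  shows "\<exists>\<eta>>0. AE w in M.
           W w \<in> H1_torus \<and> H1_torus_norm (W w) \<le> \<eta> \<longrightarrow>
           strongly_non_resonant {1..} (\<lambda>k. dirichlet_eigenvalue (W w) (nat k))"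
proof -
  interpret prob_space M by (rule assms(1))
  \<comment> \<open>Coefficients bounded by \<open>\<delta> = 1 / 1000\<close> suffice for the contraction and for Schur's test.\<close>
  define \<eta> :: real where "\<eta> = 1 / 4000"
  define \<delta> :: real where "\<delta> = 4 * \<eta>"
  have \<eta>: "\<eta> > 0" and \<delta>: "\<delta> \<le> 1 / 1000" by (simp_all add: \<eta>_def \<delta>_def)
  have nonresonant: "AE \<omega> in M. \<exists>\<gamma>>0. \<gamma> \<le> 1 \<and> (\<forall>N. \<omega> \<notin> resonance_union X s \<delta> \<gamma> N)"
    by (rule AE_nonresonant[OF _ assms(4,2) \<delta>]) (rule assms(3))
  have summable: "AE \<omega> in M. summable (\<lambda>k. \<bar>potential_coeffs s (\<lambda>k. X k \<omega>) k\<bar>)"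
    by (rule AE_coeffs_summable[OF _ assms(4,2) \<delta>]) (rule assms(3))
  have "AE \<omega> in M. W \<omega> \<in> H1_torus \<and> H1_torus_norm (W \<omega>) \<le> \<eta> \<longrightarrow>
           strongly_non_resonant {1..} (\<lambda>k. dirichlet_eigenvalue (W \<omega>) (nat k))"
    using nonresonant summable AE_space
  proof eventually_elim
    case (elim \<omega>)
    let ?w = "potential_coeffs s (\<lambda>k. X k \<omega>)"
    show ?case
    proof (intro impI, elim conjE)
      assume H: "W \<omega> \<in> H1_torus" "H1_torus_norm (W \<omega>) \<le> \<eta>"
      have W: "W \<omega> = cosine_series ?w"
        unfolding assms(5) by (rule potential_eq_cosine_series[OF elim(2)])
      have w: "small_coeffs \<delta> ?w"
        unfolding \<delta>_def
        by (rule small_coeffs_of_H1[OF elim(2) _ \<eta> H[unfolded W]]) (simp add: potential_coeffs_def)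
      have spec: "is_dirichlet_spectrum (W \<omega>) (eigenvalue ?w)"
        unfolding W by (rule dirichlet_spectrum_small_potential[OF w \<delta>])
      obtain \<gamma> where \<gamma>: "\<gamma> > 0" "\<gamma> \<le> 1" "\<forall>N. \<omega> \<notin> resonance_union X s \<delta> \<gamma> N" using elim(1) by blast
      have "strongly_non_resonant {1..} (\<lambda>k. eigenvalue ?w (nat k))"
      proof (rule strongly_non_resonant_of_small_divisors[OF _ \<gamma>(1,2), of _ "s + 2"])
        fix n :: nat assume n: "n \<ge> 1"
        have "\<bar>eigenvalue ?w n - (real n)\<^sup>2\<bar> \<le> \<delta> / real n"
          using eigenvalue_asymptotics[OF w _ n] \<delta> by simp
        also have "\<dots> \<le> 1 / real n" using \<delta> by (intro divide_right_mono) auto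
        finally show "\<bar>eigenvalue ?w n - (real n)\<^sup>2\<bar> \<le> 1 / real n" .
      next
        show "0 \<le> s + 2" using assms(2) by simp
        show "\<gamma> * exp (- (s + 2) * log_weight z N) / (1 + (real_of_int k)\<^sup>2)
            \<le> \<bar>(\<Sum>n=1..N. real_of_int (z n) * eigenvalue ?w n) + real_of_int k\<bar>"
          if "\<exists>n\<in>{1..N}. z n \<noteq> 0" for N z k
          by (rule nonresonant_imp_lower_bound[OF _ assms(4,2) \<delta> elim(3) \<gamma>(3) w that]) (rule assms(3))
      qed
      then show "strongly_non_resonant {1..} (\<lambda>k. dirichlet_eigenvalue (W \<omega>) (nat k))"
        by (rule strongly_non_resonant_cong) (use dirichlet_eigenvalue_eq[OF spec] in simp)
    qed
  qed
  then show ?thesis using \<eta> by blast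
qed

end
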